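(* The variety of complex $3$-dimensional associative algebras has dimension $9$ and it has exactly $8$ irreducible components, namely $$\overline{\mathcal{O}(\mathrm{A}_{07})},\ \overline{\mathcal{O}(\mathrm{A}_{17})},\ \overline{\mathcal{O}(\mathrm{A}_{18})},\ \overline{\mathcal{O}(\mathrm{A}_{19})},\ \overline{\mathcal{O}(\mathrm{A}_{20})},\ \overline{\mathcal{O}(\mathrm{A}_{23})},\ \overline{\mathcal{O}(\mathrm{A}_{24})},\ \overline{\bigcup_{\alpha}\mathcal{O}(\mathrm{A}_{14}^{\alpha})},$$ where in the last one $\alpha$ ranges over $\mathbb{C}\setminus\{0\}$. In particular, there are exactly $7$ rigid algebras (up to isomorphism) in this variety.
   Context: Associative algebras are not assumed to be unital. Let $\mathbb{V}=\mathbb{C}^3$. The variety of complex $3$-dimensional associative algebras is the Zariski-closed subset of $\mathrm{Hom}(\mathbb{V}\otimes\mathbb{V},\mathbb{V})\cong\mathbb{C}^{27}$ (coordinates: structure constants) consisting of the associative multiplications. $\mathrm{GL}(\mathbb{V})$ acts by $(g*\mu)(x\otimes y)=g\mu(g^{-1}x\otimes g^{-1}y)$; $\mathcal{O}(\mathrm{A})$ is the orbit of a structure representing the algebra $\mathrm{A}$, and the bar denotes Zariski closure. An algebra is rigid in the variety if its orbit is an open subset of the variety. The algebras, in a basis $e_1,e_2,e_3$ (products not listed are zero): $\mathrm{A}_{07}$: $e_1e_1=e_1$, $e_2e_2=e_2$, $e_3e_3=e_3$; $\mathrm{A}_{14}^{\alpha}$: $e_1e_2=(1+\alpha)e_3$,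 $e_2e_1=(1-\alpha)e_3$; $\mathrm{A}_{17}$: $e_1e_1=e_1$, $e_1e_2=e_2$, $e_1e_3=e_3$; $\mathrm{A}_{18}$: $e_1e_1=e_1$, $e_2e_1=e_2$, $e_3e_1=e_3$; $\mathrm{A}_{19}$: $e_1e_1=e_1$, $e_1e_3=e_3$, $e_2e_1=e_2$; $\mathrm{A}_{20}$: $e_1e_1=e_1$, $e_1e_3=e_3$, $e_2e_2=e_2$, $e_3e_2=e_3$; $\mathrm{A}_{23}$: $e_1e_1=e_1$, $e_1e_3=e_3$, $e_2e_2=e_2$; $\mathrm{A}_{24}$: $e_1e_1=e_1$, $e_2e_2=e_2$, $e_3e_1=e_3$. *)

theory Defs
  imports "HOL-Analysis.Analysis"
begin

section \<open>Irreducible components and Krull dimension of a topological space\<close>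

definition irreducible_in :: "'a topology \<Rightarrow> 'a set \<Rightarrow> bool" where
  "irreducible_in X S \<longleftrightarrow> S \<subseteq> topspace X \<and> S \<noteq> {} \<and>
     (\<forall>A B. closedin X A \<and> closedin X B \<and> S \<subseteq> A \<union> B \<longrightarrow> S \<subseteq> A \<or> S \<subseteq> B)"

definition irreducible_components :: "'a topology \<Rightarrow> 'a set set" where
  "irreducible_components X =
     {S. irreducible_in X S \<and> (\<forall>T. irreducible_in X T \<and> S \<subseteq> T \<longrightarrow> T = S)}"

text \<open>The supremum is taken in \<^typ>\<open>enat\<close>, so the empty space gets dimension \<open>0\<close>
  instead of the usual \<open>-\<infinity>\<close>.\<close>

definition krull_dim :: "'a topology \<Rightarrow> enat" where
  "krull_dim X = Sup {enat n | n. \<exists>Z :: nat \<Rightarrow> 'a set.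
     (\<forall>i\<le>n. closedin X (Z i) \<and> irreducible_in X (Z i)) \<and> (\<forall>i<n. Z i \<subset> Z (Suc i))}"


section \<open>Multiplications on a coordinate space and the Zariski topology\<close>

text \<open>A bilinear multiplication \<open>\<mu>\<close> is given by its structure constants: \<open>\<mu> $ i $ j\<close> is the
  vector \<open>e\<^sub>i e\<^sub>j\<close>, and \<open>\<mu> $ i $ j $ k\<close> is its \<open>e\<^sub>k\<close>-coordinate.\<close>

type_synonym 'n multiplication = "complex^'n^'n^'n"

definition alg_mult :: "'n::finite multiplication \<Rightarrow> complex^'n \<Rightarrow> complex^'n \<Rightarrow> complex^'n" where
  "alg_mult \<mu> x y = (\<Sum>i\<in>UNIV. \<Sum>j\<in>UNIV. (x $ i * y $ j) *s \<mu> $ i $ j)"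

inductive_set poly_funs :: "('n::finite multiplication \<Rightarrow> complex) set" where
  const: "(\<lambda>_. c) \<in> poly_funs"
| coord: "(\<lambda>\<mu>. \<mu> $ i $ j $ k) \<in> poly_funs"
| add: "p \<in> poly_funs \<Longrightarrow> q \<in> poly_funs \<Longrightarrow> (\<lambda>\<mu>. p \<mu> + q \<mu>) \<in> poly_funs"
| mult: "p \<in> poly_funs \<Longrightarrow> q \<in> poly_funs \<Longrightarrow> (\<lambda>\<mu>. p \<mu> * q \<mu>) \<in> poly_funs"

definition zero_locus :: "('n::finite multiplication \<Rightarrow> complex) set \<Rightarrow> 'n multiplication set" where
  "zero_locus F = {\<mu>. \<forall>p\<in>F. p \<mu> = 0}"

definition zariski :: "'n::finite multiplication topology" where
  "zariski = topology (\<lambda>U. \<exists>F\<subseteq>poly_funs. - U = zero_locus F)"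

lemma istopology_zariski:
  "istopology (\<lambda>U :: 'n::finite multiplication set. \<exists>F\<subseteq>poly_funs. - U = zero_locus F)"
  unfolding istopology_def
proof (intro conjI allI impI)
  fix S T :: "'n multiplication set"
  assume "\<exists>F\<subseteq>poly_funs. - S = zero_locus F" "\<exists>F\<subseteq>poly_funs. - T = zero_locus F"
  then obtain F G where FG: "F \<subseteq> poly_funs" "- S = zero_locus F"
      "G \<subseteq> poly_funs" "- T = zero_locus G" by blast
  let ?H = "{(\<lambda>\<mu>. p \<mu> * q \<mu>) | p q. p \<in> F \<and> q \<in> G}"
  have H: "?H \<subseteq> poly_funs" using FG by (auto intro: poly_funs.mult)
  have "zero_locus ?H = zero_locus F \<union> zero_locus G"
  proof (intro equalityI subsetI)
    fix \<mu> assume \<mu>: "\<mu> \<in> zero_locus ?H"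
    show "\<mu> \<in> zero_locus F \<union> zero_locus G"
    proof (rule ccontr)
      assume "\<mu> \<notin> zero_locus F \<union> zero_locus G"
      then obtain p q where pq: "p \<in> F" "p \<mu> \<noteq> 0" "q \<in> G" "q \<mu> \<noteq> 0"
        by (auto simp: zero_locus_def)
      then have "(\<lambda>\<mu>. p \<mu> * q \<mu>) \<in> ?H" by blast
      moreover have "\<forall>f\<in>?H. f \<mu> = 0" using \<mu> by (simp only: zero_locus_def mem_Collect_eq)
      ultimately have "p \<mu> * q \<mu> = 0" by (rule bspec[rotated])
      with pq show False by simp
    qed
  qed (auto simp: zero_locus_def)
  then have "- (S \<inter> T) = zero_locus ?H" by (simp only: Compl_Int FG)
  with H show "\<exists>F\<subseteq>poly_funs. - (S \<inter> T) = zero_locus F" by (intro exI[of _ ?H] conjI)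
next
  fix \<K> :: "'n multiplication set set"
  assume "\<forall>K\<in>\<K>. \<exists>F\<subseteq>poly_funs. - K = zero_locus F"
  then obtain F where F: "\<And>K. K \<in> \<K> \<Longrightarrow> F K \<subseteq> poly_funs \<and> - K = zero_locus (F K)" by metis
  then have eq: "- K = zero_locus (F K)" if "K \<in> \<K>" for K using that by blast
  have "- \<Union>\<K> = (\<Inter>K\<in>\<K>. - K)" by blast
  also have "\<dots> = (\<Inter>K\<in>\<K>. zero_locus (F K))" using eq by (rule INF_cong[OF refl])
  also have "\<dots> = zero_locus (\<Union>K\<in>\<K>. F K)" by (auto simp: zero_locus_def)
  finally have "- \<Union>\<K> = zero_locus (\<Union>K\<in>\<K>. F K)" .
  moreover have "(\<Union>K\<in>\<K>. F K) \<subseteq> poly_funs" using F by blast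
  ultimately show "\<exists>F\<subseteq>poly_funs. - \<Union>\<K> = zero_locus F" by blast
qed

lemma openin_zariski: "openin zariski U \<longleftrightarrow> (\<exists>F\<subseteq>poly_funs. - U = zero_locus F)"
  unfolding zariski_def topology_inverse'[OF istopology_zariski] ..

lemma topspace_zariski [simp]: "topspace zariski = UNIV"
proof -
  have "zero_locus {\<lambda>_. 1} = {}" by (auto simp: zero_locus_def)
  then have "openin zariski UNIV"
    unfolding openin_zariski by (intro exI[of _ "{\<lambda>_. 1}"]) (auto intro: poly_funs.const)
  then show ?thesis using openin_subset by blast
qed

lemma closedin_zariski: "closedin zariski Z \<longleftrightarrow> (\<exists>F\<subseteq>poly_funs. Z = zero_locus F)"
  by (simp add: closedin_def openin_zariski flip: Compl_eq_Diff_UNIV)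


section \<open>The variety of associative algebras\<close>

definition associative_algebras :: "'n::finite multiplication set" where
  "associative_algebras =
     {\<mu>. \<forall>x y z. alg_mult \<mu> (alg_mult \<mu> x y) z = alg_mult \<mu> x (alg_mult \<mu> y z)}"

definition assoc_variety :: "'n::finite multiplication topology" where
  "assoc_variety = subtopology zariski associative_algebras"

definition gl_act :: "complex^'n^'n \<Rightarrow> 'n::finite multiplication \<Rightarrow> 'n multiplication" where
  "gl_act g \<mu> =
     (\<chi> i j. g *v alg_mult \<mu> (matrix_inv g *v axis i 1) (matrix_inv g *v axis j 1))"

definition gl_orbit :: "'n::finite multiplication \<Rightarrow> 'n multiplication set" where
  "gl_orbit \<mu> = {gl_act g \<mu> | g. invertible g}"

definition alg_isomorphic :: "'n::finite multiplication \<Rightarrow> 'n multiplication \<Rightarrow> bool" where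
  "alg_isomorphic \<mu> \<nu> \<longleftrightarrow> (\<exists>f. Vector_Spaces.linear (*s) (*s) f \<and> bij f \<and>
     (\<forall>x y. f (alg_mult \<mu> x y) = alg_mult \<nu> (f x) (f y)))"

definition rigid_algebra :: "'n::finite multiplication \<Rightarrow> bool" where
  "rigid_algebra \<mu> \<longleftrightarrow> \<mu> \<in> associative_algebras \<and> openin assoc_variety (gl_orbit \<mu>)"

lemma alg_mult_axis [simp]: "alg_mult \<mu> (axis i 1) (axis j 1) = \<mu> $ i $ j"
proof -
  have "(\<Sum>b\<in>UNIV. (axis i 1 $ a * axis j 1 $ b) *s \<mu> $ a $ b)
      = (if a = i then \<mu> $ i $ j else 0)" for a
  proof -
    have "(axis i 1 $ a * axis j 1 $ b) *s \<mu> $ a $ b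
        = (if b = j then (if a = i then \<mu> $ i $ j else 0) else 0)" for b
      by (simp add: axis_def)
    then show ?thesis by simp
  qed
  then show ?thesis by (simp add: alg_mult_def)
qed

lemma alg_mult_gl_act:
  "alg_mult (gl_act g \<mu>) x y = g *v alg_mult \<mu> (matrix_inv g *v x) (matrix_inv g *v y)"
proof -
  let ?h = "matrix_inv g"
  have add1: "alg_mult \<mu> (a + b) c = alg_mult \<mu> a c + alg_mult \<mu> b c" for a b c
    by (simp only: alg_mult_def vector_add_component distrib_right vector_sadd_rdistrib sum.distrib)
  have add2: "alg_mult \<mu> c (a + b) = alg_mult \<mu> c a + alg_mult \<mu> c b" for a b c
    by (simp only: alg_mult_def vector_add_component distrib_left vector_sadd_rdistrib sum.distrib)
  have sc1: "alg_mult \<mu> (r *s a) c = r *s alg_mult \<mu> a c" for r a c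
    by (simp only: alg_mult_def vec.scale_sum_right vec.scale_scale vector_smult_component mult.assoc)
  have sc2: "alg_mult \<mu> c (r *s a) = r *s alg_mult \<mu> c a" for r a c
    by (simp only: alg_mult_def vec.scale_sum_right vec.scale_scale vector_smult_component mult.left_commute)
  have zero1: "alg_mult \<mu> 0 c = 0" and zero2: "alg_mult \<mu> c 0 = 0" for c
    by (simp_all add: alg_mult_def)
  have sum1: "alg_mult \<mu> (\<Sum>i\<in>UNIV. u i) c = (\<Sum>i\<in>UNIV. alg_mult \<mu> (u i) c)" for u :: "'a \<Rightarrow> _" and c
    using sum_comp_morphism[of "\<lambda>a. alg_mult \<mu> a c" u UNIV, OF zero1 add1] by (simp add: o_def)
  have sum2: "alg_mult \<mu> c (\<Sum>i\<in>UNIV. u i) = (\<Sum>i\<in>UNIV. alg_mult \<mu> c (u i))" for u :: "'a \<Rightarrow> _" and c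
    using sum_comp_morphism[of "\<lambda>a. alg_mult \<mu> c a" u UNIV, OF zero2 add2] by (simp add: o_def)
  have mat_sum: "M *v (\<Sum>i\<in>UNIV. u i) = (\<Sum>i\<in>UNIV. M *v u i)"
    for M :: "complex^'a^'a" and u :: "'a \<Rightarrow> complex^'a"
    by (rule vec.linear_sum[OF matrix_vector_mul_linear_gen])
  have mat_sc: "M *v (r *s a) = r *s (M *v a)" for M :: "complex^'a^'a" and r a
    by (simp add: vec_eq_iff matrix_vector_mult_def sum_distrib_left mult.left_commute)
  have dec: "?h *v z = (\<Sum>i\<in>UNIV. z $ i *s (?h *v axis i 1))" for z
  proof -
    have "?h *v z = ?h *v (\<Sum>i\<in>UNIV. z $ i *s axis i 1)" by (simp add: basis_expansion)
    then show ?thesis by (simp only: mat_sum mat_sc)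
  qed
  have "alg_mult \<mu> (?h *v x) (?h *v y) =
      (\<Sum>i\<in>UNIV. \<Sum>j\<in>UNIV. (x $ i * y $ j) *s alg_mult \<mu> (?h *v axis i 1) (?h *v axis j 1))"
    unfolding dec[of x] dec[of y]
    by (subst sum.swap) (simp only: sum1 sum2 sc1 sc2 vec.scale_sum_right vec.scale_scale mult.commute)
  then show ?thesis
    unfolding alg_mult_def[of "gl_act g \<mu>"]
    by (simp only: gl_act_def vec_lambda_beta mat_sum mat_sc)
qed


section \<open>The algebras\<close>

definition mult_table :: "(('n \<times> 'n) \<times> (complex^'n)) list \<Rightarrow> 'n::finite multiplication" where
  "mult_table ps = (\<chi> i j. case map_of ps (i, j) of Some v \<Rightarrow> v | None \<Rightarrow> 0)"

abbreviation bv :: "'n \<Rightarrow> complex^'n::finite" where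
  "bv i \<equiv> axis i 1"

definition A07 :: "3 multiplication" where
  "A07 = mult_table [((1,1), bv 1), ((2,2), bv 2), ((3,3), bv 3)]"

definition A14 :: "complex \<Rightarrow> 3 multiplication" where
  "A14 \<alpha> = mult_table [((1,2), (1 + \<alpha>) *s bv 3), ((2,1), (1 - \<alpha>) *s bv 3)]"

definition A17 :: "3 multiplication" where
  "A17 = mult_table [((1,1), bv 1), ((1,2), bv 2), ((1,3), bv 3)]"

definition A18 :: "3 multiplication" where
  "A18 = mult_table [((1,1), bv 1), ((2,1), bv 2), ((3,1), bv 3)]"

definition A19 :: "3 multiplication" where
  "A19 = mult_table [((1,1), bv 1), ((1,3), bv 3), ((2,1), bv 2)]"

definition A20 :: "3 multiplication" where
  "A20 = mult_table [((1,1), bv 1), ((1,3), bv 3), ((2,2), bv 2), ((3,2), bv 3)]"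

definition A23 :: "3 multiplication" where
  "A23 = mult_table [((1,1), bv 1), ((1,3), bv 3), ((2,2), bv 2)]"

definition A24 :: "3 multiplication" where
  "A24 = mult_table [((1,1), bv 1), ((2,2), bv 2), ((3,1), bv 3)]"

end

theory Submission
  imports Defs "HOL-Computational_Algebra.Fundamental_Theorem_Algebra"
begin

text \<open>Every associative algebra is brought into one of a few normal forms, and each normal form is the
  limit, as \<open>t \<rightarrow> 0\<close>, of structure constants that for \<open>t \<noteq> 0\<close> belong to one of the listed algebras.
  If some \<open>z, z\<^sup>2, z\<^sup>3\<close> are linearly independent, the algebra is a degeneration of \<open>A07\<close> (separate the
  roots of the minimal polynomial). Otherwise either there is no nonzero idempotent, in which case all
  cubes vanish and the multiplication is a bilinear form with values in an annihilating line, or a Peirce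
  decomposition leaves a short list of cases.

  Orbits are images of the polynomial maps \<open>h \<mapsto> adj(h) \<nu>(h \<cdot>, h \<cdot>)\<close>, so their closures are irreducible;
  polynomial identities in the structure constants and the traces of left and right multiplications
  separate them. On the closure of the orbit of \<open>\<nu>\<close> these traces provide a homomorphism to \<open>\<nu>\<close>
  depending polynomially on the algebra, which makes the orbit open; in the family of the \<open>A14 \<alpha>\<close> the
  parameter \<open>\<alpha>\<^sup>2\<close> obstructs openness.

  A strict chain of \<open>n + 1\<close> irreducible closed sets yields \<open>n\<close> algebraically independent functions on
  the largest one. Counting monomials shows \<open>n \<le> 9\<close>, because every component is parametrized by nine
  variables, and an explicit parametrized chain attains the bound.\<close>


section \<open>Irreducible sets\<close>

text \<open>The Peirce rules leave two situations undetermined: a unital algebra, and a plane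
  annihilated by the idempotent \<open>e\<close>. There the reduction to algebras without
  independent \<open>z\<close>, \<open>z\<^sup>2\<close>, \<open>z\<^sup>3\<close> pays off: the
  vanishing of one determinant for every \<open>z\<close> is a polynomial identity, and on the line
  \<open>s *s e + z\<close> its top coefficient in \<open>s\<close> makes \<open>e\<close>,
  \<open>z\<close> and the square of \<open>z\<close> dependent. Openness of the orbits comes after
  the covering result for a reason: except for \<open>A07\<close>, the homomorphism made from traces
  is known to respect products only on the closure of the orbit, so a neighbourhood is cut out by
  removing all other components. Adjugates replace inverse matrices so that every parametrization is
  polynomial; over the complex numbers nothing is lost, because the factor \<open>det h\<close> is
  absorbed by a fourth root. Degenerations are limits in the usual topology, which is legitimate
  because polynomials are continuous and Zariski closed sets are therefore closed in the usual
  sense.\<close>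

lemma irreducible_in_finite_Union:
  assumes "irreducible_in X S" "finite \<C>" "\<And>C. C \<in> \<C> \<Longrightarrow> closedin X C" "S \<subseteq> \<Union>\<C>"
  shows "\<exists>C\<in>\<C>. S \<subseteq> C"
  using assms(2-)
proof (induction \<C>)
  case empty
  then show ?case using assms(1) by (auto simp: irreducible_in_def)
next
  case (insert C \<C>)
  have "closedin X (\<Union>\<C>)" using insert by (intro closedin_Union) auto
  moreover have "closedin X C" "S \<subseteq> C \<union> \<Union>\<C>" using insert by auto
  ultimately have "S \<subseteq> C \<or> S \<subseteq> \<Union>\<C>" using assms(1) unfolding irreducible_in_def by blast
  then show ?case using insert by auto
qed

text \<open>Finiteness puts every irreducible set inside a single member of \<open>\<C>\<close>, so
  maximal irreducible sets are members; the antichain condition then makes each member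
  maximal.\<close>

lemma irreducible_components_eqI:
  assumes "finite \<C>" "\<And>C. C \<in> \<C> \<Longrightarrow> closedin X C" "\<And>C. C \<in> \<C> \<Longrightarrow> irreducible_in X C"
    and "topspace X \<subseteq> \<Union>\<C>"
    and anti: "\<And>C D. C \<in> \<C> \<Longrightarrow> D \<in> \<C> \<Longrightarrow> C \<subseteq> D \<Longrightarrow> C = D"
  shows "irreducible_components X = \<C>"
proof -
  have sub: "\<exists>C\<in>\<C>. S \<subseteq> C" if "irreducible_in X S" for S
    using irreducible_in_finite_Union[OF that assms(1,2)] assms(4) that
    by (auto simp: irreducible_in_def)
  show ?thesis
  proof (intro equalityI subsetI)
    fix S assume "S \<in> irreducible_components X"
    then show "S \<in> \<C>" using sub[of S] assms(3) unfolding irreducible_components_def by blast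
  next
    fix S assume S: "S \<in> \<C>"
    have "T = S" if T: "irreducible_in X T" "S \<subseteq> T" for T
      using sub[OF T(1)] T(2) anti[OF S] by blast
    then show "S \<in> irreducible_components X"
      using assms(3)[OF S] by (auto simp: irreducible_components_def)
  qed
qed

lemma irreducible_in_closure_of:
  assumes "irreducible_in X S"
  shows "irreducible_in X (X closure_of S)"
  unfolding irreducible_in_def
proof (intro conjI allI impI)
  have S: "S \<subseteq> topspace X" "S \<noteq> {}" using assms by (auto simp: irreducible_in_def)
  show "X closure_of S \<subseteq> topspace X" by (rule closure_of_subset_topspace)
  show "X closure_of S \<noteq> {}" using closure_of_subset[OF S(1)] S(2) by blast
  fix A B assume AB: "closedin X A \<and> closedin X B \<and> X closure_of S \<subseteq> A \<union> B"
  then have "S \<subseteq> A \<union> B" using closure_of_subset[OF S(1)] by blast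
  then have "S \<subseteq> A \<or> S \<subseteq> B" using assms AB unfolding irreducible_in_def by blast
  then show "X closure_of S \<subseteq> A \<or> X closure_of S \<subseteq> B" using AB closure_of_minimal by blast
qed

lemma irreducible_in_closed_subtopology:
  assumes "closedin X V"
  shows "irreducible_in (subtopology X V) S \<longleftrightarrow> S \<subseteq> V \<and> irreducible_in X S"
proof -
  have V: "V \<subseteq> topspace X" using assms closedin_subset by blast
  have cl: "closedin (subtopology X V) A \<longleftrightarrow> closedin X A \<and> A \<subseteq> V" for A
    using closedin_closed_subtopology[OF assms] .
  show ?thesis
  proof (intro iffI conjI)
    assume S: "irreducible_in (subtopology X V) S"
    then show SV: "S \<subseteq> V" by (auto simp: irreducible_in_def)
    show "irreducible_in X S" unfolding irreducible_in_def
    proof (intro conjI allI impI)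
      show "S \<subseteq> topspace X" "S \<noteq> {}" using S by (auto simp: irreducible_in_def)
      fix A B assume AB: "closedin X A \<and> closedin X B \<and> S \<subseteq> A \<union> B"
      then have "closedin (subtopology X V) (A \<inter> V)" "closedin (subtopology X V) (B \<inter> V)"
        "S \<subseteq> (A \<inter> V) \<union> (B \<inter> V)"
        using assms SV by (auto simp: cl)
      then show "S \<subseteq> A \<or> S \<subseteq> B" using S unfolding irreducible_in_def by blast
    qed
  next
    assume S: "S \<subseteq> V \<and> irreducible_in X S"
    show "irreducible_in (subtopology X V) S"
      unfolding irreducible_in_def cl using S by (auto simp: irreducible_in_def)
  qed
qed

text \<open>The closed sets \<open>topspace X - U\<close> and \<open>C\<close> cover
  \<open>Y\<close>, and the first one misses a point of \<open>Y\<close>. This spreads an equation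
  from an open part to a whole component.\<close>

lemma irreducible_open_subset_dense:
  assumes "irreducible_in X Y" "closedin X Y" "openin X U" "U \<inter> Y \<noteq> {}" "closedin X C" "U \<inter> Y \<subseteq> C"
  shows "Y \<subseteq> C"
proof -
  have "closedin X (topspace X - U)" using assms(3) by blast
  moreover have "Y \<subseteq> (topspace X - U) \<union> C" using assms(2,6) closedin_subset by blast
  ultimately have "Y \<subseteq> topspace X - U \<or> Y \<subseteq> C"
    using assms(1,5) unfolding irreducible_in_def by blast
  then show ?thesis using assms(4) by blast
qed


section \<open>Polynomial functions and polynomial parametrizations\<close>

lemma poly_funs_sum:
  "(\<And>i. i \<in> A \<Longrightarrow> (\<lambda>\<mu>. f i \<mu>) \<in> poly_funs) \<Longrightarrow> (\<lambda>\<mu>. \<Sum>i\<in>A. f i \<mu>) \<in> poly_funs"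
  by (induction A rule: infinite_finite_induct) (auto intro: poly_funs.intros)

lemma poly_funs_diff:
  assumes "p \<in> poly_funs" "q \<in> poly_funs" shows "(\<lambda>\<mu>. p \<mu> - q \<mu>) \<in> poly_funs"
  using poly_funs.add[OF assms(1) poly_funs.mult[OF poly_funs.const[of "-1"] assms(2)]] by simp

lemma poly_funs_power: "p \<in> poly_funs \<Longrightarrow> (\<lambda>\<mu>. p \<mu> ^ n) \<in> poly_funs"
  by (induction n) (auto intro: poly_funs.intros)

lemmas poly_funs_intros = poly_funs.intros poly_funs_sum poly_funs_diff poly_funs_power

lemma closedin_zero_set: "p \<in> poly_funs \<Longrightarrow> closedin zariski {\<mu>. p \<mu> = 0}"
  unfolding closedin_zariski by (rule exI[of _ "{p}"]) (auto simp: zero_locus_def)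

lemma closedin_eq_set:
  assumes "p \<in> poly_funs" "q \<in> poly_funs" shows "closedin zariski {\<mu>. p \<mu> = q \<mu>}"
  using closedin_zero_set[OF poly_funs_diff[OF assms]] by simp

lemma closedin_zariski_Collect_all:
  "(\<And>i. closedin zariski {\<mu>. P i \<mu>}) \<Longrightarrow> closedin zariski {\<mu>. \<forall>i. P i \<mu>}"
  using closedin_INT[of UNIV zariski "\<lambda>i. {\<mu>. P i \<mu>}"] by (simp add: Collect_all_eq)

lemma closedin_zariski_Collect_conj:
  "closedin zariski {\<mu>. P \<mu>} \<Longrightarrow> closedin zariski {\<mu>. Q \<mu>} \<Longrightarrow> closedin zariski {\<mu>. P \<mu> \<and> Q \<mu>}"
  by (simp add: Collect_conj_eq closedin_Int)

text \<open>Parameters are infinite sequences of which only the first \<open>m\<close> entries may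
  occur. One type thus serves every number of parameters, and \<open>m\<close> is what the dimension
  bound counts.\<close>

inductive_set param_polys :: "nat \<Rightarrow> ((nat \<Rightarrow> complex) \<Rightarrow> complex) set" for m where
  const: "(\<lambda>_. c) \<in> param_polys m"
| var: "i < m \<Longrightarrow> (\<lambda>x. x i) \<in> param_polys m"
| add: "f \<in> param_polys m \<Longrightarrow> g \<in> param_polys m \<Longrightarrow> (\<lambda>x. f x + g x) \<in> param_polys m"
| mult: "f \<in> param_polys m \<Longrightarrow> g \<in> param_polys m \<Longrightarrow> (\<lambda>x. f x * g x) \<in> param_polys m"

lemma param_polys_sum:
  "(\<And>i. i \<in> A \<Longrightarrow> (\<lambda>x. f i x) \<in> param_polys m) \<Longrightarrow> (\<lambda>x. \<Sum>i\<in>A. f i x) \<in> param_polys m"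
  by (induction A rule: infinite_finite_induct) (auto intro: param_polys.intros)

lemma param_polys_diff:
  assumes "f \<in> param_polys m" "g \<in> param_polys m" shows "(\<lambda>x. f x - g x) \<in> param_polys m"
  using param_polys.add[OF assms(1) param_polys.mult[OF param_polys.const[of "-1"] assms(2)]] by simp

lemmas param_polys_intros = param_polys.intros param_polys_sum param_polys_diff

lemma poly_funs_comp_param:
  assumes "p \<in> poly_funs" "\<And>i j k. (\<lambda>x. w x $ i $ j $ k) \<in> param_polys m"
  shows "(\<lambda>x. p (w x)) \<in> param_polys m"
  using assms(1) by induction (auto intro: assms(2) param_polys.intros)

text \<open>Restriction to a line gives a polynomial in one variable, whose finitely many roots
  replace any argument about zero sets in several variables.\<close>

lemma param_polys_line:
  assumes "f \<in> param_polys m"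
  shows "\<exists>P. \<forall>t. f (\<lambda>i. (1 - t) * x i + t * y i) = poly P t"
  using assms
proof induction
  case (const c)
  show ?case by (rule exI[of _ "[:c:]"]) simp
next
  case (var i)
  show ?case by (rule exI[of _ "[:x i, y i - x i:]"]) (simp add: algebra_simps)
next
  case (add f g)
  then show ?case by (metis poly_add)
next
  case (mult f g)
  then show ?case by (metis poly_mult)
qed

text \<open>Two polynomial functions that do not vanish at two points of the image do not vanish
  simultaneously at a generic point of the image of the line through the two parameters.\<close>

lemma irreducible_param_image:
  assumes w: "\<And>i j k. (\<lambda>x. w x $ i $ j $ k) \<in> param_polys m" and \<delta>: "\<delta> \<in> param_polys m"
    and K: "\<And>x y t. x \<in> K \<Longrightarrow> y \<in> K \<Longrightarrow> (\<lambda>i. (1 - t) * x i + t * y i) \<in> K"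
    and ne: "x0 \<in> K" "\<delta> x0 \<noteq> 0"
  shows "irreducible_in zariski (w ` {x\<in>K. \<delta> x \<noteq> 0})"
  unfolding irreducible_in_def
proof (intro conjI allI impI)
  let ?S = "w ` {x\<in>K. \<delta> x \<noteq> 0}"
  show "?S \<subseteq> topspace zariski" by simp
  show "?S \<noteq> {}" using ne by blast
  fix A B assume AB: "closedin zariski A \<and> closedin zariski B \<and> ?S \<subseteq> A \<union> B"
  then obtain F G where F: "F \<subseteq> poly_funs" "A = zero_locus F" and G: "G \<subseteq> poly_funs" "B = zero_locus G"
    unfolding closedin_zariski by blast
  show "?S \<subseteq> A \<or> ?S \<subseteq> B"
  proof (rule ccontr)
    assume "\<not> ?thesis"
    then obtain x y where x: "x \<in> K" "\<delta> x \<noteq> 0" "w x \<notin> A" and y: "y \<in> K" "\<delta> y \<noteq> 0" "w y \<notin> B" by blast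
    obtain p q where p: "p \<in> F" "p (w x) \<noteq> 0" and q: "q \<in> G" "q (w y) \<noteq> 0"
      using x y F G by (auto simp: zero_locus_def)
    let ?l = "\<lambda>t i. (1 - t) * x i + t * y i"
    have "(\<lambda>x. p (w x)) \<in> param_polys m" "(\<lambda>x. q (w x)) \<in> param_polys m"
      using poly_funs_comp_param[OF _ w] p q F G by auto
    from this[THEN param_polys_line, of x y] param_polys_line[OF \<delta>, of x y]
    obtain P Q D where P: "\<And>t. p (w (?l t)) = poly P t" and Q: "\<And>t. q (w (?l t)) = poly Q t"
      and D: "\<And>t. \<delta> (?l t) = poly D t" by blast
    have l: "?l 0 = x" "?l 1 = y" by auto
    have "P \<noteq> 0" "Q \<noteq> 0" "D \<noteq> 0" using P[of 0] Q[of 1] D[of 0] l p q x by auto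
    then have "finite {t. poly (P * Q * D) t = 0}" by (intro poly_roots_finite) simp
    then obtain t where "t \<notin> {t. poly (P * Q * D) t = 0}"
      using infinite_UNIV_char_0 ex_new_if_finite by blast
    then have t: "p (w (?l t)) \<noteq> 0" "q (w (?l t)) \<noteq> 0" "\<delta> (?l t) \<noteq> 0" by (auto simp: P Q D)
    then have "w (?l t) \<in> A \<union> B" using AB K[OF x(1) y(1)] by blast
    then show False using t p q F G by (auto simp: zero_locus_def)
  qed
qed


section \<open>Algebraic independence and dimension\<close>

text \<open>Gaussian elimination: a pivot \<open>M a0 b\<close> removes the unknown
  \<open>a0\<close> from the other equations, and its value \<open>- ?s\<close> is recovered from
  equation \<open>b\<close> at the end.\<close>

lemma homogeneous_system_nontrivial:
  fixes M :: "'a \<Rightarrow> 'b \<Rightarrow> 'c::field"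
  assumes "finite B" "finite A" "card B < card A"
  shows "\<exists>c. (\<exists>a\<in>A. c a \<noteq> 0) \<and> (\<forall>b\<in>B. (\<Sum>a\<in>A. c a * M a b) = 0)"
  using assms
proof (induction B arbitrary: A M rule: finite_induct)
  case empty
  then obtain a where "a \<in> A" by (auto simp: card_gt_0_iff)
  then show ?case by (intro exI[of _ "\<lambda>_. 1"]) auto
next
  case (insert b B)
  show ?case
  proof (cases "\<forall>a\<in>A. M a b = 0")
    case True
    obtain c where "\<exists>a\<in>A. c a \<noteq> 0" "\<forall>b\<in>B. (\<Sum>a\<in>A. c a * M a b) = 0"
      using insert.IH[of A M] insert.prems insert.hyps by auto
    then show ?thesis using True by (intro exI[of _ c]) auto
  next
    case False
    then obtain a0 where a0: "a0 \<in> A" "M a0 b \<noteq> 0" by blast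
    let ?A = "A - {a0}"
    let ?r = "\<lambda>a. M a b / M a0 b"
    have "card B < card ?A" using insert.prems insert.hyps a0 by simp
    then obtain c where c: "\<exists>a\<in>?A. c a \<noteq> 0" "\<And>b'. b' \<in> B \<Longrightarrow> (\<Sum>a\<in>?A. c a * (M a b' - ?r a * M a0 b')) = 0"
      using insert.IH[of ?A "\<lambda>a b'. M a b' - ?r a * M a0 b'"] insert.prems(1) by blast
    let ?s = "\<Sum>a\<in>?A. c a * ?r a"
    let ?c = "c(a0 := - ?s)"
    have sum: "(\<Sum>a\<in>A. ?c a * M a b') = (\<Sum>a\<in>?A. c a * (M a b' - ?r a * M a0 b'))" for b'
    proof -
      have "(\<Sum>a\<in>A. ?c a * M a b') = ?c a0 * M a0 b' + (\<Sum>a\<in>?A. ?c a * M a b')"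
        using sum.remove[OF insert.prems(1) a0(1)] .
      also have "(\<Sum>a\<in>?A. ?c a * M a b') = (\<Sum>a\<in>?A. c a * M a b')" by (intro sum.cong) auto
      finally show ?thesis by (simp add: algebra_simps sum_subtractf sum_distrib_right sum_distrib_left)
    qed
    have "(\<Sum>a\<in>A. ?c a * M a b') = 0" if "b' \<in> insert b B" for b'
      unfolding sum using that c(2) a0(2) by (cases "b' = b") auto
    moreover have "\<exists>a\<in>A. ?c a \<noteq> 0" using c(1) by auto
    ultimately show ?thesis by blast
  qed
qed

section \<open>Monomials and algebraic independence of functions on a set\<close>

definition monom_fun :: "('a \<Rightarrow> complex) list \<Rightarrow> nat list \<Rightarrow> 'a \<Rightarrow> complex" where
  "monom_fun fs ks x = prod_list (map2 (\<lambda>f k. f x ^ k) fs ks)"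

definition exponents :: "nat \<Rightarrow> nat \<Rightarrow> nat list set" where
  "exponents n D = {ks. set ks \<subseteq> {..D} \<and> length ks = n}"

text \<open>The exponents are bounded one by one instead of by total degree. As \<open>D\<close> is
  arbitrary this is the usual notion, and the number of monomials is exactly a power of
  \<open>D + 1\<close>.\<close>

definition alg_independent_on :: "'a set \<Rightarrow> ('a \<Rightarrow> complex) list \<Rightarrow> bool" where
  "alg_independent_on Z fs \<longleftrightarrow> (\<forall>D c.
     (\<forall>x\<in>Z. (\<Sum>ks\<in>exponents (length fs) D. c ks * monom_fun fs ks x) = 0) \<longrightarrow>
     (\<forall>ks\<in>exponents (length fs) D. c ks = 0))"

lemma finite_exponents [simp]: "finite (exponents n D)"
  unfolding exponents_def by (rule finite_lists_length_eq) simp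

lemma card_exponents: "card (exponents n D) = (D + 1) ^ n"
  unfolding exponents_def by (subst card_lists_length_eq) auto

lemma monom_fun_simps [simp]:
  "monom_fun [] [] x = 1" "monom_fun (f # fs) (k # ks) x = f x ^ k * monom_fun fs ks x"
  by (simp_all add: monom_fun_def)

lemma exponents_0 [simp]: "exponents 0 D = {[]}"
  by (auto simp: exponents_def)

lemma sum_exponents_Suc:
  "(\<Sum>ks\<in>exponents (Suc n) D. h ks) = (\<Sum>k\<le>D. \<Sum>ks\<in>exponents n D. h (k # ks))"
proof -
  have "exponents (Suc n) D = (\<lambda>(k, ks). k # ks) ` ({..D} \<times> exponents n D)"
    by (auto simp: exponents_def length_Suc_conv image_iff)
  moreover have "inj_on (\<lambda>(k, ks). k # ks) ({..D} \<times> exponents n D)" by (auto simp: inj_on_def)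
  ultimately have "(\<Sum>ks\<in>exponents (Suc n) D. h ks) = (\<Sum>(k, ks)\<in>{..D} \<times> exponents n D. h (k # ks))"
    by (simp add: sum.reindex case_prod_unfold)
  then show ?thesis by (simp add: sum.cartesian_product)
qed

lemma alg_independent_on_mono:
  "alg_independent_on Z fs \<Longrightarrow> Z \<subseteq> Z' \<Longrightarrow> alg_independent_on Z' fs"
  unfolding alg_independent_on_def by blast

text \<open>Polynomials in \<open>m\<close> variables whose exponents are all at most
  \<open>d\<close>: the bound adds up under products, and the coefficients fill a space of known
  finite dimension.\<close>

definition box_polys :: "nat \<Rightarrow> nat \<Rightarrow> ((nat \<Rightarrow> complex) \<Rightarrow> complex) set" where
  "box_polys m d = {f. \<exists>c. \<forall>x. f x = (\<Sum>es\<in>exponents m d. c es * (\<Prod>i<m. x i ^ (es ! i)))}"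

lemma box_polys_zero: "(\<lambda>_. 0) \<in> box_polys m d"
  unfolding box_polys_def by (auto intro: exI[of _ "\<lambda>_. 0"])

lemma box_polys_add:
  assumes "f \<in> box_polys m d" "g \<in> box_polys m d" shows "(\<lambda>x. f x + g x) \<in> box_polys m d"
proof -
  obtain c c' where "\<forall>x. f x = (\<Sum>es\<in>exponents m d. c es * (\<Prod>i<m. x i ^ (es ! i)))"
    "\<forall>x. g x = (\<Sum>es\<in>exponents m d. c' es * (\<Prod>i<m. x i ^ (es ! i)))"
    using assms by (auto simp: box_polys_def)
  then show ?thesis unfolding box_polys_def
    by (auto intro!: exI[of _ "\<lambda>es. c es + c' es"] simp: algebra_simps sum.distrib)
qed

lemma box_polys_scale:
  assumes "f \<in> box_polys m d" shows "(\<lambda>x. a * f x) \<in> box_polys m d"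
proof -
  obtain c where "\<forall>x. f x = (\<Sum>es\<in>exponents m d. c es * (\<Prod>i<m. x i ^ (es ! i)))"
    using assms by (auto simp: box_polys_def)
  then show ?thesis unfolding box_polys_def
    by (auto intro!: exI[of _ "\<lambda>es. a * c es"] simp: algebra_simps sum_distrib_left)
qed

lemma box_polys_sum:
  "(\<And>i. i \<in> A \<Longrightarrow> (\<lambda>x. f i x) \<in> box_polys m d) \<Longrightarrow> (\<lambda>x. \<Sum>i\<in>A. f i x) \<in> box_polys m d"
  by (induction A rule: infinite_finite_induct) (auto intro: box_polys_zero box_polys_add)

lemma box_polys_monom:
  assumes "es \<in> exponents m d"
  shows "(\<lambda>x. \<Prod>i<m. x i ^ (es ! i)) \<in> box_polys m d"
proof -
  have "(\<Prod>i<m. x i ^ (es ! i)) = (\<Sum>es'\<in>exponents m d. (if es' = es then 1 else 0) * (\<Prod>i<m. x i ^ (es' ! i)))" for x :: "nat \<Rightarrow> complex"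
    using assms by (simp add: if_distrib[of "\<lambda>a. a * _"] cong: if_cong)
  then show ?thesis
    unfolding box_polys_def mem_Collect_eq by (intro exI[of _ "\<lambda>es'. if es' = es then 1 else 0"] allI)
qed

lemma box_polys_mono:
  assumes "f \<in> box_polys m d" "d \<le> d'" shows "f \<in> box_polys m d'"
proof -
  obtain c where f: "f = (\<lambda>x. \<Sum>es\<in>exponents m d. c es * (\<Prod>i<m. x i ^ (es ! i)))"
    using assms unfolding box_polys_def by (auto simp: fun_eq_iff)
  have "exponents m d \<subseteq> exponents m d'" using assms(2) by (auto simp: exponents_def)
  then show ?thesis unfolding f by (intro box_polys_sum box_polys_scale box_polys_monom) auto
qed

lemma box_polys_mult:
  assumes "f \<in> box_polys m d" "g \<in> box_polys m d'" shows "(\<lambda>x. f x * g x) \<in> box_polys m (d + d')"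
proof -
  obtain c c' where f: "f = (\<lambda>x. \<Sum>es\<in>exponents m d. c es * (\<Prod>i<m. x i ^ (es ! i)))"
    and g: "g = (\<lambda>x. \<Sum>es\<in>exponents m d'. c' es * (\<Prod>i<m. x i ^ (es ! i)))"
    using assms unfolding box_polys_def by (auto simp: fun_eq_iff)
  have mon: "(\<lambda>x. (\<Prod>i<m. x i ^ (es ! i)) * (\<Prod>i<m. x i ^ (es' ! i))) \<in> box_polys m (d + d')"
    if "es \<in> exponents m d" "es' \<in> exponents m d'" for es es'
  proof -
    have l: "length es = m" "length es' = m" and b: "\<And>i. i < m \<Longrightarrow> es ! i \<le> d" "\<And>i. i < m \<Longrightarrow> es' ! i \<le> d'"
      using that by (fastforce simp: exponents_def set_conv_nth)+
    have "map2 (+) es es' \<in> exponents m (d + d')"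
      using l b by (auto simp: exponents_def set_conv_nth intro!: add_mono)
    moreover have "(\<Prod>i<m. x i ^ (es ! i)) * (\<Prod>i<m. x i ^ (es' ! i)) = (\<Prod>i<m. x i ^ (map2 (+) es es' ! i))"
      for x :: "nat \<Rightarrow> complex"
      using l by (simp add: power_add prod.distrib)
    ultimately show ?thesis using box_polys_monom by simp
  qed
  have "f x * g x = (\<Sum>es\<in>exponents m d. \<Sum>es'\<in>exponents m d'.
      (c es * c' es') * ((\<Prod>i<m. x i ^ (es ! i)) * (\<Prod>i<m. x i ^ (es' ! i))))" for x
    unfolding f g sum_product by (intro sum.cong refl) (simp add: mult_ac)
  then show ?thesis
    using mon by (simp only:) (intro box_polys_sum box_polys_scale)
qed

lemma box_polys_1: "(\<lambda>_. c) \<in> box_polys m 0"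
proof -
  have "replicate m 0 \<in> exponents m 0" by (auto simp: exponents_def)
  from box_polys_scale[OF box_polys_monom[OF this], of c] show ?thesis by simp
qed

lemma param_polys_imp_box: "f \<in> param_polys m \<Longrightarrow> \<exists>d. f \<in> box_polys m d"
proof (induction rule: param_polys.induct)
  case (const c)
  then show ?case using box_polys_1 by blast
next
  case (var i)
  have "(replicate m 0)[i := 1] \<in> exponents m 1"
    using set_update_subset_insert[of "replicate m 0" i "1::nat"] by (auto simp: exponents_def)
  moreover have "(\<Prod>j<m. x j ^ ((replicate m 0)[i := 1] ! j)) = x i" for x :: "nat \<Rightarrow> complex"
  proof -
    have "(\<Prod>j<m. x j ^ ((replicate m 0)[i := 1] ! j)) = (\<Prod>j<m. if j = i then x j else 1)"
      using var by (intro prod.cong) (auto simp: nth_list_update)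
    then show ?thesis using var by simp
  qed
  ultimately show ?case using box_polys_monom[of "(replicate m 0)[i := 1]" m 1] by auto
next
  case (add f g)
  then obtain d d' where "f \<in> box_polys m d" "g \<in> box_polys m d'" by blast
  then have "f \<in> box_polys m (max d d')" "g \<in> box_polys m (max d d')" by (auto intro: box_polys_mono)
  then show ?case using box_polys_add by blast
next
  case (mult f g)
  then show ?case using box_polys_mult by blast
qed

lemma box_polys_power: "f \<in> box_polys m d \<Longrightarrow> (\<lambda>x. f x ^ k) \<in> box_polys m (k * d)"
proof (induction k)
  case (Suc k)
  then show ?case using box_polys_mult[of f m d "\<lambda>x. f x ^ k" "k * d"] by simp
qed (simp add: box_polys_1)

lemma box_polys_monom_fun:
  assumes "\<forall>f\<in>set fs. (\<lambda>x. f (w x)) \<in> box_polys m d" "ks \<in> exponents (length fs) D"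
  shows "(\<lambda>x. monom_fun fs ks (w x)) \<in> box_polys m (length fs * (D * d))"
  using assms
proof (induction fs arbitrary: ks)
  case Nil
  then show ?case by (simp add: box_polys_1)
next
  case (Cons f fs)
  then obtain k ks' where ks: "ks = k # ks'" "k \<le> D" "ks' \<in> exponents (length fs) D"
    by (auto simp: exponents_def length_Suc_conv)
  have "(\<lambda>x. f (w x) ^ k) \<in> box_polys m (D * d)"
    using Cons.prems ks by (intro box_polys_mono[OF box_polys_power]) auto
  moreover have "(\<lambda>x. monom_fun fs ks' (w x)) \<in> box_polys m (length fs * (D * d))"
    using Cons ks by auto
  ultimately show ?case using box_polys_mult ks by fastforce
qed

text \<open>There are \<open>(D + 1)\<^sup>n\<close> monomials in \<open>n\<close> functions with exponents up to \<open>D\<close>, but after the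
  substitution they live in a space of dimension \<open>O(D\<^sup>m)\<close>.\<close>

lemma not_alg_independent_param:
  assumes fs: "\<forall>f\<in>set fs. (\<lambda>x. f (w x)) \<in> param_polys m" and len: "m < length fs"
  shows "\<not> alg_independent_on (range w) fs"
proof -
  let ?n = "length fs"
  have "\<exists>d. \<forall>f\<in>set fs. (\<lambda>x. f (w x)) \<in> box_polys m d"
    using fs
  proof (induction fs)
    case (Cons f fs)
    then obtain d d' where "\<forall>f\<in>set fs. (\<lambda>x. f (w x)) \<in> box_polys m d" "(\<lambda>x. f (w x)) \<in> box_polys m d'"
      using param_polys_imp_box by auto meson
    then show ?case by (intro exI[of _ "max d d'"]) (auto intro: box_polys_mono)
  qed simp
  then obtain d where d: "\<forall>f\<in>set fs. (\<lambda>x. f (w x)) \<in> box_polys m d" by blast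
  \<comment> \<open>\<open>C\<close> is chosen so that \<open>?N + 1 \<le> C * (D + 1)\<close>, and
    \<open>D = C ^ m\<close> so that the constant factor \<open>C ^ m\<close> is beaten by the one
    additional power of \<open>D + 1\<close> that \<open>m < ?n\<close> provides.\<close>
  define C where "C = ?n * d + 1"
  define D where "D = C ^ m"
  let ?N = "?n * (D * d)"
  have "(?N + 1) ^ m \<le> (C * (D + 1)) ^ m"
    by (intro power_mono) (auto simp: C_def algebra_simps)
  also have "\<dots> = D * (D + 1) ^ m" by (simp only: D_def power_mult_distrib)
  also have "\<dots> < (D + 1) ^ Suc m" by simp
  also have "\<dots> \<le> (D + 1) ^ ?n" using len by (intro power_increasing) auto
  finally have card: "card (exponents m ?N) < card (exponents ?n D)" by (simp add: card_exponents)
  have "\<forall>ks\<in>exponents ?n D. \<exists>M. \<forall>x. monom_fun fs ks (w x) = (\<Sum>es\<in>exponents m ?N. M es * (\<Prod>i<m. x i ^ (es ! i)))"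
    using box_polys_monom_fun[OF d] by (auto simp: box_polys_def)
  then obtain M where M: "\<And>ks x. ks \<in> exponents ?n D \<Longrightarrow>
      monom_fun fs ks (w x) = (\<Sum>es\<in>exponents m ?N. M ks es * (\<Prod>i<m. x i ^ (es ! i)))"
    by metis
  obtain c where c: "\<exists>ks\<in>exponents ?n D. c ks \<noteq> 0"
      "\<And>es. es \<in> exponents m ?N \<Longrightarrow> (\<Sum>ks\<in>exponents ?n D. c ks * M ks es) = 0"
    using homogeneous_system_nontrivial[OF finite_exponents finite_exponents card, of M] by blast
  have "(\<Sum>ks\<in>exponents ?n D. c ks * monom_fun fs ks (w x)) = 0" for x
  proof -
    have "(\<Sum>ks\<in>exponents ?n D. c ks * monom_fun fs ks (w x)) =
        (\<Sum>ks\<in>exponents ?n D. \<Sum>es\<in>exponents m ?N. c ks * M ks es * (\<Prod>i<m. x i ^ (es ! i)))"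
      by (simp add: M sum_distrib_left mult.assoc)
    also have "\<dots> = (\<Sum>es\<in>exponents m ?N. (\<Sum>ks\<in>exponents ?n D. c ks * M ks es) * (\<Prod>i<m. x i ^ (es ! i)))"
      by (subst sum.swap) (simp add: sum_distrib_right)
    finally show ?thesis by (simp add: c(2))
  qed
  then show ?thesis using c(1) unfolding alg_independent_on_def by blast
qed

lemma poly_funs_monom_fun:
  fixes fs :: "('n::finite multiplication \<Rightarrow> complex) list"
  shows "set fs \<subseteq> poly_funs \<Longrightarrow> length ks = length fs \<Longrightarrow> monom_fun fs ks \<in> poly_funs"
proof (induction fs arbitrary: ks)
  case Nil
  then have "monom_fun ([] :: ('n multiplication \<Rightarrow> complex) list) ks = (\<lambda>_. 1)" by auto
  then show ?case using poly_funs.const[of 1] by (simp only:)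
next
  case (Cons f fs)
  then obtain k ks' where ks: "ks = k # ks'" "length ks' = length fs" by (auto simp: length_Suc_conv)
  then have "monom_fun (f # fs) ks = (\<lambda>x. f x ^ k * monom_fun fs ks' x)" by auto
  then show ?case using Cons ks by (auto intro: poly_funs_intros)
qed

text \<open>The ring of polynomial functions on an irreducible set is an integral domain; this is
  what permits cancelling a power of a function.\<close>

lemma irreducible_in_no_zero_divisors:
  assumes "irreducible_in zariski Z" "p \<in> poly_funs" "q \<in> poly_funs"
    and "\<And>\<mu>. \<mu> \<in> Z \<Longrightarrow> p \<mu> * q \<mu> = 0" "\<nu> \<in> Z" "p \<nu> \<noteq> 0" "\<mu> \<in> Z"
  shows "q \<mu> = 0"
proof -
  have "Z \<subseteq> {\<mu>. p \<mu> = 0} \<union> {\<mu>. q \<mu> = 0}" using assms(4) by auto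
  then have "Z \<subseteq> {\<mu>. p \<mu> = 0} \<or> Z \<subseteq> {\<mu>. q \<mu> = 0}"
    using assms(1) closedin_zero_set[OF assms(2)] closedin_zero_set[OF assms(3)]
    unfolding irreducible_in_def by blast
  then show ?thesis using assms by blast
qed

text \<open>In a relation that holds on \<open>Z'\<close>, cancel the lowest power of \<open>f\<close> and restrict to \<open>Z\<close>, where only
  the terms without \<open>f\<close> survive.\<close>

lemma alg_independent_on_Cons:
  assumes fs: "set fs \<subseteq> poly_funs" and ind: "alg_independent_on Z fs" and "Z \<subseteq> Z'"
    and irr: "irreducible_in zariski Z'" and f: "f \<in> poly_funs" "\<And>\<mu>. \<mu> \<in> Z \<Longrightarrow> f \<mu> = 0"
    and \<nu>: "\<nu> \<in> Z'" "f \<nu> \<noteq> 0"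
  shows "alg_independent_on Z' (f # fs)"
  unfolding alg_independent_on_def
proof (intro allI impI)
  fix D c
  let ?E = "exponents (length fs) D"
  assume "\<forall>x\<in>Z'. (\<Sum>ks\<in>exponents (length (f # fs)) D. c ks * monom_fun (f # fs) ks x) = 0"
  then have eq: "(\<Sum>k\<le>D. \<Sum>ks\<in>?E. c (k # ks) * (f x ^ k * monom_fun fs ks x)) = 0" if "x \<in> Z'" for x
    using that by (simp add: sum_exponents_Suc)
  define g where "g k x = (\<Sum>ks\<in>?E. c (k # ks) * monom_fun fs ks x)" for k x
  have gp: "(\<lambda>x. g k x) \<in> poly_funs" for k
    unfolding g_def using poly_funs_monom_fun[OF fs] by (intro poly_funs_sum poly_funs.mult poly_funs.const) (auto simp: exponents_def)
  have eq: "(\<Sum>k\<le>D. f x ^ k * g k x) = 0" if "x \<in> Z'" for x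
    using eq[OF that] by (simp add: g_def sum_distrib_left algebra_simps)
  have c0: "\<forall>ks\<in>?E. c (k # ks) = 0" if "k \<le> D" for k
    using that
  proof (induction k rule: less_induct)
    case (less k)
    have g0: "g j x = 0" if "j < k" for j x
      using less that by (auto simp: g_def intro!: sum.neutral)
    define r where "r x = (\<Sum>j\<in>{Suc k..D}. f x ^ (j - Suc k) * g j x)" for x
    have split: "(\<Sum>j\<le>D. f x ^ j * g j x) = f x ^ k * (g k x + f x * r x)" for x
    proof -
      have "(\<Sum>j\<le>D. f x ^ j * g j x) = (\<Sum>j\<in>{k..D}. f x ^ j * g j x)"
        using g0 by (intro sum.mono_neutral_right) auto
      also have "\<dots> = f x ^ k * g k x + (\<Sum>j\<in>{Suc k..D}. f x ^ j * g j x)"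
        using less by (simp add: sum.atLeast_Suc_atMost)
      also have "(\<Sum>j\<in>{Suc k..D}. f x ^ j * g j x) = f x ^ k * (f x * r x)"
        unfolding r_def sum_distrib_left
      proof (intro sum.cong refl)
        fix j assume "j \<in> {Suc k..D}"
        then have "j = k + Suc (j - Suc k)" by auto
        then have "f x ^ j = f x ^ k * (f x * f x ^ (j - Suc k))" by (metis power_add power_Suc)
        then show "f x ^ j * g j x = f x ^ k * (f x * (f x ^ (j - Suc k) * g j x))" by (simp add: mult_ac)
      qed
      finally show ?thesis by (simp add: algebra_simps)
    qed
    have rp: "(\<lambda>x. r x) \<in> poly_funs" unfolding r_def using f(1) gp by (intro poly_funs_sum poly_funs.mult poly_funs_power)
    have "g k \<mu> + f \<mu> * r \<mu> = 0" if "\<mu> \<in> Z'" for \<mu>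
      by (rule irreducible_in_no_zero_divisors[OF irr poly_funs_power[OF f(1)], of _ k])
        (use rp gp f eq split \<nu> that in \<open>auto intro: poly_funs.intros\<close>)
    then have "g k \<mu> = 0" if "\<mu> \<in> Z" for \<mu> using that f(2) \<open>Z \<subseteq> Z'\<close> by fastforce
    then have "\<forall>x\<in>Z. (\<Sum>ks\<in>?E. c (k # ks) * monom_fun fs ks x) = 0" by (simp add: g_def)
    then show ?case using ind[unfolded alg_independent_on_def, THEN spec[of _ D], THEN spec[of _ "\<lambda>ks. c (k # ks)"]]
      by simp
  qed
  show "\<forall>ks\<in>exponents (length (f # fs)) D. c ks = 0"
    using c0 by (fastforce simp: exponents_def length_Suc_conv)
qed

text \<open>Each strict inclusion supplies a function that vanishes on the smaller set but not on
  the larger one; it is independent of those collected so far. On the nonempty bottom set the empty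
  list is independent.\<close>

lemma chain_alg_independent:
  assumes "\<forall>i\<le>n. closedin zariski (Z i) \<and> irreducible_in zariski (Z i)" "\<forall>i<n. Z i \<subset> Z (Suc i)"
  shows "\<exists>fs. length fs = n \<and> set fs \<subseteq> poly_funs \<and> alg_independent_on (Z n) fs"
  using assms
proof (induction n)
  case 0
  then have "Z 0 \<noteq> {}" by (auto simp: irreducible_in_def)
  then show ?case by (auto simp: alg_independent_on_def)
next
  case (Suc n)
  have "\<exists>fs. length fs = n \<and> set fs \<subseteq> poly_funs \<and> alg_independent_on (Z n) fs"
    using Suc.prems by (intro Suc.IH) auto
  then obtain fs where fs: "length fs = n" "set fs \<subseteq> poly_funs" "alg_independent_on (Z n) fs" by blast
  have "closedin zariski (Z n)" using Suc.prems by simp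
  then obtain F where F: "F \<subseteq> poly_funs" "Z n = zero_locus F" unfolding closedin_zariski by blast
  obtain \<nu> where \<nu>: "\<nu> \<in> Z (Suc n)" "\<nu> \<notin> Z n" using Suc.prems by blast
  then obtain f where f: "f \<in> F" "f \<nu> \<noteq> 0" using F by (auto simp: zero_locus_def)
  have "alg_independent_on (Z (Suc n)) (f # fs)"
  proof (rule alg_independent_on_Cons[where f = f and Z = "Z n" and Z' = "Z (Suc n)" and \<nu> = \<nu>, OF fs(2,3) _ _ _ _ \<nu>(1) f(2)])
    show "Z n \<subseteq> Z (Suc n)" "irreducible_in zariski (Z (Suc n))" using Suc.prems by auto
    show "f \<in> poly_funs" "\<And>\<mu>. \<mu> \<in> Z n \<Longrightarrow> f \<mu> = 0" using f(1) F by (auto simp: zero_locus_def)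
  qed
  then show ?case using fs f F by (intro exI[of _ "f # fs"]) auto
qed

lemma alg_independent_on_closure:
  assumes "alg_independent_on (zariski closure_of S) fs" "set fs \<subseteq> poly_funs"
  shows "alg_independent_on S fs"
  unfolding alg_independent_on_def
proof (intro allI impI)
  fix D c
  let ?p = "\<lambda>x. \<Sum>ks\<in>exponents (length fs) D. c ks * monom_fun fs ks x"
  assume "\<forall>x\<in>S. ?p x = 0"
  moreover have "?p \<in> poly_funs"
    using poly_funs_monom_fun[OF assms(2)] by (intro poly_funs_sum poly_funs.mult poly_funs.const) (auto simp: exponents_def)
  ultimately have "zariski closure_of S \<subseteq> {x. ?p x = 0}"
    by (intro closure_of_minimal closedin_zero_set) auto
  then show "\<forall>ks\<in>exponents (length fs) D. c ks = 0"
    using assms(1) unfolding alg_independent_on_def by blast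
qed

text \<open>A polynomial relation that holds on the image of \<open>w\<close> holds on its closure,
  so functions independent on \<open>Z n\<close> stay independent along \<open>w\<close>, where at
  most \<open>m\<close> of them can be.\<close>

lemma chain_length_le_params:
  assumes "\<forall>i\<le>n. closedin zariski (Z i) \<and> irreducible_in zariski (Z i)" "\<forall>i<n. Z i \<subset> Z (Suc i)"
    and "Z n \<subseteq> zariski closure_of (range w)"
    and w: "\<And>i j k. (\<lambda>x. w x $ i $ j $ k) \<in> param_polys m"
  shows "n \<le> m"
proof (rule ccontr)
  assume "\<not> n \<le> m"
  obtain fs where fs: "length fs = n" "set fs \<subseteq> poly_funs" "alg_independent_on (Z n) fs"
    using chain_alg_independent[OF assms(1,2)] by blast
  then have "alg_independent_on (range w) fs"
    using alg_independent_on_closure alg_independent_on_mono assms(3) by blast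
  moreover have "\<forall>f\<in>set fs. (\<lambda>x. f (w x)) \<in> param_polys m" using fs poly_funs_comp_param[OF _ w] by blast
  ultimately show False using not_alg_independent_param \<open>\<not> n \<le> m\<close> fs(1) by (metis not_le)
qed


section \<open>Homomorphisms and orbits\<close>

lemma alg_mult_component:
  "alg_mult \<mu> x y $ k = (\<Sum>i\<in>UNIV. \<Sum>j\<in>UNIV. x $ i * y $ j * \<mu> $ i $ j $ k)"
  by (simp add: alg_mult_def)

lemma alg_mult_add_left: "alg_mult \<mu> (x + y) z = alg_mult \<mu> x z + alg_mult \<mu> y z"
  by (simp add: vec_eq_iff alg_mult_component distrib_right sum.distrib)

lemma alg_mult_add_right: "alg_mult \<mu> z (x + y) = alg_mult \<mu> z x + alg_mult \<mu> z y"
  by (simp add: vec_eq_iff alg_mult_component distrib_left distrib_right sum.distrib)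

lemma alg_mult_smult_left: "alg_mult \<mu> (c *s x) y = c *s alg_mult \<mu> x y"
  by (simp add: vec_eq_iff alg_mult_component sum_distrib_left mult.assoc)

lemma alg_mult_smult_right: "alg_mult \<mu> x (c *s y) = c *s alg_mult \<mu> x y"
  by (simp add: vec_eq_iff alg_mult_component sum_distrib_left mult_ac)

lemma alg_mult_zero [simp]: "alg_mult \<mu> 0 y = 0" "alg_mult \<mu> x 0 = 0"
  by (simp_all add: alg_mult_def)

lemma alg_mult_diff_left: "alg_mult \<mu> (x - y) z = alg_mult \<mu> x z - alg_mult \<mu> y z"
  by (simp add: vec_eq_iff alg_mult_component left_diff_distrib sum_subtractf)

lemma alg_mult_diff_right: "alg_mult \<mu> z (x - y) = alg_mult \<mu> z x - alg_mult \<mu> z y"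
  by (simp add: vec_eq_iff alg_mult_component left_diff_distrib right_diff_distrib sum_subtractf)

lemmas alg_mult_bilinear = alg_mult_add_left alg_mult_add_right alg_mult_smult_left
  alg_mult_smult_right alg_mult_diff_left alg_mult_diff_right

lemma alg_mult_sum_left: "alg_mult \<mu> (\<Sum>i\<in>A. f i) y = (\<Sum>i\<in>A. alg_mult \<mu> (f i) y)"
  by (induction A rule: infinite_finite_induct) (auto simp: alg_mult_add_left)

lemma alg_mult_sum_right: "alg_mult \<mu> x (\<Sum>i\<in>A. f i) = (\<Sum>i\<in>A. alg_mult \<mu> x (f i))"
  by (induction A rule: infinite_finite_induct) (auto simp: alg_mult_add_right)

lemma matrix_vector_mult_axis: "(h :: complex^'n^'m) *v axis j 1 = column j h"
  by (simp add: vec_eq_iff matrix_vector_mult_def column_def axis_def if_distrib cong: if_cong)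

lemma matrix_vector_mult_smult: "(h :: complex^'n^'m) *v (c *s x) = c *s (h *v x)"
  by (simp add: vec_eq_iff matrix_vector_mult_def sum_distrib_left mult_ac)

text \<open>Invertibility is deliberately not included: the openness proofs first build such a
  matrix for every algebra in a closure and only afterwards look at its determinant.\<close>

definition alg_hom :: "complex^'n^'n \<Rightarrow> 'n::finite multiplication \<Rightarrow> 'n multiplication \<Rightarrow> bool" where
  "alg_hom h \<mu> \<nu> \<longleftrightarrow> (\<forall>x y. h *v alg_mult \<mu> x y = alg_mult \<nu> (h *v x) (h *v y))"

lemma alg_hom_columns:
  "alg_hom h \<mu> \<nu> \<longleftrightarrow> (\<forall>i j. h *v \<mu> $ i $ j = alg_mult \<nu> (column i h) (column j h))"
proof
  assume "alg_hom h \<mu> \<nu>"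
  then have "h *v alg_mult \<mu> (axis i 1) (axis j 1) = alg_mult \<nu> (h *v axis i 1) (h *v axis j 1)" for i j
    by (simp only: alg_hom_def)
  then show "\<forall>i j. h *v \<mu> $ i $ j = alg_mult \<nu> (column i h) (column j h)"
    by (simp add: matrix_vector_mult_axis)
next
  assume eq: "\<forall>i j. h *v \<mu> $ i $ j = alg_mult \<nu> (column i h) (column j h)"
  show "alg_hom h \<mu> \<nu>"
    unfolding alg_hom_def
  proof (intro allI)
    fix x y
    have "h *v alg_mult \<mu> x y = (\<Sum>i\<in>UNIV. \<Sum>j\<in>UNIV. (x $ i * y $ j) *s (h *v \<mu> $ i $ j))"
      unfolding alg_mult_def by (simp add: vec.linear_sum[OF matrix_vector_mul_linear_gen] matrix_vector_mult_smult)
    also have "\<dots> = (\<Sum>i\<in>UNIV. \<Sum>j\<in>UNIV. alg_mult \<nu> (x $ i *s column i h) (y $ j *s column j h))"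
      using eq by (simp add: alg_mult_smult_left alg_mult_smult_right mult.commute)
    also have "\<dots> = alg_mult \<nu> (h *v x) (h *v y)"
      unfolding matrix_mult_sum alg_mult_sum_left by (simp only: alg_mult_sum_right)
    finally show "h *v alg_mult \<mu> x y = alg_mult \<nu> (h *v x) (h *v y)" .
  qed
qed

lemma multiplication_eqI:
  fixes \<mu> \<nu> :: "'n::finite multiplication"
  assumes "\<And>x y. alg_mult \<mu> x y = alg_mult \<nu> x y"
  shows "\<mu> = \<nu>"
  using assms alg_mult_axis by (metis vec_eq_iff)

lemma alg_hom_comp: "alg_hom g \<nu> \<rho> \<Longrightarrow> alg_hom h \<mu> \<nu> \<Longrightarrow> alg_hom (g ** h) \<mu> \<rho>"
  by (simp add: alg_hom_def flip: matrix_vector_mul_assoc)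

lemma matrix_inv_cancel:
  assumes "invertible (h :: complex^'n^'n)"
  shows "matrix_inv h *v (h *v x) = x" "h *v (matrix_inv h *v x) = x"
proof -
  have "h ** matrix_inv h = mat 1 \<and> matrix_inv h ** h = mat 1"
    using assms unfolding invertible_def matrix_inv_def by (rule someI_ex)
  then show "matrix_inv h *v (h *v x) = x" "h *v (matrix_inv h *v x) = x"
    by (simp_all add: matrix_vector_mul_assoc)
qed

lemma invertible_matrix_inv: "invertible (h :: complex^'n^'n) \<Longrightarrow> invertible (matrix_inv h)"
proof -
  assume "invertible h"
  then have "h ** matrix_inv h = mat 1 \<and> matrix_inv h ** h = mat 1"
    unfolding invertible_def matrix_inv_def by (rule someI_ex)
  then show ?thesis unfolding invertible_def by blast
qed

lemma invertible_cancel_iff: "invertible (h :: complex^'n^'n) \<Longrightarrow> h *v x = h *v y \<longleftrightarrow> x = y"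
  using matrix_inv_cancel(1) by metis

lemma alg_hom_inv:
  assumes "invertible h" "alg_hom h \<mu> \<nu>"
  shows "alg_hom (matrix_inv h) \<nu> \<mu>"
  unfolding alg_hom_def
proof (intro allI)
  fix x y
  let ?g = "matrix_inv h"
  have "h *v alg_mult \<mu> (?g *v x) (?g *v y) = alg_mult \<nu> x y"
    using assms(2) unfolding alg_hom_def by (simp add: matrix_inv_cancel[OF assms(1)])
  then show "?g *v alg_mult \<nu> x y = alg_mult \<mu> (?g *v x) (?g *v y)"
    using matrix_inv_cancel(1)[OF assms(1)] by metis
qed

lemma alg_hom_gl_act:
  assumes "invertible g"
  shows "alg_hom g \<mu> (gl_act g \<mu>)"
  by (simp add: alg_hom_def alg_mult_gl_act matrix_inv_cancel[OF assms])

lemma alg_hom_imp_gl_act: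
  assumes "invertible g" "alg_hom g \<mu> \<nu>"
  shows "\<nu> = gl_act g \<mu>"
proof (rule multiplication_eqI)
  fix x y
  show "alg_mult \<nu> x y = alg_mult (gl_act g \<mu>) x y"
    using assms(2) unfolding alg_hom_def by (simp add: alg_mult_gl_act matrix_inv_cancel[OF assms(1)])
qed

abbreviation orbit_closure :: "'n::finite multiplication \<Rightarrow> 'n multiplication set" where
  "orbit_closure \<nu> \<equiv> zariski closure_of gl_orbit \<nu>"

lemma gl_orbit_iff: "\<mu> \<in> gl_orbit \<nu> \<longleftrightarrow> (\<exists>h. invertible h \<and> alg_hom h \<mu> \<nu>)"
proof
  assume "\<mu> \<in> gl_orbit \<nu>"
  then obtain g where g: "invertible g" "\<mu> = gl_act g \<nu>" by (auto simp: gl_orbit_def)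
  then show "\<exists>h. invertible h \<and> alg_hom h \<mu> \<nu>"
    using alg_hom_inv[OF g(1) alg_hom_gl_act[OF g(1)]] invertible_matrix_inv by blast
next
  assume "\<exists>h. invertible h \<and> alg_hom h \<mu> \<nu>"
  then obtain h where h: "invertible h" "alg_hom h \<mu> \<nu>" by blast
  then show "\<mu> \<in> gl_orbit \<nu>"
    using alg_hom_imp_gl_act[OF invertible_matrix_inv alg_hom_inv] invertible_matrix_inv
    unfolding gl_orbit_def by blast
qed

lemma gl_orbit_refl: "\<mu> \<in> gl_orbit \<mu>"
proof -
  have "invertible (mat 1 :: complex^'a^'a)" unfolding invertible_def by (rule exI[of _ "mat 1"]) simp
  moreover have "alg_hom (mat 1) \<mu> \<mu>" by (simp add: alg_hom_def)
  ultimately show ?thesis unfolding gl_orbit_iff by blast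
qed

lemma gl_orbit_sym: "\<mu> \<in> gl_orbit \<nu> \<Longrightarrow> \<nu> \<in> gl_orbit \<mu>"
  unfolding gl_orbit_iff using alg_hom_inv invertible_matrix_inv by blast

lemma gl_orbit_trans: "\<mu> \<in> gl_orbit \<nu> \<Longrightarrow> \<nu> \<in> gl_orbit \<rho> \<Longrightarrow> \<mu> \<in> gl_orbit \<rho>"
  unfolding gl_orbit_iff using alg_hom_comp invertible_mult by blast

lemma gl_orbit_eq: "\<mu> \<in> gl_orbit \<nu> \<Longrightarrow> gl_orbit \<mu> = gl_orbit \<nu>"
  using gl_orbit_sym gl_orbit_trans by blast

lemma associative_gl_orbit:
  assumes "\<nu> \<in> associative_algebras" "\<mu> \<in> gl_orbit \<nu>"
  shows "\<mu> \<in> associative_algebras"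
proof -
  obtain h where h: "invertible h" "\<And>x y. h *v alg_mult \<mu> x y = alg_mult \<nu> (h *v x) (h *v y)"
    using assms(2) by (auto simp: gl_orbit_iff alg_hom_def)
  have "h *v alg_mult \<mu> (alg_mult \<mu> x y) z = h *v alg_mult \<mu> x (alg_mult \<mu> y z)" for x y z
    using assms(1) by (simp add: h(2) associative_algebras_def)
  then show ?thesis using invertible_cancel_iff[OF h(1)] by (simp add: associative_algebras_def)
qed

lemma alg_isomorphic_iff: "alg_isomorphic \<mu> \<nu> \<longleftrightarrow> \<mu> \<in> gl_orbit \<nu>"
proof
  assume "alg_isomorphic \<mu> \<nu>"
  then obtain f where f: "Vector_Spaces.linear (*s) (*s) f" "bij f"
      "\<And>x y. f (alg_mult \<mu> x y) = alg_mult \<nu> (f x) (f y)"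
    by (auto simp: alg_isomorphic_def)
  have m: "matrix f *v x = f x" for x using matrix_works[OF f(1)] by simp
  then have "alg_hom (matrix f) \<mu> \<nu>" using f(3) by (simp add: alg_hom_def)
  moreover have "inj f" using f(2) by (rule bij_is_inj)
  then have "inj ((*v) (matrix f))" by (simp add: m inj_def)
  then have "invertible (matrix f)"
    using matrix_left_invertible_injective invertible_left_inverse by blast
  ultimately show "\<mu> \<in> gl_orbit \<nu>" unfolding gl_orbit_iff by blast
next
  assume "\<mu> \<in> gl_orbit \<nu>"
  then obtain h where h: "invertible h" "alg_hom h \<mu> \<nu>" by (auto simp: gl_orbit_iff)
  have "bij ((*v) h)" using matrix_inv_cancel[OF h(1)] by (metis bijI')
  then show "alg_isomorphic \<mu> \<nu>"
    using h(2) matrix_vector_mul_linear_gen unfolding alg_isomorphic_def alg_hom_def by blast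
qed


section \<open>The Zariski topology and the group action\<close>

lemma poly_funs_alg_mult:
  assumes "\<And>i. (\<lambda>\<mu>. x \<mu> $ i) \<in> poly_funs" "\<And>i. (\<lambda>\<mu>. y \<mu> $ i) \<in> poly_funs"
  shows "(\<lambda>\<mu>. alg_mult \<mu> (x \<mu>) (y \<mu>) $ k) \<in> poly_funs"
  unfolding alg_mult_component by (intro poly_funs_sum poly_funs.mult poly_funs.coord assms)

lemma closedin_zariski_vec_eq:
  assumes "\<And>i. (\<lambda>\<mu>. f \<mu> $ i) \<in> poly_funs" "\<And>i. (\<lambda>\<mu>. g \<mu> $ i) \<in> poly_funs"
  shows "closedin zariski {\<mu>. f \<mu> = g \<mu>}"
  unfolding vec_eq_iff by (intro closedin_zariski_Collect_all closedin_eq_set assms)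

lemma closedin_associative: "closedin zariski (associative_algebras :: 'n::finite multiplication set)"
proof -
  have "closedin zariski {\<mu>. alg_mult \<mu> (alg_mult \<mu> x y) z = alg_mult \<mu> x (alg_mult \<mu> y z)}" for x y z :: "complex^'n"
    by (rule closedin_zariski_vec_eq; (rule poly_funs_alg_mult poly_funs.const)+)
  then show ?thesis unfolding associative_algebras_def by (intro closedin_zariski_Collect_all)
qed

lemma poly_funs_comp:
  assumes "p \<in> poly_funs" "\<And>i j k. (\<lambda>\<mu>. w \<mu> $ i $ j $ k) \<in> poly_funs"
  shows "(\<lambda>\<mu>. p (w \<mu>)) \<in> poly_funs"
  using assms(1) by induction (auto intro: assms(2) poly_funs.intros)

lemma closedin_zariski_vimage:
  assumes "closedin zariski C" "\<And>i j k. (\<lambda>\<mu>. w \<mu> $ i $ j $ k) \<in> poly_funs"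
  shows "closedin zariski {\<mu>. w \<mu> \<in> C}"
proof -
  obtain F where F: "F \<subseteq> poly_funs" "C = zero_locus F" using assms(1) by (auto simp: closedin_zariski)
  have "{\<mu>. w \<mu> \<in> C} = zero_locus ((\<lambda>p \<mu>. p (w \<mu>)) ` F)" by (auto simp: F zero_locus_def)
  moreover have "(\<lambda>p \<mu>. p (w \<mu>)) ` F \<subseteq> poly_funs" using F(1) poly_funs_comp[OF _ assms(2)] by blast
  ultimately show ?thesis unfolding closedin_zariski by blast
qed

lemma poly_funs_gl_act: "(\<lambda>\<mu>. gl_act g \<mu> $ i $ j $ k) \<in> poly_funs"
  unfolding gl_act_def vec_lambda_beta matrix_vector_mult_def
  by (intro poly_funs_sum poly_funs.mult poly_funs_alg_mult poly_funs.const)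

text \<open>Acting by a fixed \<open>g\<close> is a polynomial map, so the algebras sent into
  \<open>C\<close> by \<open>g\<close> form a closed set; it contains \<open>S\<close> and hence the
  closure of \<open>S\<close>.\<close>

lemma closure_gl_orbit_subset:
  assumes C: "closedin zariski C" and "S \<subseteq> C" and S: "\<And>\<mu>. \<mu> \<in> S \<Longrightarrow> gl_orbit \<mu> \<subseteq> S"
    and "\<mu> \<in> zariski closure_of S"
  shows "gl_orbit \<mu> \<subseteq> C"
proof
  fix \<nu> assume "\<nu> \<in> gl_orbit \<mu>"
  then obtain g where g: "invertible g" "\<nu> = gl_act g \<mu>" by (auto simp: gl_orbit_def)
  have "zariski closure_of S \<subseteq> {\<mu>. gl_act g \<mu> \<in> C}"
  proof (intro closure_of_minimal closedin_zariski_vimage C poly_funs_gl_act subsetI CollectI)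
    fix \<rho> assume "\<rho> \<in> S"
    moreover have "gl_act g \<rho> \<in> gl_orbit \<rho>" using g(1) by (auto simp: gl_orbit_def)
    ultimately show "gl_act g \<rho> \<in> C" using S assms(2) by blast
  qed
  then show "\<nu> \<in> C" using assms(4) g(2) by blast
qed

lemma closure_gl_orbit_stable:
  assumes "\<And>\<mu>. \<mu> \<in> S \<Longrightarrow> gl_orbit \<mu> \<subseteq> S" "\<mu> \<in> zariski closure_of S"
  shows "gl_orbit \<mu> \<subseteq> zariski closure_of S"
  by (rule closure_gl_orbit_subset[OF closedin_closure_of closure_of_subset assms]) auto

text \<open>The translates of an open subset of an orbit cover the orbit.\<close>

lemma openin_gl_orbitI:
  assumes U: "openin assoc_variety U" "\<mu> \<in> U" "U \<subseteq> gl_orbit \<mu>"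
  shows "openin assoc_variety (gl_orbit \<mu>)"
proof -
  obtain V where V: "openin zariski V" "U = V \<inter> associative_algebras"
    using U(1) by (auto simp: assoc_variety_def openin_subtopology)
  have ass: "\<mu> \<in> associative_algebras" using U V by blast
  let ?U = "\<lambda>g. {\<nu>. gl_act g \<nu> \<in> V} \<inter> associative_algebras"
  have "openin zariski {\<nu>. gl_act g \<nu> \<in> V}" for g
  proof -
    have "closedin zariski {\<nu>. gl_act g \<nu> \<in> - V}"
      using V(1) by (intro closedin_zariski_vimage poly_funs_gl_act) (simp add: closedin_def)
    then show ?thesis by (simp add: closedin_def Compl_eq_Diff_UNIV[symmetric] Collect_neg_eq)
  qed
  then have op: "openin assoc_variety (?U g)" for g
    by (auto simp: assoc_variety_def openin_subtopology)
  have "gl_orbit \<mu> = (\<Union>g\<in>Collect invertible. ?U g)"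
  proof (intro equalityI subsetI)
    fix \<nu> assume \<nu>: "\<nu> \<in> gl_orbit \<mu>"
    then have "\<mu> \<in> gl_orbit \<nu>" by (rule gl_orbit_sym)
    then obtain g where "invertible g" "\<mu> = gl_act g \<nu>" by (auto simp: gl_orbit_def)
    then show "\<nu> \<in> (\<Union>g\<in>Collect invertible. ?U g)"
      using associative_gl_orbit[OF ass \<nu>] U V by auto
  next
    fix \<nu> assume "\<nu> \<in> (\<Union>g\<in>Collect invertible. ?U g)"
    then obtain g where g: "invertible g" "gl_act g \<nu> \<in> V" "\<nu> \<in> associative_algebras" by auto
    then have gg: "gl_act g \<nu> \<in> gl_orbit \<nu>" by (auto simp: gl_orbit_def)
    then have "gl_act g \<nu> \<in> gl_orbit \<mu>" using associative_gl_orbit[OF g(3) gg] g(2) U V by blast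
    then show "\<nu> \<in> gl_orbit \<mu>" using gg gl_orbit_sym gl_orbit_trans by blast
  qed
  then show ?thesis using op by (simp only:) (intro openin_Union, auto)
qed

lemma poly_funs_tendsto:
  assumes "p \<in> poly_funs" "\<And>i j k. ((\<lambda>t. \<gamma> t $ i $ j $ k) \<longlongrightarrow> \<mu> $ i $ j $ k) F"
  shows "((\<lambda>t. p (\<gamma> t)) \<longlongrightarrow> p \<mu>) F"
  using assms(1) by induction (auto intro: assms(2) tendsto_add tendsto_mult)

text \<open>Polynomial functions are continuous in the usual topology, so an equation valid along
  the curve survives in the limit.\<close>

lemma closure_of_zariski_limit:
  assumes "\<And>i j k. ((\<lambda>t. \<gamma> t $ i $ j $ k) \<longlongrightarrow> \<mu> $ i $ j $ k) F" "F \<noteq> bot"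
    and "eventually (\<lambda>t. \<gamma> t \<in> S) F"
  shows "\<mu> \<in> zariski closure_of S"
proof -
  have "closedin zariski (zariski closure_of S)" by simp
  then obtain P where P: "P \<subseteq> poly_funs" "zariski closure_of S = zero_locus P"
    unfolding closedin_zariski by blast
  have "p \<mu> = 0" if "p \<in> P" for p
  proof -
    have "S \<subseteq> zero_locus P" using closure_of_subset[of S zariski] P(2) by simp
    then have "eventually (\<lambda>t. p (\<gamma> t) = 0) F"
      using assms(3) that by (auto simp: zero_locus_def elim!: eventually_mono)
    moreover have "((\<lambda>t. p (\<gamma> t)) \<longlongrightarrow> p \<mu>) F" using poly_funs_tendsto assms(1) P that by blast
    ultimately show ?thesis by (intro tendsto_unique[OF assms(2) _ tendsto_eventually])
  qed
  then show ?thesis by (simp add: P zero_locus_def)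
qed

lemma closure_of_zariski_perturb:
  fixes \<gamma> :: "complex \<Rightarrow> 'n::finite multiplication"
  assumes "\<And>i j k. isCont (\<lambda>t. \<gamma> t $ i $ j $ k) 0" "eventually (\<lambda>t. \<gamma> t \<in> S) (at 0)"
  shows "\<gamma> 0 \<in> zariski closure_of S"
  by (rule closure_of_zariski_limit[of \<gamma> _ "at 0"]) (use assms in \<open>auto simp: isCont_def\<close>)


section \<open>Dimension three\<close>

definition adj3 :: "complex^3^3 \<Rightarrow> complex^3^3" where
  "adj3 h = vector [
     vector [h$2$2 * h$3$3 - h$2$3 * h$3$2, h$1$3 * h$3$2 - h$1$2 * h$3$3, h$1$2 * h$2$3 - h$1$3 * h$2$2],
     vector [h$2$3 * h$3$1 - h$2$1 * h$3$3, h$1$1 * h$3$3 - h$1$3 * h$3$1, h$1$3 * h$2$1 - h$1$1 * h$2$3],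
     vector [h$2$1 * h$3$2 - h$2$2 * h$3$1, h$1$2 * h$3$1 - h$1$1 * h$3$2, h$1$1 * h$2$2 - h$1$2 * h$2$1]]"

lemma adj3_mult_left: "adj3 h *v (h *v x) = det h *s x"
  by (simp add: vec_eq_iff forall_3 matrix_vector_mult_def sum_3 adj3_def det_3 algebra_simps)

lemma adj3_mult_right: "h *v (adj3 h *v x) = det h *s x"
  by (simp add: vec_eq_iff forall_3 matrix_vector_mult_def sum_3 adj3_def det_3 algebra_simps)

text \<open>Up to the factor \<open>det h\<close>, this is the action of \<open>h\<^sup>-\<^sup>1\<close>, and it is polynomial in \<open>h\<close>.\<close>

definition adj_act :: "complex^3^3 \<Rightarrow> 3 multiplication \<Rightarrow> 3 multiplication" where
  "adj_act h \<nu> = (\<chi> i j. adj3 h *v alg_mult \<nu> (column i h) (column j h))"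

lemma alg_mult_adj_act: "alg_mult (adj_act h \<nu>) x y = adj3 h *v alg_mult \<nu> (h *v x) (h *v y)"
proof -
  have "alg_mult \<nu> (h *v x) (h *v y) =
      (\<Sum>i\<in>UNIV. \<Sum>j\<in>UNIV. (x $ i * y $ j) *s alg_mult \<nu> (column i h) (column j h))"
    unfolding matrix_mult_sum alg_mult_sum_left
    by (simp only: alg_mult_sum_right) (simp add: alg_mult_smult_left alg_mult_smult_right mult.commute)
  then show ?thesis
    unfolding alg_mult_def[of "adj_act h \<nu>"]
    by (simp add: adj_act_def vec.linear_sum[OF matrix_vector_mul_linear_gen] matrix_vector_mult_smult)
qed

definition scale_mat :: "complex \<Rightarrow> complex^3^3 \<Rightarrow> complex^3^3" where
  "scale_mat c h = (\<chi> i j. c * h $ i $ j)"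

lemma scale_mat_mult: "scale_mat c h *v x = c *s (h *v x)"
  by (simp add: scale_mat_def vec_eq_iff matrix_vector_mult_def sum_distrib_left mult.assoc)

lemma det_scale_mat: "det (scale_mat c h) = c ^ 3 * det h"
  by (simp add: scale_mat_def det_3 algebra_simps power3_eq_cube)

lemma adj3_scale_mat: "adj3 (scale_mat c h) *v x = c\<^sup>2 *s (adj3 h *v x)"
  by (simp add: scale_mat_def adj3_def vec_eq_iff forall_3 matrix_vector_mult_def sum_3 algebra_simps power2_eq_square)

text \<open>Since \<open>h\<close> times \<open>adj3 h\<close> is \<open>det h\<close>, the left
  side acquires the square of \<open>det h\<close>; bilinearity of \<open>\<nu>\<close> produces the
  same square from one factor in each argument.\<close>

lemma alg_hom_adj_act: "alg_hom (scale_mat (det h) h) (adj_act h \<nu>) \<nu>"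
  by (simp add: alg_hom_def alg_mult_adj_act scale_mat_mult adj3_mult_right alg_mult_bilinear)

lemma gl_orbit_eq_adj_act: "gl_orbit \<nu> = {adj_act h \<nu> | h. det h \<noteq> 0}"
proof (intro equalityI subsetI)
  fix \<mu> assume "\<mu> \<in> gl_orbit \<nu>"
  then obtain h where h: "det h \<noteq> 0" "\<And>x y. h *v alg_mult \<mu> x y = alg_mult \<nu> (h *v x) (h *v y)"
    by (auto simp: gl_orbit_iff alg_hom_def invertible_det_nz)
  \<comment> \<open>Scaling \<open>h\<close> by \<open>c\<close> multiplies \<open>adj3 h\<close> by
    the square of \<open>c\<close> and both arguments by \<open>c\<close>, and \<open>adj3 h\<close>
    composed with \<open>h\<close> is \<open>det h\<close>. Hence the fourth root of
    \<open>1 / det h\<close>.\<close>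
  define c where "c = csqrt (csqrt (1 / det h))"
  have c4: "c ^ 4 * det h = 1"
  proof -
    have "c ^ 4 = (c\<^sup>2)\<^sup>2" by simp
    then show ?thesis using h(1) by (simp add: c_def)
  qed
  have "adj_act (scale_mat c h) \<nu> = \<mu>"
  proof (rule multiplication_eqI)
    fix x y
    have "alg_mult (adj_act (scale_mat c h) \<nu>) x y = (c ^ 4) *s (adj3 h *v (h *v alg_mult \<mu> x y))"
      by (simp add: alg_mult_adj_act scale_mat_mult alg_mult_bilinear adj3_scale_mat h(2)
          matrix_vector_mult_smult power_numeral_reduce mult.assoc)
    then show "alg_mult (adj_act (scale_mat c h) \<nu>) x y = alg_mult \<mu> x y"
      using c4 by (simp add: adj3_mult_left)
  qed
  moreover have "det (scale_mat c h) \<noteq> 0" using h(1) c4 by (auto simp: det_scale_mat)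
  ultimately show "\<mu> \<in> {adj_act h \<nu> | h. det h \<noteq> 0}" by blast
next
  fix \<mu> assume "\<mu> \<in> {adj_act h \<nu> | h. det h \<noteq> 0}"
  then obtain h where h: "\<mu> = adj_act h \<nu>" "det h \<noteq> 0" by blast
  then have "det (scale_mat (det h) h) \<noteq> 0" by (simp add: det_scale_mat)
  then show "\<mu> \<in> gl_orbit \<nu>"
    unfolding gl_orbit_iff h(1) using alg_hom_adj_act invertible_det_nz by blast
qed

text \<open>Entries 0 to 8 fill the matrix. Entry 9 is left free and carries the parameter \<alpha>
  in the irreducibility proof for the family.\<close>

definition mat3 :: "(nat \<Rightarrow> complex) \<Rightarrow> complex^3^3" where
  "mat3 x = vector [vector [x 0, x 1, x 2], vector [x 3, x 4, x 5], vector [x 6, x 7, x 8]]"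

lemma mat3_surj: "\<exists>x. mat3 x = h \<and> x 9 = c"
proof -
  let ?x = "\<lambda>n. [h$1$1, h$1$2, h$1$3, h$2$1, h$2$2, h$2$3, h$3$1, h$3$2, h$3$3, c] ! n"
  have "mat3 ?x = h \<and> ?x 9 = c" by (simp add: mat3_def vec_eq_iff forall_3)
  then show ?thesis by (rule exI[of _ ?x])
qed

lemma param_polys_adj_act:
  assumes h: "\<And>i j. (\<lambda>x. h x $ i $ j) \<in> param_polys m"
    and \<nu>: "\<And>i j k. (\<lambda>x. \<nu> x $ i $ j $ k) \<in> param_polys m"
  shows "(\<lambda>x. adj_act (h x) (\<nu> x) $ i $ j $ k) \<in> param_polys m"
proof -
  have "\<forall>i j. (\<lambda>x. adj3 (h x) $ i $ j) \<in> param_polys m"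
    unfolding forall_3 adj3_def vector_3 by (intro conjI param_polys_diff param_polys.mult h)
  then show ?thesis
    unfolding adj_act_def matrix_vector_mult_def alg_mult_component column_def vec_lambda_beta
    by (intro param_polys_sum param_polys.mult h \<nu>) auto
qed

lemma param_polys_mat3: "9 \<le> m \<Longrightarrow> (\<lambda>x. mat3 x $ i $ j) \<in> param_polys m"
proof -
  assume "9 \<le> m"
  then have "\<forall>i j. (\<lambda>x. mat3 x $ i $ j) \<in> param_polys m"
    unfolding forall_3 mat3_def vector_3 by (intro conjI param_polys.var) auto
  then show ?thesis by blast
qed

lemma param_polys_det3:
  assumes h: "\<And>i j. (\<lambda>x. h x $ i $ j :: complex) \<in> param_polys m"
  shows "(\<lambda>x. det (h x :: complex^3^3)) \<in> param_polys m"
  unfolding det_3 by (intro param_polys_diff param_polys.add param_polys.mult h)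

lemma gl_orbit_eq_image: "gl_orbit \<nu> = (\<lambda>x. adj_act (mat3 x) \<nu>) ` {x\<in>UNIV. det (mat3 x) \<noteq> 0}"
proof (intro equalityI subsetI)
  fix \<mu> assume "\<mu> \<in> gl_orbit \<nu>"
  then obtain h where "\<mu> = adj_act h \<nu>" "det h \<noteq> 0" by (auto simp: gl_orbit_eq_adj_act)
  moreover obtain x where "mat3 x = h" using mat3_surj by blast
  ultimately show "\<mu> \<in> (\<lambda>x. adj_act (mat3 x) \<nu>) ` {x\<in>UNIV. det (mat3 x) \<noteq> 0}" by blast
qed (auto simp: gl_orbit_eq_adj_act)

lemma irreducible_gl_orbit: "irreducible_in zariski (gl_orbit (\<nu> :: 3 multiplication))"
proof -
  obtain x0 where x0: "mat3 x0 = mat 1" using mat3_surj by blast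
  show ?thesis
    unfolding gl_orbit_eq_image
    by (rule irreducible_param_image[where m = 9 and ?x0.0 = x0])
      (auto intro: param_polys_adj_act param_polys_mat3 param_polys_det3 param_polys.const simp: x0)
qed

lemma gl_orbit_subset_range: "gl_orbit \<nu> \<subseteq> range (\<lambda>x. adj_act (mat3 x) \<nu>)"
  unfolding gl_orbit_eq_image by blast

section \<open>Multiplication tables of the listed algebras\<close>

lemma A07_nth: "A07 $ i $ j $ k = (if (i, j, k) \<in> {(1,1,1), (2,2,2), (3,3,3)} then 1 else 0)"
  using exhaust_3[of i] exhaust_3[of j] exhaust_3[of k] by (auto simp: A07_def mult_table_def axis_def)

lemma A17_nth: "A17 $ i $ j $ k = (if (i, j, k) \<in> {(1,1,1), (1,2,2), (1,3,3)} then 1 else 0)"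
  using exhaust_3[of i] exhaust_3[of j] exhaust_3[of k] by (auto simp: A17_def mult_table_def axis_def)

lemma A18_nth: "A18 $ i $ j $ k = (if (i, j, k) \<in> {(1,1,1), (2,1,2), (3,1,3)} then 1 else 0)"
  using exhaust_3[of i] exhaust_3[of j] exhaust_3[of k] by (auto simp: A18_def mult_table_def axis_def)

lemma A19_nth: "A19 $ i $ j $ k = (if (i, j, k) \<in> {(1,1,1), (1,3,3), (2,1,2)} then 1 else 0)"
  using exhaust_3[of i] exhaust_3[of j] exhaust_3[of k] by (auto simp: A19_def mult_table_def axis_def)

lemma A20_nth: "A20 $ i $ j $ k = (if (i, j, k) \<in> {(1,1,1), (1,3,3), (2,2,2), (3,2,3)} then 1 else 0)"
  using exhaust_3[of i] exhaust_3[of j] exhaust_3[of k] by (auto simp: A20_def mult_table_def axis_def)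

lemma A23_nth: "A23 $ i $ j $ k = (if (i, j, k) \<in> {(1,1,1), (1,3,3), (2,2,2)} then 1 else 0)"
  using exhaust_3[of i] exhaust_3[of j] exhaust_3[of k] by (auto simp: A23_def mult_table_def axis_def)

lemma A24_nth: "A24 $ i $ j $ k = (if (i, j, k) \<in> {(1,1,1), (2,2,2), (3,1,3)} then 1 else 0)"
  using exhaust_3[of i] exhaust_3[of j] exhaust_3[of k] by (auto simp: A24_def mult_table_def axis_def)

lemma A14_nth: "A14 \<alpha> $ i $ j $ k =
    (if (i, j, k) = (1,2,3) then 1 + \<alpha> else if (i, j, k) = (2,1,3) then 1 - \<alpha> else 0)"
  using exhaust_3[of i] exhaust_3[of j] exhaust_3[of k] by (auto simp: A14_def mult_table_def axis_def)

lemmas algebra_nth = A07_nth A14_nth A17_nth A18_nth A19_nth A20_nth A23_nth A24_nth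

lemma A07_mult: "alg_mult A07 x y = vector [x$1 * y$1, x$2 * y$2, x$3 * y$3]"
  by (simp add: vec_eq_iff forall_3 alg_mult_component sum_3 A07_nth)

lemma A17_mult: "alg_mult A17 x y = vector [x$1 * y$1, x$1 * y$2, x$1 * y$3]"
  by (simp add: vec_eq_iff forall_3 alg_mult_component sum_3 A17_nth)

lemma A18_mult: "alg_mult A18 x y = vector [x$1 * y$1, x$2 * y$1, x$3 * y$1]"
  by (simp add: vec_eq_iff forall_3 alg_mult_component sum_3 A18_nth)

lemma A19_mult: "alg_mult A19 x y = vector [x$1 * y$1, x$2 * y$1, x$1 * y$3]"
  by (simp add: vec_eq_iff forall_3 alg_mult_component sum_3 A19_nth)

lemma A20_mult: "alg_mult A20 x y = vector [x$1 * y$1, x$2 * y$2, x$1 * y$3 + x$3 * y$2]"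
  by (simp add: vec_eq_iff forall_3 alg_mult_component sum_3 A20_nth)

lemma A23_mult: "alg_mult A23 x y = vector [x$1 * y$1, x$2 * y$2, x$1 * y$3]"
  by (simp add: vec_eq_iff forall_3 alg_mult_component sum_3 A23_nth)

lemma A24_mult: "alg_mult A24 x y = vector [x$1 * y$1, x$2 * y$2, x$3 * y$1]"
  by (simp add: vec_eq_iff forall_3 alg_mult_component sum_3 A24_nth)

lemma A14_mult: "alg_mult (A14 \<alpha>) x y = vector [0, 0, (1 + \<alpha>) * x$1 * y$2 + (1 - \<alpha>) * x$2 * y$1]"
  by (simp add: vec_eq_iff forall_3 alg_mult_component sum_3 A14_nth)

lemmas algebra_mult = A07_mult A14_mult A17_mult A18_mult A19_mult A20_mult A23_mult A24_mult

lemma algebras_associative: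
  "A07 \<in> associative_algebras" "A14 \<alpha> \<in> associative_algebras" "A17 \<in> associative_algebras"
  "A18 \<in> associative_algebras" "A19 \<in> associative_algebras" "A20 \<in> associative_algebras"
  "A23 \<in> associative_algebras" "A24 \<in> associative_algebras"
  unfolding associative_algebras_def
  by (simp_all add: algebra_mult vec_eq_iff forall_3 algebra_simps)


section \<open>The family of nilpotent algebras\<close>

definition A14_family :: "3 multiplication set" where
  "A14_family = (\<Union>\<alpha>\<in>- {0}. gl_orbit (A14 \<alpha>))"

lemma param_polys_A14: "i < m \<Longrightarrow> (\<lambda>x. A14 (x i) $ a $ b $ c) \<in> param_polys m"
  unfolding A14_nth
  by (cases "(a, b, c) = (1,2,3)"; cases "(a, b, c) = (2,1,3)") (auto intro: param_polys_intros)

text \<open>Treating \<alpha> as a tenth parameter makes the union of orbits one polynomial image;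
  the factor \<open>x 9\<close> in the nonvanishing condition excludes
  \<open>\<alpha> = 0\<close>.\<close>

lemma irreducible_A14_family: "irreducible_in zariski A14_family"
proof -
  let ?w = "\<lambda>x. adj_act (mat3 x) (A14 (x 9))"
  let ?\<delta> = "\<lambda>x. det (mat3 x) * x 9"
  have eq: "A14_family = ?w ` {x\<in>UNIV. ?\<delta> x \<noteq> 0}"
  proof (intro equalityI subsetI)
    fix \<mu> assume "\<mu> \<in> A14_family"
    then obtain \<alpha> h where "\<alpha> \<noteq> 0" "\<mu> = adj_act h (A14 \<alpha>)" "det h \<noteq> 0"
      by (auto simp: A14_family_def gl_orbit_eq_adj_act)
    moreover obtain x where "mat3 x = h \<and> x 9 = \<alpha>" using mat3_surj by blast
    ultimately show "\<mu> \<in> ?w ` {x\<in>UNIV. ?\<delta> x \<noteq> 0}" by (intro image_eqI[of _ _ x]) auto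
  qed (auto simp: A14_family_def gl_orbit_eq_adj_act)
  obtain x0 where x0: "mat3 x0 = mat 1 \<and> x0 9 = 1" using mat3_surj by blast
  show ?thesis
    unfolding eq
    by (rule irreducible_param_image[where m = 10 and ?x0.0 = x0])
      (auto intro!: param_polys_adj_act param_polys_mat3 param_polys_det3 param_polys.mult
        param_polys.var param_polys_A14 simp: x0)
qed

text \<open>Only the first two rows of \<open>h\<close> matter in \<open>adj_act h (A14 \<alpha>)\<close>, which leaves seven parameters.\<close>

definition A14_param :: "(nat \<Rightarrow> complex) \<Rightarrow> 3 multiplication" where
  "A14_param x = adj_act (vector [vector [x 0, x 1, x 2], vector [x 3, x 4, x 5], 0]) (A14 (x 6))"

lemma param_polys_A14_param: "(\<lambda>x. A14_param x $ a $ b $ c) \<in> param_polys 9"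
proof -
  have "\<forall>i j. (\<lambda>x. (vector [vector [x 0, x 1, x 2], vector [x 3, x 4, x 5], 0] :: complex^3^3) $ i $ j) \<in> param_polys 9"
    unfolding forall_3 vector_3 by (auto intro: param_polys_intros)
  then show ?thesis
    unfolding A14_param_def by (intro param_polys_adj_act param_polys_A14) auto
qed

lemma A14_family_subset_range: "A14_family \<subseteq> range A14_param"
proof
  fix \<mu> assume "\<mu> \<in> A14_family"
  then obtain \<alpha> h where h: "\<mu> = adj_act h (A14 \<alpha>)" by (auto simp: A14_family_def gl_orbit_eq_adj_act)
  let ?x = "\<lambda>n. [h$1$1, h$1$2, h$1$3, h$2$1, h$2$2, h$2$3, \<alpha>] ! n"
  have "A14_param ?x = adj_act h (A14 \<alpha>)"
    by (rule multiplication_eqI)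
      (simp add: A14_param_def alg_mult_adj_act A14_mult vec_eq_iff forall_3 matrix_vector_mult_def sum_3 adj3_def)
  then show "\<mu> \<in> range A14_param" using h by (metis rangeI)
qed


section \<open>Structure constants in a basis\<close>

definition det3 :: "complex^3 \<Rightarrow> complex^3 \<Rightarrow> complex^3 \<Rightarrow> complex" where
  "det3 u v w = det (vector [u, v, w] :: complex^3^3)"

lemma det3_eq: "det3 u v w = u$1 * (v$2 * w$3 - v$3 * w$2) - u$2 * (v$1 * w$3 - v$3 * w$1)
    + u$3 * (v$1 * w$2 - v$2 * w$1)"
  by (simp add: det3_def det_3 algebra_simps)

lemma det3_linear:
  "det3 (u + u') v w = det3 u v w + det3 u' v w" "det3 u (v + v') w = det3 u v w + det3 u v' w"
  "det3 u v (w + w') = det3 u v w + det3 u v w'"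
  "det3 (u - u') v w = det3 u v w - det3 u' v w" "det3 u (v - v') w = det3 u v w - det3 u v' w"
  "det3 u v (w - w') = det3 u v w - det3 u v w'"
  "det3 (c *s u) v w = c * det3 u v w" "det3 u (c *s v) w = c * det3 u v w"
  "det3 u v (c *s w) = c * det3 u v w"
  "det3 u u v = 0" "det3 u v u = 0" "det3 v u u = 0"
  "det3 0 v w = 0" "det3 u 0 w = 0" "det3 u v 0 = 0"
  by (simp_all add: det3_eq algebra_simps)

lemma det3_matrix: "det3 (h *v u) (h *v v) (h *v w) = det h * det3 u v w"
  by (simp add: det3_eq det_3 matrix_vector_mult_def sum_3 algebra_simps)

lemma det3_cramer: "det3 u v w *s p = det3 p v w *s u + det3 u p w *s v + det3 u v p *s w"
  by (simp add: vec_eq_iff forall_3 det3_eq algebra_simps)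

lemma basis3_expand:
  assumes "det3 u v w \<noteq> 0"
  obtains a b c where "p = a *s u + b *s v + c *s w"
proof -
  let ?d = "det3 u v w"
  have "p = (1 / ?d) *s (?d *s p)" using assms by simp
  also have "\<dots> = (det3 p v w / ?d) *s u + (det3 u p w / ?d) *s v + (det3 u v p / ?d) *s w"
    by (subst det3_cramer) (simp add: vec_eq_iff distrib_left)
  finally show ?thesis using that by blast
qed

lemma det3_independent:
  assumes "det3 u v w \<noteq> 0" "a *s u + b *s v + c *s w = 0"
  shows "a = 0 \<and> b = 0 \<and> c = 0"
proof -
  have "det3 (a *s u + b *s v + c *s w) v w = a * det3 u v w"
    "det3 u (a *s u + b *s v + c *s w) w = b * det3 u v w"
    "det3 u v (a *s u + b *s v + c *s w) = c * det3 u v w"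
    by (simp_all add: det3_linear)
  then show ?thesis unfolding assms(2) using assms(1) by (simp add: det3_linear)
qed

text \<open>If \<open>det3 u v\<close> vanishes on the three unit vectors, all 2 by 2 minors of the
  pair vanish, and \<open>v\<close> is a multiple of \<open>u\<close>.\<close>

lemma ex_det3_nonzero:
  assumes "u \<noteq> 0" "\<And>c. v \<noteq> c *s u"
  shows "\<exists>w. det3 u v w \<noteq> 0"
proof (rule ccontr)
  assume "\<not> ?thesis"
  then have "det3 u v (axis i 1) = 0" for i by blast
  from this[of 1] this[of 2] this[of 3]
  have eq: "u$2 * v$3 = u$3 * v$2" "u$1 * v$3 = u$3 * v$1" "u$1 * v$2 = u$2 * v$1"
    by (auto simp: det3_eq axis_def)
  obtain i where i: "u $ i \<noteq> 0" using assms(1) by (auto simp: vec_eq_iff)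
  define c where "c = v $ i / u $ i"
  have "v $ j = c * u $ j" for j
    using exhaust_3[of i] exhaust_3[of j] eq i unfolding c_def by (auto simp: field_simps)
  then have "v = c *s u" by (simp add: vec_eq_iff)
  then show False using assms(2) by blast
qed

text \<open>\<open>B\<close> has the columns \<open>u\<close>, \<open>v\<close>, \<open>w\<close>.
  The last conclusion is shaped so that expanding a product in this basis yields an entry of the new
  table.\<close>

lemma structure_constants:
  assumes "det3 u v w \<noteq> 0"
  obtains \<nu> B where "invertible B" "alg_hom B \<nu> \<mu>"
    "\<And>a b c. B *v vector [a, b, c] = a *s u + b *s v + c *s w"
    "\<And>i j a b c. alg_mult \<mu> (vector [u, v, w] $ i) (vector [u, v, w] $ j) = a *s u + b *s v + c *s w
      \<Longrightarrow> \<nu> $ i $ j = vector [a, b, c]"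
proof -
  define B :: "complex^3^3" where "B = transpose (vector [u, v, w])"
  have "det B \<noteq> 0" using assms by (simp add: B_def det3_def)
  then have B: "invertible B" by (simp add: invertible_det_nz)
  have Bv: "B *v vector [a, b, c] = a *s u + b *s v + c *s w" for a b c
    by (simp add: B_def vec_eq_iff forall_3 matrix_vector_mult_def sum_3 transpose_def algebra_simps)
  have Bc: "column i B = vector [u, v, w] $ i" for i
    by (simp add: B_def column_def transpose_def vec_eq_iff)
  let ?\<nu> = "\<chi> i j. matrix_inv B *v alg_mult \<mu> (column i B) (column j B)"
  have hom: "alg_hom B ?\<nu> \<mu>"
    unfolding alg_hom_columns by (simp add: matrix_inv_cancel[OF B])
  have "?\<nu> $ i $ j = vector [a, b, c]"
    if "alg_mult \<mu> (vector [u, v, w] $ i) (vector [u, v, w] $ j) = a *s u + b *s v + c *s w" for i j a b c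
  proof -
    have "B *v ?\<nu> $ i $ j = B *v vector [a, b, c]"
      using hom that unfolding alg_hom_columns Bc Bv by metis
    then show ?thesis by (simp add: invertible_cancel_iff[OF B])
  qed
  then show ?thesis using that B hom Bv by blast
qed

lemma associative_algebrasD:
  "\<mu> \<in> associative_algebras \<Longrightarrow> alg_mult \<mu> (alg_mult \<mu> x y) z = alg_mult \<mu> x (alg_mult \<mu> y z)"
  by (simp add: associative_algebras_def)

lemma alg_mult_axis_left: "alg_mult \<mu> (axis i 1) y = (\<Sum>j\<in>UNIV. y $ j *s \<mu> $ i $ j)"
proof -
  have "alg_mult \<mu> (axis i 1) y = alg_mult \<mu> (axis i 1) (\<Sum>j\<in>UNIV. y $ j *s axis j 1)"
    by (simp add: basis_expansion)
  then show ?thesis by (simp add: alg_mult_sum_right alg_mult_smult_right)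
qed

lemma alg_mult_axis_right: "alg_mult \<mu> x (axis j 1) = (\<Sum>i\<in>UNIV. x $ i *s \<mu> $ i $ j)"
proof -
  have "alg_mult \<mu> x (axis j 1) = alg_mult \<mu> (\<Sum>i\<in>UNIV. x $ i *s axis i 1) (axis j 1)"
    by (simp add: basis_expansion)
  then show ?thesis by (simp add: alg_mult_sum_left alg_mult_smult_left)
qed

lemma associative_components:
  fixes \<nu> :: "3 multiplication"
  assumes "\<nu> \<in> associative_algebras"
  shows "\<nu>$i$j$1 * \<nu>$1$k$l + \<nu>$i$j$2 * \<nu>$2$k$l + \<nu>$i$j$3 * \<nu>$3$k$l =
    \<nu>$j$k$1 * \<nu>$i$1$l + \<nu>$j$k$2 * \<nu>$i$2$l + \<nu>$j$k$3 * \<nu>$i$3$l"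
  using arg_cong[OF associative_algebrasD[OF assms, of "axis i 1" "axis j 1" "axis k 1", unfolded alg_mult_axis], of "\<lambda>v. v $ l"]
  unfolding alg_mult_axis_left alg_mult_axis_right by (simp add: sum_3)


section \<open>Degenerations\<close>

text \<open>The exceptional set \<open>E\<close> may contain 0, since only a punctured neighbourhood
  of 0 matters; typically the limit algebra is not in \<open>S\<close>.\<close>

lemma perturbation_in_closure:
  fixes \<gamma> :: "complex \<Rightarrow> 'n::finite multiplication"
  assumes "\<And>i j k. isCont (\<lambda>t. \<gamma> t $ i $ j $ k) 0" "finite E"
    and "\<And>t. t \<notin> E \<Longrightarrow> \<gamma> t \<in> S"
  shows "\<gamma> 0 \<in> zariski closure_of S"
proof (rule closure_of_zariski_perturb[OF assms(1)])
  have "eventually (\<lambda>t. \<forall>e\<in>E. t \<noteq> e) (at (0::complex))"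
    using assms(2) by (intro eventually_ball_finite) (auto intro: eventually_neq_at_within)
  then show "eventually (\<lambda>t. \<gamma> t \<in> S) (at 0)"
    by (rule eventually_mono) (use assms(3) in blast)
qed

lemma in_gl_orbitI: "det h \<noteq> 0 \<Longrightarrow> alg_hom h \<mu> \<nu> \<Longrightarrow> \<mu> \<in> gl_orbit \<nu>"
  by (auto simp: gl_orbit_iff invertible_det_nz)

lemma degeneration:
  fixes \<gamma> :: "complex \<Rightarrow> 'n::finite multiplication"
  assumes "\<And>i j k. isCont (\<lambda>t. \<gamma> t $ i $ j $ k) 0" "finite E"
    and "\<And>t. t \<notin> E \<Longrightarrow> det (h t) \<noteq> 0" "\<And>t. alg_hom (h t) (\<gamma> t) \<nu>"
  shows "\<gamma> 0 \<in> orbit_closure \<nu>"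
  by (rule perturbation_in_closure[OF assms(1,2)]) (use assms(3,4) in_gl_orbitI in blast)

definition mtable :: "complex^3 \<Rightarrow> complex^3 \<Rightarrow> complex^3 \<Rightarrow> complex^3 \<Rightarrow> complex^3 \<Rightarrow> complex^3 \<Rightarrow>
    complex^3 \<Rightarrow> complex^3 \<Rightarrow> complex^3 \<Rightarrow> 3 multiplication" where
  "mtable a b c d e f g h i = vector [vector [a, b, c], vector [d, e, f], vector [g, h, i]]"

abbreviation vec3 :: "complex \<Rightarrow> complex \<Rightarrow> complex \<Rightarrow> complex^3" where
  "vec3 a b c \<equiv> vector [a, b, c]"

abbreviation mrows :: "complex^3 \<Rightarrow> complex^3 \<Rightarrow> complex^3 \<Rightarrow> complex^3^3" where
  "mrows a b c \<equiv> vector [a, b, c]"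

lemma mtable_nth [simp]:
  "mtable a b c d e f g h i $ 1 $ 1 = a" "mtable a b c d e f g h i $ 1 $ 2 = b"
  "mtable a b c d e f g h i $ 1 $ 3 = c" "mtable a b c d e f g h i $ 2 $ 1 = d"
  "mtable a b c d e f g h i $ 2 $ 2 = e" "mtable a b c d e f g h i $ 2 $ 3 = f"
  "mtable a b c d e f g h i $ 3 $ 1 = g" "mtable a b c d e f g h i $ 3 $ 2 = h"
  "mtable a b c d e f g h i $ 3 $ 3 = i"
  by (simp_all add: mtable_def)

lemma mtable_eqI:
  assumes "\<nu>$1$1 = a" "\<nu>$1$2 = b" "\<nu>$1$3 = c" "\<nu>$2$1 = d" "\<nu>$2$2 = e" "\<nu>$2$3 = f"
    "\<nu>$3$1 = g" "\<nu>$3$2 = h" "\<nu>$3$3 = i"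
  shows "\<nu> = mtable a b c d e f g h i"
  using assms by (simp add: mtable_def vec_eq_iff forall_3)

lemma isCont_mtable:
  assumes "\<And>k. isCont (\<lambda>t. a t $ k) z" "\<And>k. isCont (\<lambda>t. b t $ k) z" "\<And>k. isCont (\<lambda>t. c t $ k) z"
    "\<And>k. isCont (\<lambda>t. d t $ k) z" "\<And>k. isCont (\<lambda>t. e t $ k) z" "\<And>k. isCont (\<lambda>t. f t $ k) z"
    "\<And>k. isCont (\<lambda>t. g t $ k) z" "\<And>k. isCont (\<lambda>t. h t $ k) z" "\<And>k. isCont (\<lambda>t. i t $ k) z"
  shows "isCont (\<lambda>t. mtable (a t) (b t) (c t) (d t) (e t) (f t) (g t) (h t) (i t) $ p $ q $ k) z"
  using exhaust_3[of p] exhaust_3[of q] by (elim disjE) (simp_all add: assms)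

lemma isCont_vec3:
  assumes "isCont a z" "isCont b z" "isCont c z"
  shows "isCont (\<lambda>t. vec3 (a t) (b t) (c t) $ k) z"
  using exhaust_3[of k] by (elim disjE) (simp_all add: assms)

lemmas isCont_table = isCont_mtable isCont_vec3 continuous_intros

lemmas alg_hom_check = alg_hom_columns forall_3 vec_eq_iff matrix_vector_mult_def sum_3 column_def
  algebra_mult

section \<open>Algebras generated by one element\<close>

lemma quadratic_root:
  fixes p q :: complex
  shows "\<exists>x. x\<^sup>2 = p * x + q"
proof -
  define x where "x = (p + csqrt (p\<^sup>2 + 4 * q)) / 2"
  have "2 * x - p = csqrt (p\<^sup>2 + 4 * q)" by (simp add: x_def field_simps)
  then have "(2 * x - p)\<^sup>2 = p\<^sup>2 + 4 * q" by simp
  then have "4 * x\<^sup>2 = 4 * (p * x + q)" by (simp add: power2_eq_square algebra_simps)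
  then have "x\<^sup>2 = p * x + q" by (subst (asm) mult_left_cancel) auto
  then show ?thesis ..
qed

lemma cubic_roots:
  fixes \<alpha> \<beta> \<gamma> :: complex
  obtains a b c where "\<gamma> = a + b + c" "\<beta> = - (a * b + b * c + c * a)" "\<alpha> = a * b * c"
proof -
  let ?P = "[:- \<alpha>, - \<beta>, - \<gamma>, 1:]"
  have "\<not> constant (poly ?P)" by (subst constant_degree) simp
  then obtain a where "poly ?P a = 0" using fundamental_theorem_of_algebra by blast
  then have a: "a ^ 3 = \<alpha> + \<beta> * a + \<gamma> * a\<^sup>2" by (simp add: algebra_simps power3_eq_cube power2_eq_square)
  \<comment> \<open>Dividing the cubic by its linear factor at \<open>a\<close> leaves the quadratic
    whose roots are \<open>b\<close> and \<open>c\<close>.\<close>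
  obtain b where b: "b\<^sup>2 = (\<gamma> - a) * b + (\<beta> + (\<gamma> - a) * a)" using quadratic_root by blast
  define c where "c = \<gamma> - a - b"
  have \<gamma>: "\<gamma> = a + b + c" by (simp add: c_def)
  have \<beta>: "\<beta> = - (a * b + b * c + c * a)"
    using b unfolding \<gamma> by (simp add: algebra_simps power2_eq_square) algebra
  have "\<alpha> = a * b * c" using a unfolding \<gamma> \<beta> by algebra
  with \<gamma> \<beta> show ?thesis using that by blast
qed

text \<open>The multiplication of \<open>zC[z]/(z\<^sup>4 - \<gamma>z\<^sup>3 - \<beta>z\<^sup>2 - \<alpha>z)\<close> in the basis \<open>z, z\<^sup>2, z\<^sup>3\<close>.\<close>

definition cubic_table :: "complex \<Rightarrow> complex \<Rightarrow> complex \<Rightarrow> 3 multiplication" where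
  "cubic_table \<alpha> \<beta> \<gamma> = mtable (vec3 0 1 0) (vec3 0 0 1) (vec3 \<alpha> \<beta> \<gamma>)
     (vec3 0 0 1) (vec3 \<alpha> \<beta> \<gamma>) (vec3 (\<gamma> * \<alpha>) (\<alpha> + \<gamma> * \<beta>) (\<beta> + \<gamma>\<^sup>2))
     (vec3 \<alpha> \<beta> \<gamma>) (vec3 (\<gamma> * \<alpha>) (\<alpha> + \<gamma> * \<beta>) (\<beta> + \<gamma>\<^sup>2))
     (vec3 ((\<beta> + \<gamma>\<^sup>2) * \<alpha>) (\<gamma> * \<alpha> + (\<beta> + \<gamma>\<^sup>2) * \<beta>) (\<alpha> + \<gamma> * \<beta> + (\<beta> + \<gamma>\<^sup>2) * \<gamma>))"

text \<open>Evaluation at the three roots is the isomorphism: \<open>z\<close> goes to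
  \<open>(a, b, c)\<close>, so the matrix is of Vandermonde type with the additional factor
  \<open>a * b * c\<close>.\<close>

lemma cubic_table_in_gl_orbit:
  assumes ne: "a \<noteq> 0" "b \<noteq> 0" "c \<noteq> 0" "a \<noteq> b" "b \<noteq> c" "a \<noteq> c"
  shows "cubic_table (a * b * c) (- (a * b + b * c + c * a)) (a + b + c) \<in> gl_orbit A07"
proof (rule in_gl_orbitI)
  let ?h = "mrows (vec3 a (a\<^sup>2) (a ^ 3)) (vec3 b (b\<^sup>2) (b ^ 3)) (vec3 c (c\<^sup>2) (c ^ 3))"
  have "det ?h = a * b * c * (b - a) * (c - a) * (c - b)"
    by (simp add: det_3 algebra_simps power2_eq_square power3_eq_cube)
  then show "det ?h \<noteq> 0" using ne by simp
  show "alg_hom ?h (cubic_table (a * b * c) (- (a * b + b * c + c * a)) (a + b + c)) A07"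
    by (simp add: alg_hom_check cubic_table_def algebra_simps power2_eq_square power3_eq_cube)
qed

lemma cubic_table_in_closure: "cubic_table \<alpha> \<beta> \<gamma> \<in> orbit_closure A07"
proof -
  obtain a b c where abc: "\<gamma> = a + b + c" "\<beta> = - (a * b + b * c + c * a)" "\<alpha> = a * b * c"
    by (rule cubic_roots)
  \<comment> \<open>The roots move with the distinct speeds 1, 2 and 4, so two roots coincide, or
    one of them is zero, for at most six values of \<open>t\<close>; these form the set
    \<open>E\<close> below.\<close>
  define \<alpha>t where "\<alpha>t t = (a + t) * (b + 2 * t) * (c + 4 * t)" for t
  define \<beta>t where "\<beta>t t = - ((a + t) * (b + 2 * t) + (b + 2 * t) * (c + 4 * t) + (c + 4 * t) * (a + t))" for t
  define \<gamma>t where "\<gamma>t t = (a + t) + (b + 2 * t) + (c + 4 * t)" for t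
  have cont: "isCont \<alpha>t 0" "isCont \<beta>t 0" "isCont \<gamma>t 0"
    unfolding \<alpha>t_def[abs_def] \<beta>t_def[abs_def] \<gamma>t_def[abs_def] by (intro continuous_intros)+
  have "cubic_table (\<alpha>t 0) (\<beta>t 0) (\<gamma>t 0) \<in> orbit_closure A07"
  proof (rule perturbation_in_closure[where \<gamma> = "\<lambda>t. cubic_table (\<alpha>t t) (\<beta>t t) (\<gamma>t t)"
        and E = "{- a, - b / 2, - c / 4, a - b, (b - c) / 2, (a - c) / 3}"])
    show "isCont (\<lambda>t. cubic_table (\<alpha>t t) (\<beta>t t) (\<gamma>t t) $ i $ j $ k) 0" for i j k
      unfolding cubic_table_def by (intro isCont_table cont)
    fix t assume "t \<notin> {- a, - b / 2, - c / 4, a - b, (b - c) / 2, (a - c) / 3}"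
    then have "a + t \<noteq> 0" "b + 2 * t \<noteq> 0" "c + 4 * t \<noteq> 0" "a + t \<noteq> b + 2 * t" "b + 2 * t \<noteq> c + 4 * t" "a + t \<noteq> c + 4 * t"
      by (auto simp: field_simps add_eq_0_iff)
    then show "cubic_table (\<alpha>t t) (\<beta>t t) (\<gamma>t t) \<in> gl_orbit A07"
      unfolding \<alpha>t_def \<beta>t_def \<gamma>t_def by (rule cubic_table_in_gl_orbit)
  qed simp
  then show ?thesis by (simp add: \<alpha>t_def \<beta>t_def \<gamma>t_def abc)
qed

definition cubic_free :: "3 multiplication \<Rightarrow> bool" where
  "cubic_free \<mu> \<longleftrightarrow> (\<forall>z. det3 z (alg_mult \<mu> z z) (alg_mult \<mu> z (alg_mult \<mu> z z)) = 0)"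

text \<open>The products of basis vectors are the powers of \<open>z\<close> from the second to the
  sixth, and the relation for the fourth power reduces all of them.\<close>

lemma cubic_basis_table:
  assumes \<mu>: "\<mu> \<in> associative_algebras"
    and det: "det3 z (alg_mult \<mu> z z) (alg_mult \<mu> z (alg_mult \<mu> z z)) \<noteq> 0"
    and z4: "alg_mult \<mu> z (alg_mult \<mu> z (alg_mult \<mu> z z)) =
      \<alpha> *s z + \<beta> *s alg_mult \<mu> z z + \<gamma> *s alg_mult \<mu> z (alg_mult \<mu> z z)"
  shows "\<mu> \<in> gl_orbit (cubic_table \<alpha> \<beta> \<gamma>)"
proof -
  let ?m = "alg_mult \<mu>"
  note A = associative_algebrasD[OF \<mu>]
  obtain \<nu> B where B: "invertible B" "alg_hom B \<nu> \<mu>"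
    and \<nu>: "\<And>i j a b c. ?m (vector [z, ?m z z, ?m z (?m z z)] $ i) (vector [z, ?m z z, ?m z (?m z z)] $ j)
        = a *s z + b *s ?m z z + c *s ?m z (?m z z) \<Longrightarrow> \<nu> $ i $ j = vector [a, b, c]"
    using structure_constants[OF det] by metis
  have z5: "?m z (?m z (?m z (?m z z))) = (\<gamma> * \<alpha>) *s z + (\<alpha> + \<gamma> * \<beta>) *s ?m z z + (\<beta> + \<gamma>\<^sup>2) *s ?m z (?m z z)"
    unfolding z4 alg_mult_bilinear by (simp add: vec_eq_iff algebra_simps power2_eq_square)
  have z6: "?m z (?m z (?m z (?m z (?m z z)))) = ((\<beta> + \<gamma>\<^sup>2) * \<alpha>) *s z
      + (\<gamma> * \<alpha> + (\<beta> + \<gamma>\<^sup>2) * \<beta>) *s ?m z z + (\<alpha> + \<gamma> * \<beta> + (\<beta> + \<gamma>\<^sup>2) * \<gamma>) *s ?m z (?m z z)"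
    unfolding z5 unfolding alg_mult_bilinear unfolding z4 by (simp add: vec_eq_iff algebra_simps power2_eq_square)
  have "\<nu> = cubic_table \<alpha> \<beta> \<gamma>"
    unfolding cubic_table_def
    by (intro mtable_eqI \<nu>) (simp_all only: vector_3 A, simp_all only: z6, simp_all only: z5, simp_all add: z4)
  moreover have "\<mu> \<in> gl_orbit \<nu>" using B gl_orbit_sym unfolding gl_orbit_iff by metis
  ultimately show ?thesis by simp
qed

lemma not_cubic_free_in_closure:
  assumes "\<mu> \<in> associative_algebras" "\<not> cubic_free \<mu>"
  shows "\<mu> \<in> orbit_closure A07"
proof -
  obtain z where z: "det3 z (alg_mult \<mu> z z) (alg_mult \<mu> z (alg_mult \<mu> z z)) \<noteq> 0"
    using assms(2) by (auto simp: cubic_free_def)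
  obtain \<alpha> \<beta> \<gamma> where "alg_mult \<mu> z (alg_mult \<mu> z (alg_mult \<mu> z z)) =
      \<alpha> *s z + \<beta> *s alg_mult \<mu> z z + \<gamma> *s alg_mult \<mu> z (alg_mult \<mu> z z)"
    using basis3_expand[OF z] by metis
  then have "\<mu> \<in> gl_orbit (cubic_table \<alpha> \<beta> \<gamma>)" by (rule cubic_basis_table[OF assms(1) z])
  then show ?thesis
    using closure_gl_orbit_stable[OF _ cubic_table_in_closure] gl_orbit_trans by blast
qed


section \<open>Every associative algebra lies in one of the components\<close>

definition component_sets :: "3 multiplication set set" where
  "component_sets = {orbit_closure A07, orbit_closure A17,
     orbit_closure A18, orbit_closure A19,
     orbit_closure A20, orbit_closure A23,
     orbit_closure A24, zariski closure_of A14_family}"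

lemma A14_family_stable: "\<mu> \<in> A14_family \<Longrightarrow> gl_orbit \<mu> \<subseteq> A14_family"
  unfolding A14_family_def using gl_orbit_trans by blast

lemma component_stable:
  assumes "C \<in> component_sets" "\<mu> \<in> C" shows "gl_orbit \<mu> \<subseteq> C"
proof -
  have "gl_orbit \<mu> \<subseteq> orbit_closure \<nu>" if "\<mu> \<in> orbit_closure \<nu>" for \<nu>
    using that by (intro closure_gl_orbit_stable) (auto dest: gl_orbit_trans)
  moreover have "gl_orbit \<mu> \<subseteq> zariski closure_of A14_family" if "\<mu> \<in> zariski closure_of A14_family"
    using that A14_family_stable by (intro closure_gl_orbit_stable) auto
  ultimately show ?thesis using assms unfolding component_sets_def by blast
qed

lemma Union_components_orbit:
  "\<nu> \<in> \<Union>component_sets \<Longrightarrow> \<mu> \<in> gl_orbit \<nu> \<Longrightarrow> \<mu> \<in> \<Union>component_sets"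
  using component_stable by blast

lemma in_Union_components:
  "\<mu> \<in> orbit_closure A07 \<Longrightarrow> \<mu> \<in> \<Union>component_sets"
  "\<mu> \<in> orbit_closure A17 \<Longrightarrow> \<mu> \<in> \<Union>component_sets"
  "\<mu> \<in> orbit_closure A18 \<Longrightarrow> \<mu> \<in> \<Union>component_sets"
  "\<mu> \<in> orbit_closure A19 \<Longrightarrow> \<mu> \<in> \<Union>component_sets"
  "\<mu> \<in> orbit_closure A20 \<Longrightarrow> \<mu> \<in> \<Union>component_sets"
  "\<mu> \<in> orbit_closure A23 \<Longrightarrow> \<mu> \<in> \<Union>component_sets"
  "\<mu> \<in> orbit_closure A24 \<Longrightarrow> \<mu> \<in> \<Union>component_sets"
  "\<mu> \<in> zariski closure_of A14_family \<Longrightarrow> \<mu> \<in> \<Union>component_sets"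
  unfolding component_sets_def by blast+

lemma orbit_in_closure: "\<mu> \<in> gl_orbit \<nu> \<Longrightarrow> \<mu> \<in> orbit_closure \<nu>"
  using closure_of_subset[of "gl_orbit \<nu>" zariski] by auto

subsection \<open>Nilpotent algebras\<close>

lemma quadratic_form_factors:
  fixes a b c :: complex
  shows "\<exists>p1 p2 q1 q2. a = p1 * q1 \<and> b = p1 * q2 + p2 * q1 \<and> c = p2 * q2"
proof (cases "a = 0")
  case True
  then show ?thesis by (intro exI[of _ 0] exI[of _ 1] exI[of _ b] exI[of _ c]) simp
next
  case False
  obtain q where q: "q\<^sup>2 = (b / a) * q + (- c / a)" using quadratic_root by blast
  then have "a * q\<^sup>2 = b * q - c" using False by (simp add: field_simps)
  then have "c = (b - a * q) * q" by (simp add: algebra_simps power2_eq_square)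
  then show ?thesis by (intro exI[of _ a] exI[of _ "b - a * q"] exI[of _ 1] exI[of _ q]) simp
qed

definition form_table :: "complex \<Rightarrow> complex \<Rightarrow> complex \<Rightarrow> complex \<Rightarrow> 3 multiplication" where
  "form_table a b c d = mtable (vec3 0 0 a) (vec3 0 0 b) 0 (vec3 0 0 c) (vec3 0 0 d) 0 0 0 0"

text \<open>The symmetric part of \<open>A14 \<alpha>\<close> has the quadratic form
  \<open>2 * x1 * x2\<close>. So half of the given quadratic form is split into two linear factors,
  which serve as coordinates; they are independent by the discriminant condition. Then \<alpha> is
  the ratio of the skew part to the determinant \<delta>, and it is nonzero because
  \<open>b \<noteq> c\<close>.\<close>

lemma form_table_in_family:
  assumes disc: "(b + c)\<^sup>2 \<noteq> 4 * a * d" and "b \<noteq> c"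
  shows "form_table a b c d \<in> A14_family"
proof -
  obtain p1 p2 q1 q2 where pq: "a / 2 = p1 * q1" "(b + c) / 2 = p1 * q2 + p2 * q1" "d / 2 = p2 * q2"
    using quadratic_form_factors by metis
  then have a: "a = 2 * (p1 * q1)" and bc: "b + c = 2 * (p1 * q2 + p2 * q1)" and d: "d = 2 * (p2 * q2)"
    by (simp_all add: field_simps)
  define \<delta> where "\<delta> = p1 * q2 - p2 * q1"
  have "(b + c)\<^sup>2 - 4 * a * d = 4 * \<delta>\<^sup>2"
    unfolding bc unfolding a d \<delta>_def by (simp add: power2_eq_square algebra_simps)
  then have \<delta>: "\<delta> \<noteq> 0" using disc by auto
  define \<alpha> where "\<alpha> = (b - c) / (2 * \<delta>)"
  have \<alpha>: "b - c = 2 * \<alpha> * (p1 * q2 - p2 * q1)" "\<alpha> \<noteq> 0"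
    using \<delta> assms(2) by (auto simp: \<alpha>_def simp flip: \<delta>_def)
  have "2 * b = 2 * ((1 + \<alpha>) * p1 * q2 + (1 - \<alpha>) * q1 * p2)"
    "2 * c = 2 * ((1 + \<alpha>) * p2 * q1 + (1 - \<alpha>) * q2 * p1)"
    using bc \<alpha>(1) by algebra+
  then have b: "b = (1 + \<alpha>) * p1 * q2 + (1 - \<alpha>) * q1 * p2"
    and c: "c = (1 + \<alpha>) * p2 * q1 + (1 - \<alpha>) * q2 * p1"
    by (simp_all only: mult_cancel_left) simp_all
  have "form_table a b c d \<in> gl_orbit (A14 \<alpha>)"
  proof (rule in_gl_orbitI)
    let ?h = "mrows (vec3 p1 p2 0) (vec3 q1 q2 0) (vec3 0 0 1)"
    show "det ?h \<noteq> 0" using \<delta> by (simp add: det_3 \<delta>_def mult.commute)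
    show "alg_hom ?h (form_table a b c d) (A14 \<alpha>)"
      by (simp add: alg_hom_check form_table_def b c) (simp add: a d algebra_simps)
  qed
  then show ?thesis using \<alpha>(2) by (auto simp: A14_family_def)
qed

text \<open>Moving \<open>b\<close> alone restores both genericity conditions: symmetry fails except
  at one value of \<open>t\<close>, and the discriminant vanishes for at most two.\<close>

lemma form_table_in_closure: "form_table a b c d \<in> zariski closure_of A14_family"
proof -
  let ?r = "csqrt (4 * a * d)"
  have "form_table a (b + 0) c d \<in> zariski closure_of A14_family"
  proof (rule perturbation_in_closure[where \<gamma> = "\<lambda>t. form_table a (b + t) c d" and E = "{c - b, ?r - b - c, - ?r - b - c}"])
    show "isCont (\<lambda>t. form_table a (b + t) c d $ i $ j $ k) 0" for i j k
      unfolding form_table_def by (intro isCont_table; simp)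
    fix t assume t: "t \<notin> {c - b, ?r - b - c, - ?r - b - c}"
    have "(b + t + c)\<^sup>2 \<noteq> 4 * a * d"
    proof
      assume "(b + t + c)\<^sup>2 = 4 * a * d"
      then have "(b + t + c)\<^sup>2 = ?r\<^sup>2" by simp
      then have "b + t + c = ?r \<or> b + t + c = - ?r" by (simp only: power2_eq_iff)
      then show False using t by (auto simp: algebra_simps)
    qed
    then show "form_table a (b + t) c d \<in> A14_family" using t by (intro form_table_in_family) auto
  qed simp
  then show ?thesis by simp
qed

text \<open>Otherwise a polynomial in \<open>z\<close> without constant term is a nonzero
  idempotent: \<open>z / c\<close> if the square is \<open>c *s z\<close>; and if the cube is
  \<open>\<alpha> *s z + \<beta> *s z\<^sup>2\<close>, a unit for \<open>z\<close> when
  \<open>\<alpha> \<noteq> 0\<close>, or the square divided by \<open>\<beta>\<^sup>2\<close> when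
  only \<beta> is nonzero.\<close>

lemma cube_zero:
  assumes \<mu>: "\<mu> \<in> associative_algebras" and cf: "cubic_free \<mu>"
    and idem: "\<And>f. alg_mult \<mu> f f = f \<Longrightarrow> f = 0"
  shows "alg_mult \<mu> z (alg_mult \<mu> z z) = 0"
proof (cases "z = 0 \<or> (\<exists>c. alg_mult \<mu> z z = c *s z)")
  case True
  then obtain c where c: "alg_mult \<mu> z z = c *s z" by auto
  show ?thesis
  proof (cases "c = 0")
    case False
    have "(1 / c) *s z = 0" by (rule idem) (use False in \<open>simp add: alg_mult_bilinear c\<close>)
    then show ?thesis using False by simp
  qed (simp add: c)
next
  case False
  let ?m = "alg_mult \<mu>"
  note A = associative_algebrasD[OF \<mu>]
  obtain w where w: "det3 z (?m z z) w \<noteq> 0" using ex_det3_nonzero False by blast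
  obtain \<alpha> \<beta> \<gamma> where eq: "?m z (?m z z) = \<alpha> *s z + \<beta> *s ?m z z + \<gamma> *s w"
    using basis3_expand[OF w] by metis
  have "\<gamma> * det3 z (?m z z) w = det3 z (?m z z) (?m z (?m z z))"
    unfolding eq by (simp add: det3_linear)
  also have "\<dots> = 0" using cf by (simp add: cubic_free_def)
  finally have z3: "?m z (?m z z) = \<alpha> *s z + \<beta> *s ?m z z" using w eq by simp
  show ?thesis
  proof (cases "\<alpha> = 0")
    case False
    define f where "f = (1 / \<alpha>) *s (?m z z - \<beta> *s z)"
    have zf: "?m z f = z"
      using False by (simp add: f_def alg_mult_bilinear z3)
    have "?m f v = (1 / \<alpha>) *s (?m z (?m z v) - \<beta> *s ?m z v)" for v
      by (simp add: f_def alg_mult_bilinear A)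
    then have "?m f f = (1 / \<alpha>) *s (?m z z - \<beta> *s z)" by (simp only: zf)
    then have "?m f f = f" by (simp only: f_def)
    then have "f = 0" by (rule idem)
    then show ?thesis using zf \<open>\<not> (z = 0 \<or> _)\<close> by simp
  next
    case True
    then have z3: "?m z (?m z z) = \<beta> *s ?m z z" using z3 by simp
    show ?thesis
    proof (cases "\<beta> = 0")
      case False
      define f where "f = (1 / \<beta>\<^sup>2) *s ?m z z"
      have "?m (?m z z) (?m z z) = \<beta>\<^sup>2 *s ?m z z"
        by (simp add: A z3 alg_mult_bilinear power2_eq_square)
      then have "?m f f = f" using False by (simp add: f_def alg_mult_bilinear)
      then have "f = 0" by (rule idem)
      then have "?m z z = 0 *s z" using False by (simp add: f_def)
      then show ?thesis using \<open>\<not> (z = 0 \<or> _)\<close> by blast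
    qed (simp add: z3)
  qed
qed

lemma nil_in_closure:
  assumes \<mu>: "\<mu> \<in> associative_algebras" and cube: "\<And>z. alg_mult \<mu> z (alg_mult \<mu> z z) = 0"
  shows "\<mu> \<in> zariski closure_of A14_family"
proof -
  let ?m = "alg_mult \<mu>"
  note A = associative_algebrasD[OF \<mu>]
  \<comment> \<open>The goal of both cases below: a basis in which all products lie on the line of
    \<open>w\<close> and \<open>w\<close> annihilates everything, so that a bilinear form in two
    variables remains.\<close>
  have reduce: "\<mu> \<in> zariski closure_of A14_family"
    if R: "det3 x y w \<noteq> 0" "?m x x = a *s w" "?m x y = b *s w" "?m y x = c *s w" "?m y y = d *s w"
      "\<And>v. ?m v w = 0" "\<And>v. ?m w v = 0" for x y w a b c d
  proof -
    obtain \<nu> B where B: "invertible B" "alg_hom B \<nu> \<mu>"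
      and \<nu>: "\<And>i j a b c. ?m (vector [x, y, w] $ i) (vector [x, y, w] $ j) = a *s x + b *s y + c *s w
        \<Longrightarrow> \<nu> $ i $ j = vector [a, b, c]"
      using structure_constants[OF R(1)] by metis
    have z: "vec3 0 0 0 = 0" by (simp add: vec_eq_iff forall_3)
    have "\<nu> = form_table a b c d"
      unfolding form_table_def z[symmetric] by (intro mtable_eqI \<nu>) (simp_all add: R)
    moreover have "\<mu> \<in> gl_orbit \<nu>" using B gl_orbit_sym unfolding gl_orbit_iff by metis
    ultimately show ?thesis
      using closure_gl_orbit_stable[OF A14_family_stable form_table_in_closure] by blast
  qed
  show ?thesis
  proof (cases "\<exists>z. ?m z z \<noteq> 0")
    case True
    then obtain z where z: "?m z z \<noteq> 0" by blast
    define u where "u = ?m z z"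
    have zu: "?m z u = 0" "?m u z = 0" "?m u u = 0" by (simp_all add: u_def A cube)
    have "z \<noteq> 0" using z by auto
    moreover have "u \<noteq> c *s z" for c
    proof
      assume "u = c *s z"
      then have "?m z u = c *s u" by (simp add: alg_mult_bilinear u_def)
      then have "c = 0" using zu z by (auto simp: u_def)
      then show False using \<open>u = c *s z\<close> z by (simp add: u_def)
    qed
    ultimately obtain w where w: "det3 z u w \<noteq> 0" using ex_det3_nonzero by blast
    note d = det3_independent[OF w]
    obtain a b c where zw: "?m z w = a *s z + b *s u + c *s w" using basis3_expand[OF w] by metis
    obtain a' b' c' where wz: "?m w z = a' *s z + b' *s u + c' *s w" using basis3_expand[OF w] by metis
    obtain p q r where ww: "?m w w = p *s z + q *s u + r *s w" using basis3_expand[OF w] by metis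
    have uw: "?m u w = ?m z (?m z w)" "?m w u = ?m (?m w z) z" by (simp_all add: u_def A)
    \<comment> \<open>Left multiplication by \<open>z\<close> has vanishing third power, and the
      \<open>w\<close>-coordinate of its third power applied to \<open>w\<close> is
      \<open>c ^ 3\<close>.\<close>
    have "(c\<^sup>2 * a) *s z + (c * a + c\<^sup>2 * b) *s u + c ^ 3 *s w = ?m z (?m z (?m z w))"
      unfolding zw alg_mult_bilinear zu u_def[symmetric]
      by (simp add: zw vec_eq_iff algebra_simps power2_eq_square power3_eq_cube)
    also have "\<dots> = ?m (?m z u) w" by (simp add: u_def A)
    finally have "c ^ 3 = 0" using d zu by (metis alg_mult_zero(1))
    then have c: "c = 0" by simp
    have "(c'\<^sup>2 * a') *s z + (c' * a' + c'\<^sup>2 * b') *s u + c' ^ 3 *s w = ?m (?m (?m w z) z) z"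
      unfolding wz alg_mult_bilinear zu u_def[symmetric]
      by (simp add: wz vec_eq_iff algebra_simps power2_eq_square power3_eq_cube)
    also have "\<dots> = ?m w (?m u z)" by (simp add: u_def A)
    finally have "c' ^ 3 = 0" using d zu by (metis alg_mult_zero(2))
    then have c': "c' = 0" by simp
    have uw': "?m u w = a *s u" "?m w u = a' *s u"
      unfolding uw unfolding zw wz c c' by (simp_all add: alg_mult_bilinear zu u_def[symmetric])
    \<comment> \<open>Multiplication by \<open>w\<close> from the right scales \<open>u\<close> by
      \<open>a\<close>, while the cube of \<open>w\<close> is zero.\<close>
    have "a ^ 3 *s u = ?m u (?m w (?m w w))"
      by (simp flip: A add: uw' alg_mult_bilinear power3_eq_cube)
    then have a: "a = 0" using z by (simp add: cube u_def)
    have "a' ^ 3 *s u = ?m (?m (?m w w) w) u"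
      by (simp add: A uw' alg_mult_bilinear power3_eq_cube)
    then have a': "a' = 0" using z by (simp add: A cube u_def)
    have "(r * p) *s z + (p * b' + r * q) *s u + (r * r) *s w = ?m w (?m w w)"
      unfolding ww alg_mult_bilinear wz uw' a' c'
      by (simp add: ww vec_eq_iff algebra_simps)
    then have r: "r = 0" using d cube by (metis mult_eq_0_iff)
    have "p\<^sup>2 *s u = ?m (?m w w) (?m w w)"
      unfolding ww alg_mult_bilinear r by (simp add: zu u_def[symmetric] power2_eq_square)
    also have "\<dots> = ?m (?m w (?m w w)) w" by (simp add: A)
    finally have p: "p = 0" using z by (simp add: cube u_def)
    have w': "det3 z w u \<noteq> 0" using w by (simp add: det3_eq algebra_simps)
    have expand: "\<exists>a b c. v = a *s z + b *s u + c *s w" for v using basis3_expand[OF w] by metis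
    have ann: "?m v u = 0" "?m u v = 0" for v
      using expand[of v] by (auto simp: alg_mult_bilinear zu uw' a a')
    show ?thesis
      by (rule reduce[OF w', of 1 b b' q]) (simp_all add: u_def[symmetric] zw wz ww ann a a' c c' p r)
  next
    case False
    then have sq: "?m z z = 0" for z by blast
    have anti: "?m x y = - ?m y x" for x y
      using sq[of "x + y"] by (simp add: alg_mult_bilinear sq add_eq_0_iff)
    have neg: "?m (- x) y = - ?m x y" "?m x (- y) = - ?m x y" for x y
      using alg_mult_diff_left[of \<mu> 0 x y] alg_mult_diff_right[of \<mu> x 0 y] by simp_all
    \<comment> \<open>In an associative algebra with anticommuting elements, cycling
      \<open>z\<close> through the product and back changes the sign of a triple product, which must
      therefore vanish.\<close>
    have triple: "?m (?m x y) z = 0" for x y z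
    proof -
      have "?m (?m x y) z = - ?m z (?m x y)" by (rule anti)
      also have "\<dots> = - ?m (?m z x) y" by (simp add: A)
      also have "\<dots> = ?m (?m x z) y" by (simp add: anti[of z x] neg)
      also have "\<dots> = ?m x (?m z y)" by (simp add: A)
      also have "\<dots> = - ?m (?m x y) z" by (simp add: anti[of z y] neg A)
      finally have "2 *s ?m (?m x y) z = 0" by (simp add: vec_eq_iff)
      then show ?thesis by simp
    qed
    show ?thesis
    proof (cases "\<exists>x y. ?m x y \<noteq> 0")
      case False
      then show ?thesis
        by (intro reduce[of "axis 1 1" "axis 2 1" "axis 3 1" 0 0 0 0]) (auto simp: det3_eq axis_def)
    next
      case True
      then obtain x y where xy: "?m x y \<noteq> 0" by blast
      have "x \<noteq> 0" using xy by auto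
      moreover have "y \<noteq> c *s x" for c using xy by (auto simp: alg_mult_bilinear sq)
      ultimately obtain w where w: "det3 x y w \<noteq> 0" using ex_det3_nonzero by blast
      obtain \<alpha> \<beta> \<gamma> where eq: "?m x y = \<alpha> *s x + \<beta> *s y + \<gamma> *s w" using basis3_expand[OF w] by metis
      \<comment> \<open>If \<open>x y\<close> were in the span of \<open>x\<close> and
        \<open>y\<close>, multiplying by \<open>x\<close> on the left and by \<open>y\<close> on the
        right would give vanishing triple products and kill both coefficients.\<close>
      have "det3 x y (?m x y) \<noteq> 0"
      proof
        assume "det3 x y (?m x y) = 0"
        then have "\<gamma> = 0" unfolding eq using w by (simp add: det3_linear)
        then have eq: "?m x y = \<alpha> *s x + \<beta> *s y" using eq by simp
        have "\<beta> *s ?m x y = ?m x (?m x y)" by (subst (2) eq) (simp add: alg_mult_bilinear sq)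
        then have "\<beta> = 0" using xy triple sq by (simp flip: A)
        moreover have "\<alpha> *s ?m x y = ?m (?m x y) y" by (subst (2) eq) (simp add: alg_mult_bilinear sq)
        then have "\<alpha> = 0" using xy triple by simp
        ultimately show False using eq xy by simp
      qed
      then show ?thesis
        by (rule reduce[of _ _ _ 0 1 "- 1" 0]) (simp_all add: sq triple anti[of y x] flip: A)
    qed
  qed
qed

subsection \<open>Peirce decompositions\<close>

lemma degeneration_in_components:
  fixes \<gamma> :: "complex \<Rightarrow> 3 multiplication"
  assumes "\<nu> = \<gamma> 0" "orbit_closure \<rho> \<in> component_sets"
    and "\<And>i j k. isCont (\<lambda>t. \<gamma> t $ i $ j $ k) 0" "finite E"
    and "\<And>t. t \<notin> E \<Longrightarrow> det (h t) \<noteq> 0" "\<And>t. alg_hom (h t) (\<gamma> t) \<rho>"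
  shows "\<nu> \<in> \<Union>component_sets"
  using degeneration[of \<gamma> E h \<rho>] assms by blast

text \<open>The first basis vector is idempotent, and the \<open>i\<close>-th basis vector lies in the Peirce component
  on which it acts from the left by \<open>l i\<close> and from the right by \<open>r i\<close>.\<close>

definition peirce :: "3 multiplication \<Rightarrow> (3 \<Rightarrow> complex) \<Rightarrow> (3 \<Rightarrow> complex) \<Rightarrow> bool" where
  "peirce \<nu> l r \<longleftrightarrow> \<nu> \<in> associative_algebras \<and> l 1 = 1 \<and> r 1 = 1 \<and>
     (\<forall>i. \<nu> $ 1 $ i = l i *s axis i 1) \<and> (\<forall>i. \<nu> $ i $ 1 = r i *s axis i 1)"

lemma peirceD:
  assumes "peirce \<nu> l r"
  shows "\<nu> \<in> associative_algebras" "l 1 = 1" "r 1 = 1"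
    "\<nu> $ 1 $ i $ k = (if i = k then l i else 0)" "\<nu> $ i $ 1 $ k = (if i = k then r i else 0)"
  using assms by (auto simp: peirce_def axis_def)

text \<open>These are the Peirce multiplication rules. Associativity with the idempotent placed
  before, behind or between the factors compares eigenvalues, and any mismatch forces the structure
  constant to vanish.\<close>

lemma peirce_zero:
  assumes P: "peirce \<nu> l r" and ne: "l i \<noteq> l k \<or> r j \<noteq> r k \<or> r i \<noteq> l j"
  shows "\<nu> $ i $ j $ k = 0"
proof -
  note A = associative_algebrasD[OF peirceD(1)[OF P]]
  have P1: "\<nu> $ 1 $ i = l i *s axis i 1" "\<nu> $ i $ 1 = r i *s axis i 1" for i
    using P by (auto simp: peirce_def)
  have L: "alg_mult \<nu> (axis 1 1) y $ k = l k * y $ k" for y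
    unfolding alg_mult_axis_left P1 using exhaust_3[of k] by (auto simp: sum_3 axis_def)
  have R: "alg_mult \<nu> y (axis 1 1) $ k = r k * y $ k" for y
    unfolding alg_mult_axis_right P1 using exhaust_3[of k] by (auto simp: sum_3 axis_def)
  have "l i * \<nu>$i$j$k = l k * \<nu>$i$j$k"
    using arg_cong[OF A[of "axis 1 1" "axis i 1" "axis j 1"], of "\<lambda>v. v $ k"]
    by (simp add: L P1 alg_mult_bilinear)
  moreover have "r k * \<nu>$i$j$k = r j * \<nu>$i$j$k"
    using arg_cong[OF A[of "axis i 1" "axis j 1" "axis 1 1"], of "\<lambda>v. v $ k"]
    by (simp add: R P1 alg_mult_bilinear)
  moreover have "r i * \<nu>$i$j$k = l j * \<nu>$i$j$k"
    using arg_cong[OF A[of "axis i 1" "axis 1 1" "axis j 1"], of "\<lambda>v. v $ k"]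
    by (simp add: P1 alg_mult_bilinear)
  ultimately show ?thesis using ne by auto
qed

text \<open>In the names of these lemmas the digits are \<open>l 2\<close>, \<open>r 2\<close> and
  \<open>l 3\<close>, \<open>r 3\<close>.\<close>

lemma peirce_10_10:
  assumes P: "peirce \<nu> l r" and L: "l 2 = 1" "r 2 = 0" "l 3 = 1" "r 3 = 0"
  shows "\<nu> \<in> \<Union>component_sets"
proof -
  note z = peirce_zero[OF P] and P1 = peirceD(2-)[OF P] and A = associative_components[OF peirceD(1)[OF P]]
  have \<nu>: "\<nu> = mtable (vec3 1 0 0) (vec3 0 1 0) (vec3 0 0 1) 0 0 0 0 0 0"
    by (rule mtable_eqI) (simp_all add: vec_eq_iff forall_3 z P1 L)
  let ?h = "mrows (vec3 1 0 0) (vec3 0 1 0) (vec3 0 0 1)"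
  have "det ?h \<noteq> 0" by (simp add: det_3)
  moreover have "alg_hom ?h \<nu> A17" by (simp add: \<nu> alg_hom_check)
  ultimately have "\<nu> \<in> gl_orbit A17" by (rule in_gl_orbitI)
  then show ?thesis by (intro in_Union_components(2) orbit_in_closure)
qed

lemma peirce_01_01:
  assumes P: "peirce \<nu> l r" and L: "l 2 = 0" "r 2 = 1" "l 3 = 0" "r 3 = 1"
  shows "\<nu> \<in> \<Union>component_sets"
proof -
  note z = peirce_zero[OF P] and P1 = peirceD(2-)[OF P] and A = associative_components[OF peirceD(1)[OF P]]
  have \<nu>: "\<nu> = mtable (vec3 1 0 0) 0 0 (vec3 0 1 0) 0 0 (vec3 0 0 1) 0 0"
    by (rule mtable_eqI) (simp_all add: vec_eq_iff forall_3 z P1 L)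
  let ?h = "mrows (vec3 1 0 0) (vec3 0 1 0) (vec3 0 0 1)"
  have "det ?h \<noteq> 0" by (simp add: det_3)
  moreover have "alg_hom ?h \<nu> A18" by (simp add: \<nu> alg_hom_check)
  ultimately have "\<nu> \<in> gl_orbit A18" by (rule in_gl_orbitI)
  then show ?thesis by (intro in_Union_components(3) orbit_in_closure)
qed

lemma peirce_10_01:
  assumes P: "peirce \<nu> l r" and L: "l 2 = 1" "r 2 = 0" "l 3 = 0" "r 3 = 1"
  shows "\<nu> \<in> \<Union>component_sets"
proof -
  note z = peirce_zero[OF P] and P1 = peirceD(2-)[OF P] and A = associative_components[OF peirceD(1)[OF P]]
  \<comment> \<open>The Peirce rules still allow \<open>e2 e3\<close> to be a multiple of
    \<open>e1\<close>. The product \<open>e2 e3 e2\<close> decides, because \<open>e3 e2\<close>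
    would have to be of type (0,0), and no basis vector is.\<close>
  have "\<nu>$2$3$1 = 0"
    using A[of 2 3 2 2] by (simp add: z P1 L)
  have \<nu>: "\<nu> = mtable (vec3 1 0 0) (vec3 0 1 0) 0 0 0 0 (vec3 0 0 1) 0 0"
    by (rule mtable_eqI) (simp_all add: vec_eq_iff forall_3 z P1 L \<open>\<nu>$2$3$1 = 0\<close>)
  let ?h = "mrows (vec3 1 0 0) (vec3 0 0 1) (vec3 0 1 0)"
  have "det ?h \<noteq> 0" by (simp add: det_3)
  moreover have "alg_hom ?h \<nu> A19" by (simp add: \<nu> alg_hom_check)
  ultimately have "\<nu> \<in> gl_orbit A19" by (rule in_gl_orbitI)
  then show ?thesis by (intro in_Union_components(4) orbit_in_closure)
qed

text \<open>The vectors \<open>e1\<close>, \<open>e2\<close> span a unital plane, and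
  \<open>e2\<close> acts on \<open>e3\<close> by a scalar \<kappa>, which is thus a root of the
  quadratic equation of \<open>e2\<close>. Moving the other root away from \<kappa> splits the
  plane; the first two rows of \<open>?h\<close> are its two characters. The next lemma is the
  mirror image with factors exchanged.\<close>

lemma peirce_11_10:
  assumes P: "peirce \<nu> l r" and L: "l 2 = 1" "r 2 = 1" "l 3 = 1" "r 3 = 0"
  shows "\<nu> \<in> \<Union>component_sets"
proof -
  note z = peirce_zero[OF P] and P1 = peirceD(2-)[OF P] and A = associative_components[OF peirceD(1)[OF P]]
  define \<kappa> where "\<kappa> = \<nu>$2$3$3"
  define \<kappa>' where "\<kappa>' = \<nu>$2$2$2 - \<kappa>"
  have b: "\<nu>$2$2$2 = \<kappa> + \<kappa>'" by (simp add: \<kappa>'_def)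
  have a: "\<nu>$2$2$1 = - (\<kappa> * \<kappa>')"
    using A[of 2 2 3 3] by (simp add: z P1 L \<kappa>'_def \<kappa>_def algebra_simps add_eq_0_iff eq_diff_eq)
  let ?\<gamma> = "\<lambda>t. mtable (vec3 1 0 0) (vec3 0 1 0) (vec3 0 0 1) (vec3 0 1 0) (vec3 (- (\<kappa> * (\<kappa>' + t))) (\<kappa> + (\<kappa>' + t)) 0) (vec3 0 0 \<kappa>) 0 0 0"
  let ?h = "\<lambda>t. mrows (vec3 1 \<kappa> 0) (vec3 1 (\<kappa>' + t) 0) (vec3 0 0 1)"
  show ?thesis
  proof (rule degeneration_in_components[where \<gamma> = ?\<gamma> and h = ?h and E = "{\<kappa> - \<kappa>'}" and \<rho> = A23])
    show "\<nu> = ?\<gamma> 0"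
      by (rule mtable_eqI) (simp_all add: vec_eq_iff forall_3 z P1 L a b \<kappa>_def[symmetric])
    show "det (?h t) \<noteq> 0" if t: "t \<notin> {\<kappa> - \<kappa>'}" for t
      using t by (auto simp: det_3 algebra_simps add_eq_0_iff)
  qed (intro isCont_table; simp | simp add: alg_hom_check algebra_simps component_sets_def)+
qed

lemma peirce_11_01:
  assumes P: "peirce \<nu> l r" and L: "l 2 = 1" "r 2 = 1" "l 3 = 0" "r 3 = 1"
  shows "\<nu> \<in> \<Union>component_sets"
proof -
  note z = peirce_zero[OF P] and P1 = peirceD(2-)[OF P] and A = associative_components[OF peirceD(1)[OF P]]
  define \<kappa> where "\<kappa> = \<nu>$3$2$3"
  define \<kappa>' where "\<kappa>' = \<nu>$2$2$2 - \<kappa>"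
  have b: "\<nu>$2$2$2 = \<kappa> + \<kappa>'" by (simp add: \<kappa>'_def)
  have a: "\<nu>$2$2$1 = - (\<kappa> * \<kappa>')"
    using A[of 3 2 2 3] by (simp add: z P1 L \<kappa>'_def \<kappa>_def algebra_simps add_eq_0_iff eq_diff_eq)
  let ?\<gamma> = "\<lambda>t. mtable (vec3 1 0 0) (vec3 0 1 0) 0 (vec3 0 1 0) (vec3 (- (\<kappa> * (\<kappa>' + t))) (\<kappa> + (\<kappa>' + t)) 0) 0 (vec3 0 0 1) (vec3 0 0 \<kappa>) 0"
  let ?h = "\<lambda>t. mrows (vec3 1 \<kappa> 0) (vec3 1 (\<kappa>' + t) 0) (vec3 0 0 1)"
  show ?thesis
  proof (rule degeneration_in_components[where \<gamma> = ?\<gamma> and h = ?h and E = "{\<kappa> - \<kappa>'}" and \<rho> = A24])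
    show "\<nu> = ?\<gamma> 0"
      by (rule mtable_eqI) (simp_all add: vec_eq_iff forall_3 z P1 L a b \<kappa>_def[symmetric])
    show "det (?h t) \<noteq> 0" if t: "t \<notin> {\<kappa> - \<kappa>'}" for t
      using t by (auto simp: det_3 algebra_simps add_eq_0_iff)
  qed (intro isCont_table; simp | simp add: alg_hom_check algebra_simps component_sets_def)+
qed

lemma peirce_11_00:
  assumes P: "peirce \<nu> l r" and L: "l 2 = 1" "r 2 = 1" "l 3 = 0" "r 3 = 0"
  shows "\<nu> \<in> \<Union>component_sets"
proof -
  note z = peirce_zero[OF P] and P1 = peirceD(2-)[OF P] and A = associative_components[OF peirceD(1)[OF P]]
  \<comment> \<open>\<kappa> and \<kappa>' are the roots of the quadratic equation of
    \<open>e2\<close> in the unital plane of \<open>e1\<close> and \<open>e2\<close>. Separating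
    them and making the square of \<open>e3\<close> nonzero gives three orthogonal
    idempotents.\<close>
  obtain \<kappa> where \<kappa>: "\<kappa>\<^sup>2 = \<nu>$2$2$2 * \<kappa> + \<nu>$2$2$1" using quadratic_root by blast
  define \<kappa>' where "\<kappa>' = \<nu>$2$2$2 - \<kappa>"
  define c where "c = \<nu>$3$3$3"
  have b: "\<nu>$2$2$2 = \<kappa> + \<kappa>'" by (simp add: \<kappa>'_def)
  have a: "\<nu>$2$2$1 = - (\<kappa> * \<kappa>')" using \<kappa> by (simp add: \<kappa>'_def algebra_simps power2_eq_square)
  let ?\<gamma> = "\<lambda>t. mtable (vec3 1 0 0) (vec3 0 1 0) 0 (vec3 0 1 0) (vec3 (- (\<kappa> * (\<kappa>' + t))) (\<kappa> + (\<kappa>' + t)) 0) 0 0 0 (vec3 0 0 (c + t))"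
  let ?h = "\<lambda>t. mrows (vec3 1 \<kappa> 0) (vec3 1 (\<kappa>' + t) 0) (vec3 0 0 (c + t))"
  show ?thesis
  proof (rule degeneration_in_components[where \<gamma> = ?\<gamma> and h = ?h and E = "{\<kappa> - \<kappa>', - c}" and \<rho> = A07])
    show "\<nu> = ?\<gamma> 0"
      by (rule mtable_eqI) (simp_all add: vec_eq_iff forall_3 z P1 L a b c_def[symmetric])
    show "det (?h t) \<noteq> 0" if t: "t \<notin> {\<kappa> - \<kappa>', - c}" for t
    proof -
      have "det (?h t) = (\<kappa>' + t - \<kappa>) * (c + t)" by (simp add: det_3 algebra_simps)
      then show ?thesis using t by (auto simp: eq_neg_iff_add_eq_0 eq_diff_eq add.commute)
    qed
  qed (intro isCont_table; simp | simp add: alg_hom_check algebra_simps component_sets_def)+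
qed

text \<open>Right multiplication by \<open>e3\<close> scales \<open>e2\<close> by \<kappa>, and the
  square of \<open>e3\<close> is \<open>c *s e3\<close>, so \<kappa> is 0 or \<open>c\<close>.
  Replacing \<open>c\<close> by \<open>c + t\<close>, and \<kappa> along with it in the second case,
  turns \<open>e3\<close> into a multiple of an idempotent. The next lemma treats the opposite
  multiplication.\<close>

lemma peirce_10_00:
  assumes P: "peirce \<nu> l r" and L: "l 2 = 1" "r 2 = 0" "l 3 = 0" "r 3 = 0"
  shows "\<nu> \<in> \<Union>component_sets"
proof -
  note z = peirce_zero[OF P] and P1 = peirceD(2-)[OF P] and A = associative_components[OF peirceD(1)[OF P]]
  define c where "c = \<nu>$3$3$3"
  define \<kappa> where "\<kappa> = \<nu>$2$3$2"
  have "\<kappa> * \<kappa> = c * \<kappa>"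
    using A[of 2 3 3 2] by (auto simp: z P1 L c_def \<kappa>_def)
  then consider "\<kappa> = 0" | "\<kappa> = c" by auto
  then show ?thesis
  proof cases
    case 1
  let ?\<gamma> = "\<lambda>t. mtable (vec3 1 0 0) (vec3 0 1 0) 0 0 0 0 0 0 (vec3 0 0 (c + t))"
  let ?h = "\<lambda>t. mrows (vec3 1 0 0) (vec3 0 0 (c + t)) (vec3 0 1 0)"
  show ?thesis
  proof (rule degeneration_in_components[where \<gamma> = ?\<gamma> and h = ?h and E = "{- c}" and \<rho> = A23])
    show "\<nu> = ?\<gamma> 0"
      by (rule mtable_eqI) (simp_all add: vec_eq_iff forall_3 z P1 L c_def[symmetric] 1[unfolded \<kappa>_def])
    show "det (?h t) \<noteq> 0" if t: "t \<notin> {- c}" for t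
      using t by (auto simp: det_3 algebra_simps add_eq_0_iff)
  qed (intro isCont_table; simp | simp add: alg_hom_check algebra_simps component_sets_def)+
  next
    case 2
  let ?\<gamma> = "\<lambda>t. mtable (vec3 1 0 0) (vec3 0 1 0) 0 0 0 (vec3 0 (c + t) 0) 0 0 (vec3 0 0 (c + t))"
  let ?h = "\<lambda>t. mrows (vec3 1 0 0) (vec3 0 0 (c + t)) (vec3 0 1 0)"
  show ?thesis
  proof (rule degeneration_in_components[where \<gamma> = ?\<gamma> and h = ?h and E = "{- c}" and \<rho> = A20])
    show "\<nu> = ?\<gamma> 0"
      by (rule mtable_eqI) (simp_all add: vec_eq_iff forall_3 z P1 L c_def[symmetric] 2[unfolded \<kappa>_def])
    show "det (?h t) \<noteq> 0" if t: "t \<notin> {- c}" for t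
      using t by (auto simp: det_3 algebra_simps add_eq_0_iff)
  qed (intro isCont_table; simp | simp add: alg_hom_check algebra_simps component_sets_def)+
  qed
qed

lemma peirce_01_00:
  assumes P: "peirce \<nu> l r" and L: "l 2 = 0" "r 2 = 1" "l 3 = 0" "r 3 = 0"
  shows "\<nu> \<in> \<Union>component_sets"
proof -
  note z = peirce_zero[OF P] and P1 = peirceD(2-)[OF P] and A = associative_components[OF peirceD(1)[OF P]]
  define c where "c = \<nu>$3$3$3"
  define \<kappa> where "\<kappa> = \<nu>$3$2$2"
  have "\<kappa> * \<kappa> = c * \<kappa>"
    using A[of 3 3 2 2] by (auto simp: z P1 L c_def \<kappa>_def)
  then consider "\<kappa> = 0" | "\<kappa> = c" by auto
  then show ?thesis
  proof cases
    case 1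
  let ?\<gamma> = "\<lambda>t. mtable (vec3 1 0 0) 0 0 (vec3 0 1 0) 0 0 0 0 (vec3 0 0 (c + t))"
  let ?h = "\<lambda>t. mrows (vec3 1 0 0) (vec3 0 0 (c + t)) (vec3 0 1 0)"
  show ?thesis
  proof (rule degeneration_in_components[where \<gamma> = ?\<gamma> and h = ?h and E = "{- c}" and \<rho> = A24])
    show "\<nu> = ?\<gamma> 0"
      by (rule mtable_eqI) (simp_all add: vec_eq_iff forall_3 z P1 L c_def[symmetric] 1[unfolded \<kappa>_def])
    show "det (?h t) \<noteq> 0" if t: "t \<notin> {- c}" for t
      using t by (auto simp: det_3 algebra_simps add_eq_0_iff)
  qed (intro isCont_table; simp | simp add: alg_hom_check algebra_simps component_sets_def)+
  next
    case 2
  let ?\<gamma> = "\<lambda>t. mtable (vec3 1 0 0) 0 0 (vec3 0 1 0) 0 0 0 (vec3 0 (c + t) 0) (vec3 0 0 (c + t))"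
  let ?h = "\<lambda>t. mrows (vec3 0 0 (c + t)) (vec3 1 0 0) (vec3 0 1 0)"
  show ?thesis
  proof (rule degeneration_in_components[where \<gamma> = ?\<gamma> and h = ?h and E = "{- c}" and \<rho> = A20])
    show "\<nu> = ?\<gamma> 0"
      by (rule mtable_eqI) (simp_all add: vec_eq_iff forall_3 z P1 L c_def[symmetric] 2[unfolded \<kappa>_def])
    show "det (?h t) \<noteq> 0" if t: "t \<notin> {- c}" for t
      using t by (auto simp: det_3 algebra_simps add_eq_0_iff)
  qed (intro isCont_table; simp | simp add: alg_hom_check algebra_simps component_sets_def)+
  qed
qed

text \<open>The idempotent annihilates the plane of \<open>e2\<close> and \<open>e3\<close>, about
  whose product the Peirce rules say nothing; cubic freeness makes every square in the plane
  proportional to its root.\<close>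

lemma peirce_00_00:
  assumes P: "peirce \<nu> l r" and L: "l 2 = 0" "r 2 = 0" "l 3 = 0" "r 3 = 0" and cf: "cubic_free \<nu>"
  shows "\<nu> \<in> \<Union>component_sets"
proof -
  note z = peirce_zero[OF P] and P1 = peirceD(2-)[OF P] and A = associative_components[OF peirceD(1)[OF P]]
  let ?m = "alg_mult \<nu>"
  let ?e = "axis 1 1 :: complex^3"
  have P': "\<nu> $ 1 $ i = l i *s axis i 1" "\<nu> $ i $ 1 = r i *s axis i 1" for i
    using P by (auto simp: peirce_def)
  have ann: "?m ?e (vec3 0 a b) = 0" "?m (vec3 0 a b) ?e = 0" for a b
    unfolding alg_mult_axis_left alg_mult_axis_right by (simp_all add: sum_3 P' L)
  have ee: "\<nu> $ 1 $ 1 = ?e" by (simp add: P' P1)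
  have det: "det3 z (?m z z) ?e = 0" if z: "z = vec3 0 a b" for z a b
  proof -
    note A' = associative_algebrasD[OF peirceD(1)[OF P]]
    have ze: "?m ?e z = 0" "?m z ?e = 0" "?m ?e (?m z z) = 0" unfolding z by (simp_all flip: A' add: ann)
    have 0: "det3 (s *s ?e + z) (s\<^sup>2 *s ?e + ?m z z) (s ^ 3 *s ?e + ?m z (?m z z)) = 0" for s
      using cf[unfolded cubic_free_def, rule_format, of "s *s ?e + z"]
      by (simp add: alg_mult_bilinear ze ee power2_eq_square power3_eq_cube mult.assoc)
    \<comment> \<open>the third difference in \<open>s\<close> isolates the coefficient of \<open>s\<^sup>3\<close>\<close>
    have "6 * det3 z (?m z z) ?e = det3 (3 *s ?e + z) (3\<^sup>2 *s ?e + ?m z z) (3 ^ 3 *s ?e + ?m z (?m z z))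
        - 3 * det3 (2 *s ?e + z) (2\<^sup>2 *s ?e + ?m z z) (2 ^ 3 *s ?e + ?m z (?m z z))
        + 3 * det3 (1 *s ?e + z) (1\<^sup>2 *s ?e + ?m z z) (1 ^ 3 *s ?e + ?m z (?m z z))
        - det3 (0 *s ?e + z) (0\<^sup>2 *s ?e + ?m z z) (0 ^ 3 *s ?e + ?m z (?m z z))"
      by (simp add: det3_eq axis_def algebra_simps)
    then show ?thesis unfolding 0 by simp
  qed
  \<comment> \<open>Now \<open>e2\<close> and \<open>e3\<close> have the squares
    \<open>p *s e2\<close> and \<open>q *s e3\<close>. The vectors \<open>e2 + e3\<close> and
    \<open>e2 - e3\<close> then fix the symmetric part of the product.\<close>
  define p where "p = \<nu>$2$2$2"
  define q where "q = \<nu>$3$3$3"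
  define \<alpha> where "\<alpha> = \<nu>$2$3$2"
  define \<beta> where "\<beta> = \<nu>$2$3$3"
  have 2: "\<nu>$2$2$3 = 0" and 3: "\<nu>$3$3$2 = 0"
    using det[of "vec3 0 1 0" 1 0] det[of "vec3 0 0 1" 0 1]
    by (simp_all add: det3_eq axis_def alg_mult_component sum_3)
  have "\<nu>$2$3$2 + \<nu>$3$2$2 = q" "\<nu>$2$3$3 + \<nu>$3$2$3 = p"
  proof -
    have "q + (\<nu>$2$3$3 + \<nu>$3$2$3) - (p + (\<nu>$2$3$2 + \<nu>$3$2$2)) = 0"
      using det[of "vec3 0 1 1" 1 1] by (simp add: det3_eq axis_def alg_mult_component sum_3 2 3 p_def q_def algebra_simps)
    moreover have "(q - (\<nu>$2$3$3 + \<nu>$3$2$3)) + (p - (\<nu>$2$3$2 + \<nu>$3$2$2)) = 0"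
      using det[of "vec3 0 1 (-1)" 1 "-1"] by (simp add: det3_eq axis_def alg_mult_component sum_3 2 3 p_def q_def algebra_simps)
    ultimately have "2 * (q - (\<nu>$2$3$2 + \<nu>$3$2$2)) = 0" "2 * (p - (\<nu>$2$3$3 + \<nu>$3$2$3)) = 0"
      by algebra+
    then show "\<nu>$2$3$2 + \<nu>$3$2$2 = q" "\<nu>$2$3$3 + \<nu>$3$2$3 = p"
      by (simp_all only: mult_eq_0_iff right_minus_eq) simp_all
  qed
  then have 32: "\<nu>$3$2$2 = q - \<alpha>" "\<nu>$3$2$3 = p - \<beta>" by (auto simp: \<alpha>_def \<beta>_def algebra_simps)
  note defs = p_def[symmetric] q_def[symmetric] \<alpha>_def[symmetric] \<beta>_def[symmetric]
  have e1: "\<alpha> * \<beta> = 0" using A[of 2 2 3 2] by (auto simp add: z P1 L 2 3 32 defs)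
  have e2: "\<beta> * \<beta> = p * \<beta>" using A[of 2 2 3 3] by (auto simp add: z P1 L 2 3 32 defs e1)
  have e3: "\<alpha> * \<alpha> = q * \<alpha>" using A[of 2 3 3 2] by (auto simp add: z P1 L 2 3 32 defs e1 mult.commute)
  have e4: "(q - \<alpha>) * (p - \<beta>) = 0" using A[of 3 3 2 3] by (auto simp add: z P1 L 2 3 32 defs e1 algebra_simps)
  \<comment> \<open>With the functional \<lambda> taking the values \<open>p\<close> and
    \<open>q\<close> on \<open>e2\<close> and \<open>e3\<close>, the plane has either the product
    \<open>x y = \<lambda>(y) x\<close> or \<open>x y = \<lambda>(x) y\<close>. Perturbing
    \<open>p\<close> makes \<lambda> nonzero, and it becomes the first coordinate in
    \<open>A24\<close> or \<open>A23\<close>.\<close>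
  have "(\<alpha> = q \<and> \<beta> = 0) \<or> (\<alpha> = 0 \<and> \<beta> = p)"
    using e1 e2 e3 e4 by auto
  then show ?thesis
  proof
    assume ab: "\<alpha> = q \<and> \<beta> = 0"
  let ?\<gamma> = "\<lambda>t. mtable (vec3 1 0 0) 0 0 0 (vec3 0 (p + t) 0) (vec3 0 q 0) 0 (vec3 0 0 (p + t)) (vec3 0 0 q)"
  let ?h = "\<lambda>t. mrows (vec3 0 (p + t) q) (vec3 1 0 0) (vec3 0 0 1)"
  show ?thesis
  proof (rule degeneration_in_components[where \<gamma> = ?\<gamma> and h = ?h and E = "{- p}" and \<rho> = A24])
    show "\<nu> = ?\<gamma> 0"
      by (rule mtable_eqI) (simp_all add: vec_eq_iff forall_3 z P1 L 2 3 32 defs ab)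
    show "det (?h t) \<noteq> 0" if t: "t \<notin> {- p}" for t
      using t by (auto simp: det_3 algebra_simps add_eq_0_iff)
  qed (intro isCont_table; simp | simp add: alg_hom_check algebra_simps component_sets_def)+
  next
    assume ab: "\<alpha> = 0 \<and> \<beta> = p"
  let ?\<gamma> = "\<lambda>t. mtable (vec3 1 0 0) 0 0 0 (vec3 0 (p + t) 0) (vec3 0 0 (p + t)) 0 (vec3 0 q 0) (vec3 0 0 q)"
  let ?h = "\<lambda>t. mrows (vec3 0 (p + t) q) (vec3 1 0 0) (vec3 0 0 1)"
  show ?thesis
  proof (rule degeneration_in_components[where \<gamma> = ?\<gamma> and h = ?h and E = "{- p}" and \<rho> = A23])
    show "\<nu> = ?\<gamma> 0"
      by (rule mtable_eqI) (simp_all add: vec_eq_iff forall_3 z P1 L 2 3 32 defs ab)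
    show "det (?h t) \<noteq> 0" if t: "t \<notin> {- p}" for t
      using t by (auto simp: det_3 algebra_simps add_eq_0_iff)
  qed (intro isCont_table; simp | simp add: alg_hom_check algebra_simps component_sets_def)+
  qed
qed

section \<open>Unital algebras and the general case\<close>

lemma ex_basis3:
  assumes "u \<noteq> 0" obtains v w where "det3 u v w \<noteq> 0"
proof -
  obtain i where i: "u $ i \<noteq> 0" using assms by (auto simp: vec_eq_iff)
  have "det3 u (axis 2 1) (axis 3 1) = u $ 1" "det3 u (axis 3 1) (axis 1 1) = u $ 2"
    "det3 u (axis 1 1) (axis 2 1) = u $ 3"
    by (simp_all add: det3_eq axis_def)
  then show ?thesis using i exhaust_3[of i] that by metis
qed

text \<open>Every element satisfies a quadratic equation over the line of \<open>e\<close>, and the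
  absence of further idempotents forces double roots. The outcome is the unital algebra whose
  radical is a plane with zero product.\<close>

lemma unital_in_components:
  assumes \<mu>: "\<mu> \<in> associative_algebras" and cf: "cubic_free \<mu>" and "e \<noteq> 0"
    and unit: "\<And>v. alg_mult \<mu> e v = v" "\<And>v. alg_mult \<mu> v e = v"
    and idem: "\<And>f. alg_mult \<mu> f f = f \<Longrightarrow> f = 0 \<or> f = e"
  shows "\<mu> \<in> \<Union>component_sets"
proof -
  let ?m = "alg_mult \<mu>"
  note A = associative_algebrasD[OF \<mu>]
  have det: "det3 e z (?m z z) = 0" for z
  proof -
    let ?f = "\<lambda>s. det3 (s *s e + z) (s\<^sup>2 *s e + 2 *s (s *s z) + ?m z z)
        (s ^ 3 *s e + 3 *s (s\<^sup>2 *s z) + 3 *s (s *s ?m z z) + ?m z (?m z z))"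
    have 0: "?f s = 0" for s
    proof -
      let ?z = "s *s e + z"
      have z2: "?m ?z ?z = s\<^sup>2 *s e + 2 *s (s *s z) + ?m z z"
        by (simp add: alg_mult_bilinear unit vec_eq_iff power2_eq_square)
      have "?m ?z (?m ?z ?z) = s ^ 3 *s e + 3 *s (s\<^sup>2 *s z) + 3 *s (s *s ?m z z) + ?m z (?m z z)"
        unfolding z2 by (simp add: alg_mult_bilinear unit vec_eq_iff power2_eq_square power3_eq_cube algebra_simps)
      then show ?thesis using cf[unfolded cubic_free_def, rule_format, of ?z] z2 by simp
    qed
    \<comment> \<open>the third difference in \<open>s\<close> isolates the coefficient of \<open>s\<^sup>3\<close>\<close>
    have "6 * det3 e z (?m z z) = ?f 3 - 3 * ?f 2 + 3 * ?f 1 - ?f 0"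
      by (simp add: det3_linear) (simp add: det3_eq algebra_simps)
    then show ?thesis unfolding 0 by simp
  qed
  \<comment> \<open>With \<open>k\<close> a root of the quadratic equation of \<open>x\<close>, the
    square of \<open>x - k *s e\<close> is a multiple of itself; a nonzero factor would yield an
    idempotent other than 0 and \<open>e\<close>.\<close>
  have shift: "\<exists>k. ?m (x - k *s e) (x - k *s e) = 0" if w: "det3 e x w \<noteq> 0" for x w
  proof -
    obtain a b c where xx: "?m x x = a *s e + b *s x + c *s w" using basis3_expand[OF w] by metis
    have "c = 0" using det[of x] w unfolding xx by (simp add: det3_linear)
    then have xx: "?m x x = a *s e + b *s x" using xx by simp
    obtain k where k: "k\<^sup>2 = b * k + a" using quadratic_root by blast
    define y where "y = x - k *s e"
    have "?m y y = ?m x x - (2 * k) *s x + k\<^sup>2 *s e"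
      by (simp add: y_def alg_mult_bilinear unit vec_eq_iff power2_eq_square algebra_simps)
    also have "\<dots> = (b - 2 * k) *s y"
    proof -
      have a: "a = k\<^sup>2 - b * k" using k by simp
      show ?thesis unfolding xx y_def a by (simp add: vec_eq_iff algebra_simps power2_eq_square)
    qed
    finally have "?m y y = (b - 2 * k) *s y" .
    then obtain c where yy: "?m y y = c *s y" by blast
    have y: "y \<noteq> d *s e" for d
    proof
      assume "y = d *s e"
      then have "x = (k + d) *s e" by (simp add: y_def vec_eq_iff algebra_simps)
      then show False using w by (simp add: det3_linear)
    qed
    have "c = 0"
    proof (rule ccontr)
      assume ne: "c \<noteq> 0"
      define f where "f = (1 / c) *s y"
      have "?m f f = f" using ne by (simp add: f_def alg_mult_bilinear yy)
      then have "f = 0 \<or> f = e" by (rule idem)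
      moreover have "y = c *s f" using ne by (simp add: f_def)
      ultimately show False using y[of 0] y[of "c"] by auto
    qed
    then show ?thesis using yy by (auto simp: y_def)
  qed
  obtain x0 y0 where xy0: "det3 e x0 y0 \<noteq> 0" using ex_basis3[OF \<open>e \<noteq> 0\<close>] by blast
  then have "det3 e y0 x0 \<noteq> 0" by (simp add: det3_eq algebra_simps)
  then obtain k k' where k: "?m (x0 - k *s e) (x0 - k *s e) = 0" "?m (y0 - k' *s e) (y0 - k' *s e) = 0"
    using shift xy0 by meson
  define x where "x = x0 - k *s e"
  define y where "y = y0 - k' *s e"
  have D: "det3 e x y \<noteq> 0" using xy0 by (simp add: x_def y_def det3_linear)
  have xx: "?m x x = 0" "?m y y = 0" using k by (simp_all add: x_def y_def)
  obtain a b c where xy: "?m x y = a *s e + b *s x + c *s y" using basis3_expand[OF D] by metis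
  obtain a' b' c' where yx: "?m y x = a' *s e + b' *s x + c' *s y" using basis3_expand[OF D] by metis
  have swap: "det3 e y x = - det3 e x y" by (simp add: det3_eq algebra_simps)
  have minus: "det3 u v (- w) = - det3 u v w" for u v w by (simp add: det3_eq algebra_simps)
  \<comment> \<open>As \<open>x\<close> and \<open>y\<close> have square zero, the squares of
    \<open>x + y\<close> and \<open>x - y\<close> are \<open>xy + yx\<close> up to sign. Their
    dependence on \<open>e\<close> and the root gives two equations that force
    \<open>xy + yx\<close> onto the line of \<open>e\<close>.\<close>
  have "(c + c' - (b + b')) * det3 e x y = det3 e (x + y) (?m (x + y) (x + y))"
    by (simp add: alg_mult_bilinear xx xy yx det3_linear swap algebra_simps)
  then have 1: "c + c' - (b + b') = 0" using det D by simp
  have "(c + c' + (b + b')) * det3 e x y = - det3 e (x - y) (?m (x - y) (x - y))"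
    by (simp add: alg_mult_bilinear xx xy yx det3_linear swap minus algebra_simps)
  then have "c + c' + (b + b') = 0" using det D by simp
  with 1 have bc: "b' = - b" "c' = - c" by algebra+
  have "(c * a) *s e + (a + c * b) *s x + (c * c) *s y = ?m x (?m x y)"
    unfolding xy alg_mult_bilinear unit xx by (simp add: xy vec_eq_iff algebra_simps)
  also have "\<dots> = 0" by (simp flip: A add: xx)
  finally have ac: "a = 0" "c = 0" using det3_independent[OF D] by fastforce+
  have "0 *s e + (b * b) *s x + 0 *s y = ?m (?m x y) y"
    unfolding xy ac by (simp add: alg_mult_bilinear xy ac)
  also have "\<dots> = 0" by (simp add: A xx)
  finally have b: "b = 0" using det3_independent[OF D] by fastforce
  have "0 *s e + a' *s x + 0 *s y = ?m (?m y x) x"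
    unfolding yx bc b ac by (simp add: alg_mult_bilinear unit)
  also have "\<dots> = 0" by (simp add: A xx)
  finally have "a' = 0" using det3_independent[OF D] by fastforce
  then have 0: "?m x y = 0" "?m y x = 0" unfolding xy yx bc b ac by simp_all
  obtain \<nu> B where B: "invertible B" "alg_hom B \<nu> \<mu>"
    and \<nu>: "\<And>i j a b c. ?m (vector [e, x, y] $ i) (vector [e, x, y] $ j) = a *s e + b *s x + c *s y
      \<Longrightarrow> \<nu> $ i $ j = vector [a, b, c]"
    using structure_constants[OF D] by metis
  \<comment> \<open>For \<open>t \<noteq> 0\<close> the vectors \<open>x\<close> and
    \<open>y\<close> divided by \<open>t\<close> are orthogonal idempotents, and the rows of the
    matrix used below are the three characters of the algebra.\<close>
  let ?\<gamma> = "\<lambda>t. mtable (vec3 1 0 0) (vec3 0 1 0) (vec3 0 0 1) (vec3 0 1 0) (vec3 0 t 0) (vec3 0 0 0)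
     (vec3 0 0 1) (vec3 0 0 0) (vec3 0 0 t)"
  have "\<nu> = ?\<gamma> 0" by (intro mtable_eqI \<nu>) (simp_all add: unit xx 0)
  moreover have "?\<gamma> 0 \<in> orbit_closure A07"
  proof (rule degeneration[where \<gamma> = ?\<gamma> and h = "\<lambda>t. mrows (vec3 1 t 0) (vec3 1 0 t) (vec3 1 0 0)" and E = "{0}"])
    show "det (mrows (vec3 1 t 0) (vec3 1 0 t) (vec3 1 0 0)) \<noteq> 0" if "t \<notin> {0}" for t :: complex
      using that by (simp add: det_3)
  qed (intro isCont_table; simp | simp add: alg_hom_check)+
  ultimately have "\<nu> \<in> \<Union>component_sets" by (intro in_Union_components(1)) simp
  moreover have "\<mu> \<in> gl_orbit \<nu>" using B gl_orbit_sym unfolding gl_orbit_iff by metis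
  ultimately show ?thesis by (rule Union_components_orbit)
qed

text \<open>Four Peirce types give ten unordered pairs. The missing pair, both of type (1,1), would
  make \<open>e\<close> a unit.\<close>

lemma peirce_basis_in_components:
  assumes \<mu>: "\<mu> \<in> associative_algebras" and D: "det3 e x y \<noteq> 0" and ee: "alg_mult \<mu> e e = e"
    and x: "alg_mult \<mu> e x = l2 *s x" "alg_mult \<mu> x e = r2 *s x"
    and y: "alg_mult \<mu> e y = l3 *s y" "alg_mult \<mu> y e = r3 *s y"
    and cases: "(l2, r2, l3, r3) \<in> {(1,1,1,0), (1,1,0,1), (1,1,0,0), (1,0,1,0), (1,0,0,1), (1,0,0,0),
      (0,1,0,1), (0,1,0,0), (0,0,0,0)}"
  shows "\<mu> \<in> \<Union>component_sets"
proof -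
  let ?m = "alg_mult \<mu>"
  obtain \<nu> B where B: "invertible B" "alg_hom B \<nu> \<mu>"
    and \<nu>: "\<And>i j a b c. ?m (vector [e, x, y] $ i) (vector [e, x, y] $ j) = a *s e + b *s x + c *s y
      \<Longrightarrow> \<nu> $ i $ j = vector [a, b, c]"
    using structure_constants[OF D] by metis
  have o: "\<mu> \<in> gl_orbit \<nu>" using B gl_orbit_sym unfolding gl_orbit_iff by metis
  have \<nu>A: "\<nu> \<in> associative_algebras" using associative_gl_orbit[OF \<mu> gl_orbit_sym[OF o]] .
  have tab: "\<nu>$1$1 = vec3 1 0 0" "\<nu>$1$2 = vec3 0 l2 0" "\<nu>$1$3 = vec3 0 0 l3"
    "\<nu>$2$1 = vec3 0 r2 0" "\<nu>$3$1 = vec3 0 0 r3"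
    by (rule \<nu>; simp add: ee x y)+
  have P: "peirce \<nu> (($) (vec3 1 l2 l3)) (($) (vec3 1 r2 r3))"
    unfolding peirce_def using \<nu>A by (simp add: forall_3 tab vec_eq_iff axis_def)
  have "\<nu> \<in> \<Union>component_sets"
  proof (cases "cubic_free \<nu>")
    case False
    then show ?thesis using not_cubic_free_in_closure[OF \<nu>A] in_Union_components(1) by blast
  next
    case True
    show ?thesis
      using cases peirce_11_10[OF P] peirce_11_01[OF P] peirce_11_00[OF P] peirce_10_10[OF P]
        peirce_10_01[OF P] peirce_10_00[OF P] peirce_01_01[OF P] peirce_01_00[OF P]
        peirce_00_00[OF P] True
      by auto
  qed
  then show ?thesis using o by (rule Union_components_orbit)
qed

lemma associative_in_components:
  assumes \<mu>: "\<mu> \<in> associative_algebras"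
  shows "\<mu> \<in> \<Union>component_sets"
proof (cases "cubic_free \<mu>")
  case False
  then show ?thesis using not_cubic_free_in_closure[OF \<mu>] in_Union_components(1) by blast
next
  case cf: True
  let ?m = "alg_mult \<mu>"
  note A = associative_algebrasD[OF \<mu>]
  show ?thesis
  proof (cases "\<forall>f. ?m f f = f \<longrightarrow> f = 0")
    case True
    then show ?thesis using nil_in_closure[OF \<mu> cube_zero[OF \<mu> cf]] in_Union_components(8) by blast
  next
    case ex: False
    show ?thesis
    proof (cases "\<forall>e. ?m e e = e \<longrightarrow> e \<noteq> 0 \<longrightarrow> (\<forall>v. ?m e v = v \<and> ?m v e = v)")
      case True
      then obtain e where "e \<noteq> 0" and unit: "\<And>v. ?m e v = v \<and> ?m v e = v" using ex by blast
      \<comment> \<open>A nonzero idempotent is here a two-sided unit, and two units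
        coincide.\<close>
      moreover have "f = 0 \<or> f = e" if "?m f f = f" for f
        using True that unit by metis
      ultimately show ?thesis using unital_in_components[OF \<mu> cf] by blast
    next
      case False
      then obtain e v0 where e: "?m e e = e" "e \<noteq> 0" and v0: "?m e v0 \<noteq> v0 \<or> ?m v0 e \<noteq> v0" by blast
      define H where "H = {x. \<exists>l\<in>{0, 1}. \<exists>r\<in>{0, 1}. ?m e x = l *s x \<and> ?m x e = r *s x}"
      have ee: "?m e (?m e v) = ?m e v" for v by (simp flip: A add: e)
      have ee': "?m (?m v e) e = ?m v e" for v by (simp add: A e)
      have dec: "\<exists>a\<in>H. \<exists>b\<in>H. \<exists>c\<in>H. \<exists>d\<in>H. v = a + b + c + d" for v
      proof -
        let ?a = "?m e (?m v e)" and ?b = "?m e v - ?m e (?m v e)" and ?c = "?m v e - ?m e (?m v e)"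
        let ?d = "v - ?m e v - ?m v e + ?m e (?m v e)"
        note s = alg_mult_bilinear ee ee' A e
        have "?m e ?a = 1 *s ?a \<and> ?m ?a e = 1 *s ?a" by (simp add: s)
        moreover have "?m e ?b = 1 *s ?b \<and> ?m ?b e = 0 *s ?b" by (simp add: s)
        moreover have "?m e ?c = 0 *s ?c \<and> ?m ?c e = 1 *s ?c" by (simp add: s)
        moreover have "?m e ?d = 0 *s ?d \<and> ?m ?d e = 0 *s ?d" by (simp add: s)
        ultimately have "?a \<in> H" "?b \<in> H" "?c \<in> H" "?d \<in> H" unfolding H_def by blast+
        moreover have "v = ?a + ?b + ?c + ?d" by simp
        ultimately show ?thesis by blast
      qed
      \<comment> \<open>By trilinearity, a determinant vanishing on all pairs of Peirce vectors
        would vanish on all pairs, although \<open>e\<close> extends to a basis.\<close>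
      have "\<exists>x\<in>H. \<exists>y\<in>H. det3 e x y \<noteq> 0"
      proof (rule ccontr)
        assume "\<not> ?thesis"
        then have 0: "det3 e x y = 0" if "x \<in> H" "y \<in> H" for x y using that by blast
        have "det3 e v w = 0" if "v \<in> H" for v w
          using dec[of w] 0 that by (auto simp: det3_linear)
        then have "det3 e v w = 0" for v w
          using dec[of v] by (auto simp: det3_linear)
        then show False using ex_basis3[OF e(2)] by metis
      qed
      then obtain x y l2 r2 l3 r3 where D: "det3 e x y \<noteq> 0"
        and lr: "l2 = 0 \<or> l2 = 1" "r2 = 0 \<or> r2 = 1" "l3 = 0 \<or> l3 = 1" "r3 = 0 \<or> r3 = 1"
        and x: "?m e x = l2 *s x" "?m x e = r2 *s x" and y: "?m e y = l3 *s y" "?m y e = r3 *s y"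
        unfolding H_def by blast
      have D': "det3 e y x \<noteq> 0" using D by (simp add: det3_eq algebra_simps)
      have "\<not> (l2 = 1 \<and> r2 = 1 \<and> l3 = 1 \<and> r3 = 1)"
      proof
        assume 1: "l2 = 1 \<and> r2 = 1 \<and> l3 = 1 \<and> r3 = 1"
        obtain a b c where "v0 = a *s e + b *s x + c *s y" using basis3_expand[OF D] by metis
        then have "?m e v0 = v0" "?m v0 e = v0" using 1 x y e by (simp_all add: alg_mult_bilinear)
        then show False using v0 by blast
      qed
      then have "(l2, r2, l3, r3) \<in> {(1,1,1,0), (1,1,0,1), (1,1,0,0), (1,0,1,0), (1,0,0,1), (1,0,0,0),
          (0,1,0,1), (0,1,0,0), (0,0,0,0)} \<or>
        (l3, r3, l2, r2) \<in> {(1,1,1,0), (1,1,0,1), (1,1,0,0), (1,0,1,0), (1,0,0,1), (1,0,0,0),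
          (0,1,0,1), (0,1,0,0), (0,0,0,0)}"
        using lr by (elim disjE) simp_all
      then show ?thesis
        using peirce_basis_in_components[OF \<mu> D e(1) x y] peirce_basis_in_components[OF \<mu> D' e(1) y x]
        by (elim disjE)
    qed
  qed
qed


section \<open>Invariants\<close>

definition ltrace :: "'n::finite multiplication \<Rightarrow> complex^'n \<Rightarrow> complex" where
  "ltrace \<mu> x = (\<Sum>i\<in>UNIV. alg_mult \<mu> x (axis i 1) $ i)"

definition rtrace :: "'n::finite multiplication \<Rightarrow> complex^'n \<Rightarrow> complex" where
  "rtrace \<mu> x = (\<Sum>i\<in>UNIV. alg_mult \<mu> (axis i 1) x $ i)"

lemma trace_conjugate:
  assumes h: "invertible (h :: complex^'n^'n)" and eq: "\<And>x. h *v F x = G (h *v x)"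
    and F: "Vector_Spaces.linear (*s) (*s) F" and G: "Vector_Spaces.linear (*s) (*s) G"
  shows "trace (matrix F) = trace (matrix G)"
proof -
  let ?g = "matrix_inv h"
  have "matrix G = h ** (matrix F ** ?g)"
    by (simp add: matrix_eq matrix_works[OF F] matrix_works[OF G] eq matrix_inv_cancel[OF h] flip: matrix_vector_mul_assoc)
  then have "trace (matrix G) = trace (h ** (matrix F ** ?g))" by (rule arg_cong)
  also have "\<dots> = trace ((matrix F ** ?g) ** h)" by (rule trace_mul_sym)
  also have "(matrix F ** ?g) ** h = matrix F"
    by (simp add: matrix_eq matrix_inv_cancel[OF h] flip: matrix_vector_mul_assoc)
  finally show ?thesis ..
qed

lemma linear_alg_mult:
  "Vector_Spaces.linear (*s) (*s) (alg_mult \<mu> x)" "Vector_Spaces.linear (*s) (*s) (\<lambda>y. alg_mult \<mu> y x)"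
  by (unfold_locales; simp add: alg_mult_bilinear)+

lemma ltrace_hom:
  assumes "invertible h" "alg_hom h \<mu> \<nu>" shows "ltrace \<nu> (h *v x) = ltrace \<mu> x"
  using trace_conjugate[OF assms(1) _ linear_alg_mult(1)[of \<mu> x] linear_alg_mult(1)[of \<nu> "h *v x"]] assms(2)
  by (simp add: ltrace_def alg_hom_def trace_def matrix_def)

lemma rtrace_hom:
  assumes "invertible h" "alg_hom h \<mu> \<nu>" shows "rtrace \<nu> (h *v x) = rtrace \<mu> x"
  using trace_conjugate[OF assms(1) _ linear_alg_mult(2)[of \<mu> x] linear_alg_mult(2)[of \<nu> "h *v x"]] assms(2)
  by (simp add: rtrace_def alg_hom_def trace_def matrix_def)

lemma trace_linear:
  "ltrace \<mu> (x + y) = ltrace \<mu> x + ltrace \<mu> y" "ltrace \<mu> (c *s x) = c * ltrace \<mu> x"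
  "rtrace \<mu> (x + y) = rtrace \<mu> x + rtrace \<mu> y" "rtrace \<mu> (c *s x) = c * rtrace \<mu> x"
  by (simp_all add: ltrace_def rtrace_def alg_mult_bilinear sum.distrib sum_distrib_left)

lemma poly_funs_trace:
  assumes "\<And>i. (\<lambda>\<mu>. x \<mu> $ i) \<in> poly_funs"
  shows "(\<lambda>\<mu>. ltrace \<mu> (x \<mu>)) \<in> poly_funs" "(\<lambda>\<mu>. rtrace \<mu> (x \<mu>)) \<in> poly_funs"
  unfolding ltrace_def rtrace_def
  by (intro poly_funs_sum poly_funs_alg_mult assms poly_funs.const)+

lemma poly_funs_det3:
  assumes "\<And>i. (\<lambda>\<mu>. x \<mu> $ i) \<in> poly_funs" "\<And>i. (\<lambda>\<mu>. y \<mu> $ i) \<in> poly_funs" "\<And>i. (\<lambda>\<mu>. z \<mu> $ i) \<in> poly_funs"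
  shows "(\<lambda>\<mu>. det3 (x \<mu>) (y \<mu>) (z \<mu>)) \<in> poly_funs"
  unfolding det3_eq by (intro poly_funs_diff poly_funs.add poly_funs.mult assms)

lemma poly_funs_vec_add:
  assumes "(\<lambda>\<mu>. x \<mu> $ i) \<in> poly_funs" "(\<lambda>\<mu>. y \<mu> $ i) \<in> poly_funs"
  shows "(\<lambda>\<mu>. (x \<mu> + y \<mu>) $ i) \<in> poly_funs"
  using poly_funs.add[OF assms] by simp

lemma poly_funs_vec_diff:
  assumes "(\<lambda>\<mu>. x \<mu> $ i) \<in> poly_funs" "(\<lambda>\<mu>. y \<mu> $ i) \<in> poly_funs"
  shows "(\<lambda>\<mu>. (x \<mu> - y \<mu>) $ i) \<in> poly_funs"
  using poly_funs_diff[OF assms] by simp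

lemma poly_funs_vec_smult:
  assumes "(\<lambda>\<mu>. c \<mu>) \<in> poly_funs" "(\<lambda>\<mu>. x \<mu> $ i) \<in> poly_funs"
  shows "(\<lambda>\<mu>. (c \<mu> *s x \<mu>) $ i) \<in> poly_funs"
  using poly_funs.mult[OF assms] by simp

lemma poly_funs_divide: "p \<in> poly_funs \<Longrightarrow> (\<lambda>\<mu>. p \<mu> / c) \<in> poly_funs"
  using poly_funs.mult[OF _ poly_funs.const[of "1 / c"]] by simp

lemmas poly_funs_rules = poly_funs_alg_mult poly_funs_vec_add poly_funs_vec_diff poly_funs_vec_smult poly_funs_trace poly_funs_det3
  poly_funs_diff poly_funs.add poly_funs.mult poly_funs_divide poly_funs_power poly_funs.const

definition gl_invariant :: "(3 multiplication \<Rightarrow> bool) \<Rightarrow> bool" where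
  "gl_invariant P \<longleftrightarrow> (\<forall>h \<mu> \<nu>. invertible h \<longrightarrow> alg_hom h \<mu> \<nu> \<longrightarrow> P \<nu> \<longrightarrow> P \<mu>)"

lemma closure_invariant:
  assumes "gl_invariant P" "closedin zariski {\<mu>. P \<mu>}" "P \<nu>" "\<mu> \<in> orbit_closure \<nu>"
  shows "P \<mu>"
proof -
  have "gl_orbit \<nu> \<subseteq> {\<mu>. P \<mu>}" using assms(1,3) by (auto simp: gl_invariant_def gl_orbit_iff)
  then have "orbit_closure \<nu> \<subseteq> {\<mu>. P \<mu>}" using assms(2) by (rule closure_of_minimal)
  then show ?thesis using assms(4) by blast
qed

lemma gl_invariant_conj: "gl_invariant P \<Longrightarrow> gl_invariant Q \<Longrightarrow> gl_invariant (\<lambda>\<mu>. P \<mu> \<and> Q \<mu>)"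
  unfolding gl_invariant_def by blast

text \<open>On each rigid algebra other than \<open>A07\<close>, suitable combinations of the two
  traces are coordinate functionals. The coefficients come from inverting the trace formulas: on
  \<open>A20\<close> the traces are \<open>2 * x1 + x2\<close> and \<open>x1 + 2 * x2\<close>,
  whence 2/3 and -1/3.\<close>

definition weight :: "complex \<Rightarrow> complex \<Rightarrow> 3 multiplication \<Rightarrow> complex^3 \<Rightarrow> complex" where
  "weight a b \<mu> x = a * ltrace \<mu> x + b * rtrace \<mu> x"

lemma weight_hom: "invertible h \<Longrightarrow> alg_hom h \<mu> \<nu> \<Longrightarrow> weight a b \<nu> (h *v x) = weight a b \<mu> x"
  by (simp add: weight_def ltrace_hom rtrace_hom)

lemma poly_funs_weight: "(\<And>i. (\<lambda>\<mu>. x \<mu> $ i) \<in> poly_funs) \<Longrightarrow> (\<lambda>\<mu>. weight a b \<mu> (x \<mu>)) \<in> poly_funs"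
  unfolding weight_def by (rule poly_funs_rules | assumption)+

lemma weight_linear:
  "weight a b \<mu> (x + y) = weight a b \<mu> x + weight a b \<mu> y" "weight a b \<mu> (c *s x) = c * weight a b \<mu> x"
  by (simp_all add: weight_def trace_linear algebra_simps)

definition multiplicative :: "complex \<Rightarrow> complex \<Rightarrow> 3 multiplication \<Rightarrow> bool" where
  "multiplicative a b \<mu> \<longleftrightarrow> (\<forall>x y. weight a b \<mu> (alg_mult \<mu> x y) = weight a b \<mu> x * weight a b \<mu> y)"

text \<open>One scheme for several laws: \<open>s = -1\<close> with zero weights is commutativity,
  \<open>s = 0\<close> says that a product is a multiple of one factor as in \<open>A17\<close> and
  \<open>A18\<close>, and \<open>s = 1\<close> describes the symmetrized product of
  \<open>A19\<close>.\<close>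

definition product_rule :: "complex \<Rightarrow> complex \<Rightarrow> complex \<Rightarrow> complex \<Rightarrow> complex \<Rightarrow> 3 multiplication \<Rightarrow> bool" where
  "product_rule s a b c d \<mu> \<longleftrightarrow>
     (\<forall>x y. alg_mult \<mu> x y + s *s alg_mult \<mu> y x = weight a b \<mu> x *s y + weight c d \<mu> y *s x)"

text \<open>For fixed \<open>v\<close> the expression \<open>x v - weight x v\<close> then behaves
  under products like the second coordinate of \<open>A19\<close>; in \<open>right_rule\<close> the
  expression \<open>v x - weight x v\<close> behaves like the third.\<close>

definition left_rule :: "complex \<Rightarrow> complex \<Rightarrow> 3 multiplication \<Rightarrow> bool" where
  "left_rule a b \<mu> \<longleftrightarrow> (\<forall>x y v. alg_mult \<mu> (alg_mult \<mu> x y) v - weight a b \<mu> (alg_mult \<mu> x y) *s v =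
     weight a b \<mu> y *s (alg_mult \<mu> x v - weight a b \<mu> x *s v))"

definition right_rule :: "complex \<Rightarrow> complex \<Rightarrow> 3 multiplication \<Rightarrow> bool" where
  "right_rule a b \<mu> \<longleftrightarrow> (\<forall>x y v. alg_mult \<mu> v (alg_mult \<mu> x y) - weight a b \<mu> (alg_mult \<mu> x y) *s v =
     weight a b \<mu> x *s (alg_mult \<mu> v y - weight a b \<mu> y *s v))"

text \<open>For fixed \<open>v\<close> the commutator with \<open>v\<close> then satisfies the
  product law of the third coordinate in \<open>A20\<close>, \<open>A23\<close> or
  \<open>A24\<close>, up to the choice of the two weights.\<close>

definition commutator_rule :: "complex \<Rightarrow> complex \<Rightarrow> complex \<Rightarrow> complex \<Rightarrow> 3 multiplication \<Rightarrow> bool" where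
  "commutator_rule a b c d \<mu> \<longleftrightarrow> (\<forall>x y v. alg_mult \<mu> (alg_mult \<mu> x y) v - alg_mult \<mu> v (alg_mult \<mu> x y) =
     weight a b \<mu> x *s (alg_mult \<mu> y v - alg_mult \<mu> v y) + weight c d \<mu> y *s (alg_mult \<mu> x v - alg_mult \<mu> v x))"

text \<open>In \<open>A20\<close>, \<open>A23\<close> and \<open>A24\<close> the product \<open>xy\<close> is a combination of \<open>x\<close> and \<open>y\<close> plus \<open>\<theta>(x) \<psi>(y) u\<close> with
  functionals \<open>\<theta>, \<psi>\<close> and a fixed vector \<open>u\<close>, so \<open>det3 (xy) x y\<close> is \<open>\<theta>(x) \<psi>(y)\<close> times a factor that is
  alternating in \<open>x\<close> and \<open>y\<close>.\<close>

definition det_rule :: "3 multiplication \<Rightarrow> bool" where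
  "det_rule \<mu> \<longleftrightarrow> (\<forall>x y. det3 (alg_mult \<mu> x y) x y * det3 (alg_mult \<mu> y x) x y =
     det3 (alg_mult \<mu> x x) x y * det3 (alg_mult \<mu> y y) x y)"

lemmas rule_defs = multiplicative_def product_rule_def left_rule_def right_rule_def commutator_rule_def det_rule_def

lemma closedin_rules:
  "closedin zariski {\<mu>. multiplicative a b \<mu>}" "closedin zariski {\<mu>. product_rule s a b c d \<mu>}"
  "closedin zariski {\<mu>. left_rule a b \<mu>}" "closedin zariski {\<mu>. right_rule a b \<mu>}"
  "closedin zariski {\<mu>. commutator_rule a b c d \<mu>}" "closedin zariski {\<mu>. det_rule \<mu>}"
  unfolding rule_defs
  by ((rule closedin_zariski_Collect_all)+; (rule closedin_zariski_vec_eq | rule closedin_eq_set);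
      (rule poly_funs_weight poly_funs_rules)+)+

text \<open>Traces are preserved by isomorphisms, so every identity is carried over by
  \<open>h\<close>. Both sides of \<open>det_rule\<close> contain two determinants and pick up the
  same power of \<open>det h\<close>.\<close>

lemma gl_invariant_rules:
  "gl_invariant (multiplicative a b)" "gl_invariant (product_rule s a b c d)"
  "gl_invariant (left_rule a b)" "gl_invariant (right_rule a b)"
  "gl_invariant (commutator_rule a b c d)" "gl_invariant det_rule"
proof -
  have *: "multiplicative a b \<nu> \<longrightarrow> multiplicative a b \<mu>" "product_rule s a b c d \<nu> \<longrightarrow> product_rule s a b c d \<mu>"
    "left_rule a b \<nu> \<longrightarrow> left_rule a b \<mu>" "right_rule a b \<nu> \<longrightarrow> right_rule a b \<mu>"
    "commutator_rule a b c d \<nu> \<longrightarrow> commutator_rule a b c d \<mu>" "det_rule \<nu> \<longrightarrow> det_rule \<mu>"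
    if h: "invertible h" "alg_hom h \<mu> \<nu>" for h \<mu> \<nu>
  proof -
    have "det h \<noteq> 0" using h(1) by (simp add: invertible_det_nz)
    note push = matrix_vector_mult_smult matrix_vector_mult_diff_distrib matrix_vector_right_distrib
      h(2)[unfolded alg_hom_def, rule_format]
    note inj = invertible_cancel_iff[OF h(1), symmetric]
    note w = weight_hom[OF h, symmetric]
    show "multiplicative a b \<nu> \<longrightarrow> multiplicative a b \<mu>"
      unfolding multiplicative_def w push by blast
    show "product_rule s a b c d \<nu> \<longrightarrow> product_rule s a b c d \<mu>"
      unfolding product_rule_def by (subst (2) inj) (simp add: push w)
    show "left_rule a b \<nu> \<longrightarrow> left_rule a b \<mu>"
      unfolding left_rule_def by (subst (2) inj) (simp add: push w)
    show "right_rule a b \<nu> \<longrightarrow> right_rule a b \<mu>"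
      unfolding right_rule_def by (subst (2) inj) (simp add: push w)
    show "commutator_rule a b c d \<nu> \<longrightarrow> commutator_rule a b c d \<mu>"
      unfolding commutator_rule_def by (subst (2) inj) (simp add: push w)
    have d: "det3 u v w = det3 (h *v u) (h *v v) (h *v w) / det h" for u v w
      using \<open>det h \<noteq> 0\<close> by (simp add: det3_matrix)
    show "det_rule \<nu> \<longrightarrow> det_rule \<mu>"
      unfolding det_rule_def d[of "alg_mult \<mu> _ _"] push by simp
  qed
  show "gl_invariant (multiplicative a b)" "gl_invariant (product_rule s a b c d)"
    "gl_invariant (left_rule a b)" "gl_invariant (right_rule a b)"
    "gl_invariant (commutator_rule a b c d)" "gl_invariant det_rule"
    unfolding gl_invariant_def using * by blast+
qed

section \<open>Closed invariants of the seven rigid algebras\<close>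

definition inv_A07 :: "3 multiplication \<Rightarrow> bool" where
  "inv_A07 \<mu> \<longleftrightarrow> product_rule (- 1) 0 0 0 0 \<mu>"

definition inv_A17 :: "3 multiplication \<Rightarrow> bool" where
  "inv_A17 \<mu> \<longleftrightarrow> product_rule 0 0 1 0 0 \<mu>"

definition inv_A18 :: "3 multiplication \<Rightarrow> bool" where
  "inv_A18 \<mu> \<longleftrightarrow> product_rule 0 0 0 1 0 \<mu>"

text \<open>The symmetrized product rule separates \<open>A19\<close> from the other algebras; the
  remaining three rules provide the coordinates of a homomorphism to \<open>A19\<close>.\<close>

definition inv_A19 :: "3 multiplication \<Rightarrow> bool" where
  "inv_A19 \<mu> \<longleftrightarrow> multiplicative (1/2) 0 \<mu> \<and> product_rule 1 (1/2) 0 (1/2) 0 \<mu> \<and>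
     left_rule (1/2) 0 \<mu> \<and> right_rule (1/2) 0 \<mu>"

definition inv_A20 :: "3 multiplication \<Rightarrow> bool" where
  "inv_A20 \<mu> \<longleftrightarrow> multiplicative (2/3) (-1/3) \<mu> \<and> multiplicative (-1/3) (2/3) \<mu> \<and>
     commutator_rule (2/3) (-1/3) (-1/3) (2/3) \<mu> \<and> det_rule \<mu>"

definition inv_A23 :: "3 multiplication \<Rightarrow> bool" where
  "inv_A23 \<mu> \<longleftrightarrow> multiplicative 1 (-1) \<mu> \<and> multiplicative (-1) 2 \<mu> \<and> commutator_rule 1 (-1) 0 0 \<mu> \<and> det_rule \<mu>"

definition inv_A24 :: "3 multiplication \<Rightarrow> bool" where
  "inv_A24 \<mu> \<longleftrightarrow> multiplicative (-1) 1 \<mu> \<and> multiplicative 2 (-1) \<mu> \<and> commutator_rule 0 0 (-1) 1 \<mu> \<and> det_rule \<mu>"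

lemmas inv_defs = inv_A07_def inv_A17_def inv_A18_def inv_A19_def inv_A20_def inv_A23_def inv_A24_def

lemma closedin_inv:
  "closedin zariski {\<mu>. inv_A07 \<mu>}" "closedin zariski {\<mu>. inv_A17 \<mu>}" "closedin zariski {\<mu>. inv_A18 \<mu>}"
  "closedin zariski {\<mu>. inv_A19 \<mu>}" "closedin zariski {\<mu>. inv_A20 \<mu>}" "closedin zariski {\<mu>. inv_A23 \<mu>}"
  "closedin zariski {\<mu>. inv_A24 \<mu>}"
  unfolding inv_defs by (intro closedin_zariski_Collect_conj closedin_rules)+

lemma gl_invariant_inv:
  "gl_invariant inv_A07" "gl_invariant inv_A17" "gl_invariant inv_A18" "gl_invariant inv_A19"
  "gl_invariant inv_A20" "gl_invariant inv_A23" "gl_invariant inv_A24"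
  unfolding inv_defs[abs_def] by (intro gl_invariant_conj gl_invariant_rules)+

lemma traces:
  "ltrace A07 x = x$1 + x$2 + x$3" "rtrace A07 x = x$1 + x$2 + x$3"
  "ltrace (A14 \<alpha>) x = 0" "rtrace (A14 \<alpha>) x = 0"
  "ltrace A17 x = 3 * x$1" "rtrace A17 x = x$1"
  "ltrace A18 x = x$1" "rtrace A18 x = 3 * x$1"
  "ltrace A19 x = 2 * x$1" "rtrace A19 x = 2 * x$1"
  "ltrace A20 x = 2 * x$1 + x$2" "rtrace A20 x = x$1 + 2 * x$2"
  "ltrace A23 x = 2 * x$1 + x$2" "rtrace A23 x = x$1 + x$2"
  "ltrace A24 x = x$1 + x$2" "rtrace A24 x = 2 * x$1 + x$2"
  by (simp_all add: ltrace_def rtrace_def sum_3 algebra_mult axis_def)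

lemma inv_self: "inv_A07 A07" "inv_A17 A17" "inv_A18 A18" "inv_A19 A19" "inv_A20 A20" "inv_A23 A23" "inv_A24 A24"
  unfolding inv_defs rule_defs weight_def
  by (simp_all add: algebra_mult traces det3_eq vec_eq_iff forall_3 field_simps)

lemmas evaluate = algebra_nth algebra_mult traces weight_def det3_eq vec_eq_iff forall_3 axis_def

lemma product_ruleD:
  assumes "product_rule s a b c d \<mu>"
  shows "\<mu> $ i $ j + s *s \<mu> $ j $ i = weight a b \<mu> (axis i 1) *s axis j 1 + weight c d \<mu> (axis j 1) *s axis i 1"
  using assms[unfolded product_rule_def, rule_format, of "axis i 1" "axis j 1"] by simp

lemma multiplicativeD:
  assumes "multiplicative a b \<mu>"
  shows "weight a b \<mu> (\<mu> $ i $ j) = weight a b \<mu> (axis i 1) * weight a b \<mu> (axis j 1)"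
  using assms[unfolded multiplicative_def, rule_format, of "axis i 1" "axis j 1"] by simp

lemma not_inv_A07:
  "\<not> inv_A07 (A14 2)" "\<not> inv_A07 A17" "\<not> inv_A07 A18" "\<not> inv_A07 A19" "\<not> inv_A07 A20" "\<not> inv_A07 A23" "\<not> inv_A07 A24"
  unfolding inv_A07_def
  by (rule notI, frule product_ruleD[of _ _ _ _ _ _ 1 2], drule product_ruleD[of _ _ _ _ _ _ 1 3], simp add: evaluate)+

lemma not_inv_A17:
  "\<not> inv_A17 (A14 2)" "\<not> inv_A17 A07" "\<not> inv_A17 A18" "\<not> inv_A17 A19" "\<not> inv_A17 A20" "\<not> inv_A17 A23" "\<not> inv_A17 A24"
  unfolding inv_A17_def
  by (rule notI, frule product_ruleD[of _ _ _ _ _ _ 1 2], drule product_ruleD[of _ _ _ _ _ _ 1 1], simp add: evaluate)+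

lemma not_inv_A18:
  "\<not> inv_A18 (A14 2)" "\<not> inv_A18 A07" "\<not> inv_A18 A17" "\<not> inv_A18 A19" "\<not> inv_A18 A20" "\<not> inv_A18 A23" "\<not> inv_A18 A24"
  unfolding inv_A18_def
  by (rule notI, frule product_ruleD[of _ _ _ _ _ _ 2 1], drule product_ruleD[of _ _ _ _ _ _ 1 1], simp add: evaluate)+

lemma not_inv_A19:
  "\<not> inv_A19 (A14 2)" "\<not> inv_A19 A07" "\<not> inv_A19 A17" "\<not> inv_A19 A18" "\<not> inv_A19 A20" "\<not> inv_A19 A23" "\<not> inv_A19 A24"
  unfolding inv_A19_def
  by (rule notI, elim conjE, frule product_ruleD[of _ _ _ _ _ _ 1 2], frule product_ruleD[of _ _ _ _ _ _ 1 1],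
      drule product_ruleD[of _ _ _ _ _ _ 2 2], simp add: evaluate)+

text \<open>On the first two basis vectors the squares vanish, and the rule would say
  \<open>1 - \<alpha>\<^sup>2 = 0\<close>. So a representative of the family with \<alpha> different
  from 1 and -1 is taken.\<close>

lemma not_det_rule_A14: "\<not> det_rule (A14 2)"
  unfolding det_rule_def
  by (rule notI, drule spec[of _ "axis 1 1"], drule spec[of _ "axis 2 1"]) (simp add: evaluate)

lemma not_inv_A20:
  "\<not> inv_A20 (A14 2)" "\<not> inv_A20 A07" "\<not> inv_A20 A17" "\<not> inv_A20 A18" "\<not> inv_A20 A19" "\<not> inv_A20 A23" "\<not> inv_A20 A24"
proof -
  show "\<not> inv_A20 (A14 2)" unfolding inv_A20_def using not_det_rule_A14 by blast
qed (unfold inv_A20_def, (rule notI, elim conjE, frule multiplicativeD[of "2/3" _ _ 1 1], drule multiplicativeD[of "2/3" _ _ 2 2], simp add: evaluate)+)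

lemma not_inv_A23:
  "\<not> inv_A23 (A14 2)" "\<not> inv_A23 A07" "\<not> inv_A23 A17" "\<not> inv_A23 A18" "\<not> inv_A23 A19" "\<not> inv_A23 A20" "\<not> inv_A23 A24"
proof -
  show "\<not> inv_A23 (A14 2)" unfolding inv_A23_def using not_det_rule_A14 by blast
qed (unfold inv_A23_def, (rule notI, elim conjE, drule multiplicativeD[of 1 _ _ 2 2], frule multiplicativeD[of "-1" _ _ 1 1],
    drule multiplicativeD[of "-1" _ _ 1 2], simp add: evaluate)+)

lemma not_inv_A24:
  "\<not> inv_A24 (A14 2)" "\<not> inv_A24 A07" "\<not> inv_A24 A17" "\<not> inv_A24 A18" "\<not> inv_A24 A19" "\<not> inv_A24 A20" "\<not> inv_A24 A23"
proof -
  show "\<not> inv_A24 (A14 2)" unfolding inv_A24_def using not_det_rule_A14 by blast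
qed (unfold inv_A24_def, (rule notI, elim conjE, drule multiplicativeD[of "-1" _ _ 1 1], frule multiplicativeD[of 2 _ _ 1 1],
    drule multiplicativeD[of 2 _ _ 1 2], simp add: evaluate)+)


section \<open>Open orbits\<close>

lemma linear_vec3:
  assumes "\<And>x y. f (x + y) = f x + f y" "\<And>c x. f (c *s x) = c * f x"
    "\<And>x y. g (x + y) = g x + g y" "\<And>c x. g (c *s x) = c * g x"
    "\<And>x y. h (x + y) = h x + h y" "\<And>c x. h (c *s x) = c * h x"
  shows "Vector_Spaces.linear (*s) (*s) (\<lambda>x :: complex^3. vec3 (f x) (g x) (h x))"
  by (unfold_locales; simp add: vec_eq_iff forall_3 assms)

text \<open>A homomorphism to \<open>\<nu>\<close> that depends polynomially on the algebra is an isomorphism on an open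
  set, so \<open>gl_orbit \<nu>\<close> contains an open subset of its closure.\<close>

lemma openin_gl_orbit_hom:
  assumes \<nu>: "\<nu> \<in> associative_algebras" and C: "orbit_closure \<nu> \<in> component_sets"
    and other: "\<And>C. C \<in> component_sets \<Longrightarrow> C \<noteq> orbit_closure \<nu> \<Longrightarrow> \<nu> \<notin> C"
    and lin: "\<And>\<mu>. Vector_Spaces.linear (*s) (*s) (F \<mu>)"
    and poly: "\<And>x i. (\<lambda>\<mu>. F \<mu> x $ i) \<in> poly_funs"
    and hom: "\<And>\<mu> x y. \<mu> \<in> orbit_closure \<nu> \<Longrightarrow> F \<mu> (alg_mult \<mu> x y) = alg_mult \<nu> (F \<mu> x) (F \<mu> y)"
    and det: "det (matrix (F \<nu>)) \<noteq> 0"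
  shows "openin assoc_variety (gl_orbit \<nu>)"
proof (rule openin_gl_orbitI)
  let ?C = "orbit_closure \<nu>"
  let ?Z = "\<Union>(component_sets - {?C}) \<union> {\<mu>. det (matrix (F \<mu>)) = 0}"
  let ?U = "associative_algebras - ?Z"
  have cl: "closedin zariski C" if "C \<in> component_sets" for C
    using that unfolding component_sets_def by auto
  have "(\<lambda>\<mu>. det (matrix (F \<mu>))) \<in> poly_funs"
    unfolding det_3 matrix_def vec_lambda_beta
    by (intro poly_funs_diff poly_funs.add poly_funs.mult poly)
  moreover have "finite component_sets" by (simp add: component_sets_def)
  ultimately have "closedin zariski ?Z"
    by (intro closedin_Un closedin_zero_set closedin_Union) (auto intro: cl)
  then have "openin zariski (- ?Z)" by (simp add: closedin_def Compl_eq_Diff_UNIV)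
  then show "openin assoc_variety ?U"
    unfolding assoc_variety_def openin_subtopology by blast
  show "\<nu> \<in> ?U" using \<nu> other det by blast
  show "?U \<subseteq> gl_orbit \<nu>"
  proof
    fix \<mu> assume \<mu>: "\<mu> \<in> ?U"
    then have "\<mu> \<in> \<Union>component_sets" using associative_in_components by blast
    then have "\<mu> \<in> ?C" using \<mu> by blast
    then have "alg_hom (matrix (F \<mu>)) \<mu> \<nu>" by (simp add: alg_hom_def matrix_works[OF lin] hom)
    then show "\<mu> \<in> gl_orbit \<nu>" using \<mu> in_gl_orbitI by blast
  qed
qed

lemma closure_inv:
  "\<mu> \<in> orbit_closure A07 \<Longrightarrow> inv_A07 \<mu>"
  "\<mu> \<in> orbit_closure A17 \<Longrightarrow> inv_A17 \<mu>"
  "\<mu> \<in> orbit_closure A18 \<Longrightarrow> inv_A18 \<mu>"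
  "\<mu> \<in> orbit_closure A19 \<Longrightarrow> inv_A19 \<mu>"
  "\<mu> \<in> orbit_closure A20 \<Longrightarrow> inv_A20 \<mu>"
  "\<mu> \<in> orbit_closure A23 \<Longrightarrow> inv_A23 \<mu>"
  "\<mu> \<in> orbit_closure A24 \<Longrightarrow> inv_A24 \<mu>"
  using closure_invariant gl_invariant_inv closedin_inv inv_self by blast+

text \<open>Left multiplications in the family are nilpotent, and vanishing trace is a closed
  condition; an algebra with a left multiplication of nonzero trace is thus kept out of this
  component.\<close>

lemma A14_family_ltrace:
  assumes "\<mu> \<in> zariski closure_of A14_family"
  shows "ltrace \<mu> x = 0"
proof -
  have "zariski closure_of A14_family \<subseteq> {\<mu>. \<forall>x. ltrace \<mu> x = 0}"
  proof (rule closure_of_minimal)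
    show "A14_family \<subseteq> {\<mu>. \<forall>x. ltrace \<mu> x = 0}"
    proof (intro subsetI CollectI allI)
      fix \<mu> x assume "\<mu> \<in> A14_family"
      then obtain \<alpha> h where h: "invertible h" "alg_hom h \<mu> (A14 \<alpha>)"
        by (auto simp: A14_family_def gl_orbit_iff)
      then have "ltrace \<mu> x = ltrace (A14 \<alpha>) (h *v x)" by (simp add: ltrace_hom)
      then show "ltrace \<mu> x = 0" by (simp add: traces)
    qed
    show "closedin zariski {\<mu> :: 3 multiplication. \<forall>x. ltrace \<mu> x = 0}"
      by (intro closedin_zariski_Collect_all closedin_zero_set poly_funs_trace(1) poly_funs.const)
  qed
  then show ?thesis using assms by blast
qed

lemma A14_in_family: "\<alpha> \<noteq> 0 \<Longrightarrow> A14 \<alpha> \<in> A14_family"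
  unfolding A14_family_def using gl_orbit_refl by blast

lemma not_in_closure_family:
  "A07 \<notin> zariski closure_of A14_family" "A17 \<notin> zariski closure_of A14_family"
  "A18 \<notin> zariski closure_of A14_family" "A19 \<notin> zariski closure_of A14_family"
  "A20 \<notin> zariski closure_of A14_family" "A23 \<notin> zariski closure_of A14_family"
  "A24 \<notin> zariski closure_of A14_family"
  using A14_family_ltrace[of _ "axis 1 1"] by (auto simp: traces axis_def dest!: A14_family_ltrace[of _ "axis 1 1"])

section \<open>Mutual position of the seven orbits and the family\<close>

lemma in_own_closure: "\<nu> \<in> orbit_closure \<nu>"
  by (intro orbit_in_closure gl_orbit_refl)

definition rigid_reps :: "3 multiplication set" where
  "rigid_reps = {A07, A17, A18, A19, A20, A23, A24}"

lemma component_sets_eq: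
  "component_sets = insert (zariski closure_of A14_family) ((\<lambda>\<nu>. orbit_closure \<nu>) ` rigid_reps)"
  unfolding component_sets_def rigid_reps_def by auto

lemma rigid_reps_not_in_closure:
  assumes "\<nu> \<in> rigid_reps" "\<rho> \<in> rigid_reps" "\<nu> \<in> orbit_closure \<rho>"
  shows "\<nu> = \<rho>"
  using assms(1,2) closure_inv[of \<nu>] assms(3) not_inv_A07 not_inv_A17 not_inv_A18 not_inv_A19
    not_inv_A20 not_inv_A23 not_inv_A24
  unfolding rigid_reps_def by auto

lemma rigid_reps_not_in_family: "\<nu> \<in> rigid_reps \<Longrightarrow> \<nu> \<notin> zariski closure_of A14_family"
  unfolding rigid_reps_def using not_in_closure_family by auto

lemma A14_not_in_closure:
  assumes "\<rho> \<in> rigid_reps" shows "A14 2 \<notin> orbit_closure \<rho>"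
  using assms closure_inv[of "A14 2"] not_inv_A07 not_inv_A17 not_inv_A18 not_inv_A19
    not_inv_A20 not_inv_A23 not_inv_A24
  unfolding rigid_reps_def by auto

lemma rigid_reps_other_components:
  assumes "\<nu> \<in> rigid_reps" "C \<in> component_sets" "C \<noteq> orbit_closure \<nu>"
  shows "\<nu> \<notin> C"
  using assms rigid_reps_not_in_closure[OF assms(1)] rigid_reps_not_in_family[OF assms(1)]
  unfolding component_sets_eq by auto

lemma rigid_reps_associative: "\<nu> \<in> rigid_reps \<Longrightarrow> \<nu> \<in> associative_algebras"
  unfolding rigid_reps_def using algebras_associative by auto

lemma openin_gl_orbit_hom':
  assumes "\<nu> \<in> rigid_reps" "\<And>\<mu>. \<mu> \<in> orbit_closure \<nu> \<Longrightarrow> P \<mu>"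
    and "\<And>\<mu>. Vector_Spaces.linear (*s) (*s) (\<lambda>x :: complex^3. vec3 (f \<mu> x) (g \<mu> x) (h \<mu> x))"
    and "\<And>x. (\<lambda>\<mu>. f \<mu> x) \<in> poly_funs" "\<And>x. (\<lambda>\<mu>. g \<mu> x) \<in> poly_funs" "\<And>x. (\<lambda>\<mu>. h \<mu> x) \<in> poly_funs"
    and "\<And>\<mu> x y. P \<mu> \<Longrightarrow> vec3 (f \<mu> (alg_mult \<mu> x y)) (g \<mu> (alg_mult \<mu> x y)) (h \<mu> (alg_mult \<mu> x y)) =
      alg_mult \<nu> (vec3 (f \<mu> x) (g \<mu> x) (h \<mu> x)) (vec3 (f \<mu> y) (g \<mu> y) (h \<mu> y))"
    and "det (matrix (\<lambda>x. vec3 (f \<nu> x) (g \<nu> x) (h \<nu> x))) \<noteq> 0"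
  shows "openin assoc_variety (gl_orbit \<nu>)"
proof (rule openin_gl_orbit_hom[where F = "\<lambda>\<mu> x. vec3 (f \<mu> x) (g \<mu> x) (h \<mu> x)"])
  show "\<nu> \<in> associative_algebras" "orbit_closure \<nu> \<in> component_sets"
    using assms(1) rigid_reps_associative component_sets_eq by auto
  show "\<nu> \<notin> C" if "C \<in> component_sets" "C \<noteq> orbit_closure \<nu>" for C
    using rigid_reps_other_components assms(1) that by blast
  show "(\<lambda>\<mu>. vec3 (f \<mu> x) (g \<mu> x) (h \<mu> x) $ i) \<in> poly_funs" for x i
    using exhaust_3[of i] assms(4-6) by (elim disjE) simp_all
qed (use assms in auto)

text \<open>On the closure, \<open>x y\<close> is a scalar depending on \<open>x\<close> times
  \<open>y\<close>, so every linear functional has the product law of the second and third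
  coordinates of \<open>A17\<close>. The chosen ones are the coordinates at \<open>A17\<close>
  itself.\<close>

lemma openin_gl_orbit_A17: "openin assoc_variety (gl_orbit A17)"
proof (rule openin_gl_orbit_hom'[where P = inv_A17 and f = "weight 0 1" and g = "\<lambda>_ x. x $ 2" and h = "\<lambda>_ x. x $ 3"])
  show "Vector_Spaces.linear (*s) (*s) (\<lambda>x. vec3 (weight 0 1 \<mu> x) (x $ 2) (x $ 3))" for \<mu>
    by (rule linear_vec3) (simp_all add: weight_linear)
  show "vec3 (weight 0 1 \<mu> (alg_mult \<mu> x y)) (alg_mult \<mu> x y $ 2) (alg_mult \<mu> x y $ 3) =
      alg_mult A17 (vec3 (weight 0 1 \<mu> x) (x $ 2) (x $ 3)) (vec3 (weight 0 1 \<mu> y) (y $ 2) (y $ 3))"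
    if "inv_A17 \<mu>" for \<mu> x y
    using that[unfolded inv_A17_def product_rule_def, rule_format, of x y]
    by (simp add: A17_mult weight_def trace_linear)
  show "det (matrix (\<lambda>x. vec3 (weight 0 1 A17 x) (x $ 2) (x $ 3))) \<noteq> 0"
    by (simp add: matrix_def det_3 weight_def traces axis_def)
qed (auto simp: rigid_reps_def closure_inv intro: poly_funs_weight poly_funs.const)

lemma openin_gl_orbit_A18: "openin assoc_variety (gl_orbit A18)"
proof (rule openin_gl_orbit_hom'[where P = inv_A18 and f = "weight 1 0" and g = "\<lambda>_ x. x $ 2" and h = "\<lambda>_ x. x $ 3"])
  show "Vector_Spaces.linear (*s) (*s) (\<lambda>x. vec3 (weight 1 0 \<mu> x) (x $ 2) (x $ 3))" for \<mu>
    by (rule linear_vec3) (simp_all add: weight_linear)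
  show "vec3 (weight 1 0 \<mu> (alg_mult \<mu> x y)) (alg_mult \<mu> x y $ 2) (alg_mult \<mu> x y $ 3) =
      alg_mult A18 (vec3 (weight 1 0 \<mu> x) (x $ 2) (x $ 3)) (vec3 (weight 1 0 \<mu> y) (y $ 2) (y $ 3))"
    if "inv_A18 \<mu>" for \<mu> x y
    using that[unfolded inv_A18_def product_rule_def, rule_format, of x y]
    by (simp add: A18_mult weight_def trace_linear mult.commute)
  show "det (matrix (\<lambda>x. vec3 (weight 1 0 A18 x) (x $ 2) (x $ 3))) \<noteq> 0"
    by (simp add: matrix_def det_3 weight_def traces axis_def)
qed (auto simp: rigid_reps_def closure_inv intro: poly_funs_weight poly_funs.const)

text \<open>\<open>?g\<close> and \<open>?h\<close> are coordinates of the expressions in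
  \<open>left_rule\<close> and \<open>right_rule\<close> at the fixed vector
  \<open>?e\<close>.\<close>

lemma openin_gl_orbit_A19: "openin assoc_variety (gl_orbit A19)"
proof -
  let ?e = "axis 1 1 :: complex^3"
  let ?f = "weight (1/2) 0"
  let ?g = "\<lambda>\<mu> x. (alg_mult \<mu> x ?e - ?f \<mu> x *s ?e) $ 2"
  let ?h = "\<lambda>\<mu> x. (alg_mult \<mu> ?e x - ?f \<mu> x *s ?e) $ 3"
  show ?thesis
  proof (rule openin_gl_orbit_hom'[where P = inv_A19 and f = ?f and g = ?g and h = ?h])
    show "Vector_Spaces.linear (*s) (*s) (\<lambda>x. vec3 (?f \<mu> x) (?g \<mu> x) (?h \<mu> x))" for \<mu>
      by (rule linear_vec3) (simp_all add: weight_linear alg_mult_bilinear algebra_simps)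
    show "vec3 (?f \<mu> (alg_mult \<mu> x y)) (?g \<mu> (alg_mult \<mu> x y)) (?h \<mu> (alg_mult \<mu> x y)) =
        alg_mult A19 (vec3 (?f \<mu> x) (?g \<mu> x) (?h \<mu> x)) (vec3 (?f \<mu> y) (?g \<mu> y) (?h \<mu> y))"
      if "inv_A19 \<mu>" for \<mu> x y
      using that
      unfolding A19_mult vector_3 inv_A19_def multiplicative_def left_rule_def right_rule_def
      by (auto simp only: vector_smult_component mult.commute)
    show "det (matrix (\<lambda>x. vec3 (?f A19 x) (?g A19 x) (?h A19 x))) \<noteq> 0"
      by (simp add: matrix_def det_3 weight_def traces A19_nth axis_def[of 1] axis_def[of 2] axis_def[of 3] A19_mult)
    show "(\<lambda>\<mu>. ?g \<mu> x) \<in> poly_funs" for x by (rule poly_funs_weight poly_funs_rules)+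
    show "(\<lambda>\<mu>. ?h \<mu> x) \<in> poly_funs" for x by (rule poly_funs_weight poly_funs_rules)+
  qed (auto simp: rigid_reps_def closure_inv intro: poly_funs_weight poly_funs.const)
qed

text \<open>Two weights are multiplicative and give the first two coordinates; the third is a
  coordinate of the commutator with a fixed vector.\<close>

lemma openin_gl_orbit_commutator:
  assumes \<nu>: "\<nu> \<in> rigid_reps"
    and rules: "\<And>\<mu>. \<mu> \<in> orbit_closure \<nu> \<Longrightarrow>
      multiplicative a b \<mu> \<and> multiplicative c d \<mu> \<and> commutator_rule p q r s \<mu>"
    and mult: "\<And>\<mu> x y t u. alg_mult \<nu> (vec3 (weight a b \<mu> x) (weight c d \<mu> x) t) (vec3 (weight a b \<mu> y) (weight c d \<mu> y) u) =
      vec3 (weight a b \<mu> x * weight a b \<mu> y) (weight c d \<mu> x * weight c d \<mu> y) (weight p q \<mu> x * u + weight r s \<mu> y * t)"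
    and det: "det (matrix (\<lambda>x. vec3 (weight a b \<nu> x) (weight c d \<nu> x)
      ((alg_mult \<nu> x (axis 1 1) - alg_mult \<nu> (axis 1 1) x) $ 3))) \<noteq> 0"
  shows "openin assoc_variety (gl_orbit \<nu>)"
proof -
  let ?h = "\<lambda>\<mu> x. (alg_mult \<mu> x (axis 1 1) - alg_mult \<mu> (axis 1 1) x) $ 3"
  show ?thesis
  proof (rule openin_gl_orbit_hom'[where f = "weight a b" and g = "weight c d" and h = ?h, OF \<nu> rules])
    show "Vector_Spaces.linear (*s) (*s) (\<lambda>x. vec3 (weight a b \<mu> x) (weight c d \<mu> x) (?h \<mu> x))" for \<mu>
      by (rule linear_vec3) (simp_all add: weight_linear alg_mult_bilinear algebra_simps)
    show "vec3 (weight a b \<mu> (alg_mult \<mu> x y)) (weight c d \<mu> (alg_mult \<mu> x y)) (?h \<mu> (alg_mult \<mu> x y)) =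
        alg_mult \<nu> (vec3 (weight a b \<mu> x) (weight c d \<mu> x) (?h \<mu> x)) (vec3 (weight a b \<mu> y) (weight c d \<mu> y) (?h \<mu> y))"
      if "multiplicative a b \<mu> \<and> multiplicative c d \<mu> \<and> commutator_rule p q r s \<mu>" for \<mu> x y
      using that unfolding mult multiplicative_def commutator_rule_def
      by (auto simp only: vector_smult_component vector_add_component)
    show "(\<lambda>\<mu>. ?h \<mu> x) \<in> poly_funs" for x by (rule poly_funs_rules)+
    show "det (matrix (\<lambda>x. vec3 (weight a b \<nu> x) (weight c d \<nu> x) (?h \<nu> x))) \<noteq> 0" by (rule det)
  qed (auto intro: poly_funs_weight poly_funs.const)
qed

lemma openin_gl_orbit_A20: "openin assoc_variety (gl_orbit A20)"
  by (rule openin_gl_orbit_commutator[where a = "2/3" and b = "-1/3" and c = "-1/3" and d = "2/3"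
        and p = "2/3" and q = "-1/3" and r = "-1/3" and s = "2/3"])
    (use closure_inv(5) in \<open>auto simp: rigid_reps_def inv_A20_def A20_mult A20_nth matrix_def det_3
       weight_def traces axis_def[of 1] axis_def[of 2] axis_def[of 3] mult.commute\<close>)

lemma openin_gl_orbit_A23: "openin assoc_variety (gl_orbit A23)"
  by (rule openin_gl_orbit_commutator[where a = 1 and b = "-1" and c = "-1" and d = 2
        and p = 1 and q = "-1" and r = 0 and s = 0])
    (use closure_inv(6) in \<open>auto simp: rigid_reps_def inv_A23_def A23_mult A23_nth matrix_def det_3
       weight_def traces axis_def[of 1] axis_def[of 2] axis_def[of 3] mult.commute\<close>)

lemma openin_gl_orbit_A24: "openin assoc_variety (gl_orbit A24)"
  by (rule openin_gl_orbit_commutator[where a = "-1" and b = 1 and c = 2 and d = "-1"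
        and p = 0 and q = 0 and r = "-1" and s = 1])
    (use closure_inv(7) in \<open>auto simp: rigid_reps_def inv_A24_def A24_mult A24_nth matrix_def det_3
       weight_def traces axis_def[of 1] axis_def[of 2] axis_def[of 3] mult.commute\<close>)

text \<open>Being generated by a fixed vector whose minimal polynomial has nonzero discriminant and
  nonzero constant term is an open condition; \<open>da / d\<close>, \<open>db / d\<close>, \<open>dc / d\<close> are the coefficients by
  Cramer's rule.\<close>

lemma openin_gl_orbit_A07: "openin assoc_variety (gl_orbit A07)"
proof (rule openin_gl_orbitI)
  \<comment> \<open>In \<open>A07\<close> the entries of a vector are the roots of its cubic; they
    only have to be distinct and nonzero.\<close>
  define z where "z = vec3 1 2 3"
  define z2 where "z2 \<mu> = alg_mult \<mu> z z" for \<mu> :: "3 multiplication"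
  define z3 where "z3 \<mu> = alg_mult \<mu> z (z2 \<mu>)" for \<mu> :: "3 multiplication"
  define z4 where "z4 \<mu> = alg_mult \<mu> z (z3 \<mu>)" for \<mu> :: "3 multiplication"
  define d where "d \<mu> = det3 z (z2 \<mu>) (z3 \<mu>)" for \<mu>
  define da where "da \<mu> = det3 (z4 \<mu>) (z2 \<mu>) (z3 \<mu>)" for \<mu>
  define db where "db \<mu> = det3 z (z4 \<mu>) (z3 \<mu>)" for \<mu>
  define dc where "dc \<mu> = det3 z (z2 \<mu>) (z4 \<mu>)" for \<mu>
  \<comment> \<open>The discriminant of
    \<open>X ^ 3 - \<gamma> * X ^ 2 - \<beta> * X - \<alpha>\<close>, multiplied by
    \<open>d ^ 4\<close> to clear the denominators of Cramer's rule.\<close>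
  define disc where "disc \<mu> = (dc \<mu>)\<^sup>2 * (db \<mu>)\<^sup>2 + 4 * (db \<mu>) ^ 3 * d \<mu> - 4 * (dc \<mu>) ^ 3 * da \<mu>
     - 18 * dc \<mu> * db \<mu> * da \<mu> * d \<mu> - 27 * (da \<mu>)\<^sup>2 * (d \<mu>)\<^sup>2" for \<mu>
  define F where "F \<mu> = d \<mu> * da \<mu> * disc \<mu>" for \<mu>
  let ?U = "associative_algebras - {\<mu>. F \<mu> = 0}"
  have z2: "(\<lambda>\<mu>. z2 \<mu> $ i) \<in> poly_funs" for i
    unfolding z2_def by (rule poly_funs_rules)+
  have z3: "(\<lambda>\<mu>. z3 \<mu> $ i) \<in> poly_funs" for i
    unfolding z3_def by (intro poly_funs_alg_mult z2 poly_funs.const)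
  have z4: "(\<lambda>\<mu>. z4 \<mu> $ i) \<in> poly_funs" for i
    unfolding z4_def by (intro poly_funs_alg_mult z3 poly_funs.const)
  have ds: "(\<lambda>\<mu>. d \<mu>) \<in> poly_funs" "(\<lambda>\<mu>. da \<mu>) \<in> poly_funs" "(\<lambda>\<mu>. db \<mu>) \<in> poly_funs" "(\<lambda>\<mu>. dc \<mu>) \<in> poly_funs"
    unfolding d_def da_def db_def dc_def by (intro poly_funs_det3 z2 z3 z4 poly_funs.const)+
  have "(\<lambda>\<mu>. F \<mu>) \<in> poly_funs"
    unfolding F_def disc_def
    by (intro poly_funs_diff poly_funs.add poly_funs.mult poly_funs_power poly_funs.const ds)
  then have "closedin zariski {\<mu>. F \<mu> = 0}" by (rule closedin_zero_set)
  then have "openin zariski (- {\<mu>. F \<mu> = 0})" by (simp add: closedin_def Compl_eq_Diff_UNIV)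
  then show "openin assoc_variety ?U"
    unfolding assoc_variety_def openin_subtopology by blast
  have e: "z2 A07 = vec3 1 4 9" "z3 A07 = vec3 1 8 27" "z4 A07 = vec3 1 16 81"
    by (simp_all add: z2_def z3_def z4_def z_def A07_mult)
  have "d A07 = 12" "da A07 = 72" "db A07 = - 132" "dc A07 = 72"
    by (simp_all add: d_def da_def db_def dc_def e z_def det3_eq)
  then have "F A07 \<noteq> 0" by (simp add: F_def disc_def)
  then show "A07 \<in> ?U" using algebras_associative by blast
  show "?U \<subseteq> gl_orbit A07"
  proof
    fix \<mu> assume "\<mu> \<in> ?U"
    then have \<mu>: "\<mu> \<in> associative_algebras" and F: "d \<mu> \<noteq> 0" "da \<mu> \<noteq> 0" "disc \<mu> \<noteq> 0"
      by (auto simp: F_def)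
    have D: "det3 z (alg_mult \<mu> z z) (alg_mult \<mu> z (alg_mult \<mu> z z)) \<noteq> 0"
      using F(1) by (simp add: d_def z3_def z2_def)
    obtain \<alpha> \<beta> \<gamma> where eq: "z4 \<mu> = \<alpha> *s z + \<beta> *s z2 \<mu> + \<gamma> *s z3 \<mu>"
      using basis3_expand[of z "z2 \<mu>" "z3 \<mu>" "z4 \<mu>"] F(1) unfolding d_def by metis
    have N: "da \<mu> = \<alpha> * d \<mu>" "db \<mu> = \<beta> * d \<mu>" "dc \<mu> = \<gamma> * d \<mu>"
      unfolding da_def db_def dc_def d_def eq by (simp_all add: det3_linear)
    obtain a b c where abc: "\<gamma> = a + b + c" "\<beta> = - (a * b + b * c + c * a)" "\<alpha> = a * b * c"
      by (rule cubic_roots)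
    have "disc \<mu> = (d \<mu>) ^ 4 * ((a - b) * (b - c) * (a - c))\<^sup>2"
      unfolding disc_def N abc by algebra
    then have "a \<noteq> b" "b \<noteq> c" "a \<noteq> c" using F(3) by auto
    moreover have "a \<noteq> 0" "b \<noteq> 0" "c \<noteq> 0" using F(2) unfolding N abc by auto
    ultimately have "cubic_table \<alpha> \<beta> \<gamma> \<in> gl_orbit A07"
      unfolding abc by (intro cubic_table_in_gl_orbit)
    moreover have "\<mu> \<in> gl_orbit (cubic_table \<alpha> \<beta> \<gamma>)"
      using eq by (intro cubic_basis_table[OF \<mu> D]) (simp add: z4_def z3_def z2_def)
    ultimately show "\<mu> \<in> gl_orbit A07" using gl_orbit_trans by blast
  qed
qed

lemma openin_rigid_reps: "\<nu> \<in> rigid_reps \<Longrightarrow> openin assoc_variety (gl_orbit \<nu>)"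
  unfolding rigid_reps_def
  using openin_gl_orbit_A07 openin_gl_orbit_A17 openin_gl_orbit_A18 openin_gl_orbit_A19
    openin_gl_orbit_A20 openin_gl_orbit_A23 openin_gl_orbit_A24 by auto


section \<open>Components and rigid algebras\<close>

lemma component_closed: "C \<in> component_sets \<Longrightarrow> closedin zariski C"
  unfolding component_sets_eq by auto

lemma component_irreducible: "C \<in> component_sets \<Longrightarrow> irreducible_in zariski C"
  unfolding component_sets_eq
  using irreducible_in_closure_of irreducible_gl_orbit irreducible_A14_family by auto

lemma component_associative:
  assumes "C \<in> component_sets" shows "C \<subseteq> associative_algebras"
proof -
  have "orbit_closure \<nu> \<subseteq> associative_algebras" if "\<nu> \<in> associative_algebras" for \<nu> :: "3 multiplication"
    using associative_gl_orbit[OF that] by (intro closure_of_minimal closedin_associative) blast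
  moreover have "zariski closure_of A14_family \<subseteq> associative_algebras"
    using associative_gl_orbit algebras_associative(2) unfolding A14_family_def
    by (intro closure_of_minimal closedin_associative) blast
  ultimately show ?thesis using assms rigid_reps_associative unfolding component_sets_eq by blast
qed

lemma topspace_assoc_variety: "topspace assoc_variety = associative_algebras"
  by (simp add: assoc_variety_def)

lemma component_antichain:
  assumes "C \<in> component_sets" "D \<in> component_sets" "C \<subseteq> D"
  shows "C = D"
proof -
  have "D = orbit_closure \<nu>" if "\<nu> \<in> rigid_reps" "C = orbit_closure \<nu>" for \<nu>
    using rigid_reps_other_components[OF that(1) assms(2)] assms(3) in_own_closure that(2) by blast
  moreover have "D = zariski closure_of A14_family" if "C = zariski closure_of A14_family"
  proof -
    have "A14 2 \<in> D"
      using A14_in_family[of 2] closure_of_subset[of A14_family zariski] assms(3) that by auto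
    then show ?thesis using A14_not_in_closure assms(2) unfolding component_sets_eq by blast
  qed
  ultimately show ?thesis using assms(1) unfolding component_sets_eq by blast
qed

lemma irreducible_components_assoc_variety: "irreducible_components assoc_variety = component_sets"
proof (rule irreducible_components_eqI)
  show "finite component_sets" by (simp add: component_sets_def)
  show "closedin assoc_variety C" if "C \<in> component_sets" for C
    using component_closed[OF that] component_associative[OF that]
    by (simp add: assoc_variety_def closedin_closed_subtopology closedin_associative)
  show "irreducible_in assoc_variety C" if "C \<in> component_sets" for C
    using component_irreducible[OF that] component_associative[OF that]
    by (simp add: assoc_variety_def irreducible_in_closed_subtopology closedin_associative)
  show "topspace assoc_variety \<subseteq> \<Union>component_sets"
    unfolding topspace_assoc_variety using associative_in_components by blast
qed (rule component_antichain)

lemma card_rigid_reps: "card rigid_reps = 7"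
proof -
  have "A07 \<noteq> A17" "A07 \<noteq> A18" "A07 \<noteq> A19" "A07 \<noteq> A20" "A07 \<noteq> A23" "A07 \<noteq> A24"
    using inv_self(1) not_inv_A07 by metis+
  moreover have "A17 \<noteq> A18" "A17 \<noteq> A19" "A17 \<noteq> A20" "A17 \<noteq> A23" "A17 \<noteq> A24"
    using inv_self(2) not_inv_A17 by metis+
  moreover have "A18 \<noteq> A19" "A18 \<noteq> A20" "A18 \<noteq> A23" "A18 \<noteq> A24"
    using inv_self(3) not_inv_A18 by metis+
  moreover have "A19 \<noteq> A20" "A19 \<noteq> A23" "A19 \<noteq> A24"
    using inv_self(4) not_inv_A19 by metis+
  moreover have "A20 \<noteq> A23" "A20 \<noteq> A24" "A23 \<noteq> A24"
    using inv_self(5,6) not_inv_A20 not_inv_A23 by metis+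
  ultimately show ?thesis by (simp add: rigid_reps_def)
qed

lemma card_component_sets: "card component_sets = 8"
proof -
  let ?f = "\<lambda>\<nu>. orbit_closure \<nu> :: 3 multiplication set"
  have "inj_on ?f rigid_reps"
    using rigid_reps_not_in_closure in_own_closure unfolding inj_on_def by metis
  then have "card (?f ` rigid_reps) = 7" by (simp add: card_image card_rigid_reps)
  moreover have "zariski closure_of A14_family \<notin> ?f ` rigid_reps"
    using rigid_reps_not_in_family in_own_closure by blast
  moreover have "finite rigid_reps" by (simp add: rigid_reps_def)
  ultimately show ?thesis by (simp add: component_sets_eq)
qed

text \<open>An equation that determines \<open>\<alpha>\<^sup>2\<close> on the orbit of \<open>A14 \<alpha>\<close>.\<close>

definition A14_equation :: "complex \<Rightarrow> 3 multiplication \<Rightarrow> bool" where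
  "A14_equation \<alpha> \<mu> \<longleftrightarrow> (\<forall>x y k. (alg_mult \<mu> x y $ k - alg_mult \<mu> y x $ k)\<^sup>2 =
     \<alpha>\<^sup>2 * ((alg_mult \<mu> x y $ k + alg_mult \<mu> y x $ k)\<^sup>2 - 4 * (alg_mult \<mu> x x $ k * alg_mult \<mu> y y $ k)))"

lemma closedin_A14_equation: "closedin zariski {\<mu>. A14_equation \<alpha> \<mu>}"
  unfolding A14_equation_def
  by (intro closedin_zariski_Collect_all closedin_eq_set poly_funs_power poly_funs_diff poly_funs.add
      poly_funs.mult poly_funs_alg_mult poly_funs.const)

lemma A14_equation_orbit:
  assumes "\<mu> \<in> gl_orbit (A14 \<alpha>)" shows "A14_equation \<alpha> \<mu>"
proof -
  obtain g where \<mu>: "\<mu> = gl_act g (A14 \<alpha>)" using assms by (auto simp: gl_orbit_def)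
  have m: "alg_mult \<mu> x y $ k = g$k$3 * ((1 + \<alpha>) * (matrix_inv g *v x)$1 * (matrix_inv g *v y)$2
      + (1 - \<alpha>) * (matrix_inv g *v x)$2 * (matrix_inv g *v y)$1)" for x y k
    unfolding \<mu> alg_mult_gl_act A14_mult matrix_vector_mult_def[of g] by (simp add: sum_3)
  have "(c * ((1 + \<alpha>) * u1 * v2 + (1 - \<alpha>) * u2 * v1) - c * ((1 + \<alpha>) * v1 * u2 + (1 - \<alpha>) * v2 * u1))\<^sup>2 =
     \<alpha>\<^sup>2 * ((c * ((1 + \<alpha>) * u1 * v2 + (1 - \<alpha>) * u2 * v1) + c * ((1 + \<alpha>) * v1 * u2 + (1 - \<alpha>) * v2 * u1))\<^sup>2
      - 4 * (c * ((1 + \<alpha>) * u1 * u2 + (1 - \<alpha>) * u2 * u1) * (c * ((1 + \<alpha>) * v1 * v2 + (1 - \<alpha>) * v2 * v1))))"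
    for c u1 u2 v1 v2 :: complex
    by algebra
  then show ?thesis unfolding A14_equation_def m by blast
qed

text \<open>At the first two basis vectors the equation would read
  \<open>16 * \<alpha>\<^sup>2 = 4 * \<alpha>\<^sup>2\<close>.\<close>

lemma not_A14_equation: "\<alpha> \<noteq> 0 \<Longrightarrow> \<not> A14_equation \<alpha> (A14 (2 * \<alpha>))"
  unfolding A14_equation_def
  by (rule notI, drule spec[of _ "axis 1 1"], drule spec[of _ "axis 2 1"], drule spec[of _ 3])
    (simp add: A14_nth power2_eq_square)

lemma openin_meets_dense:
  assumes "openin zariski V" "\<mu> \<in> V" "\<mu> \<in> zariski closure_of S"
  shows "V \<inter> S \<noteq> {}"
  using assms unfolding in_closure_of by blast

lemma rigid_algebra_iff: "rigid_algebra \<mu> \<longleftrightarrow> (\<exists>\<nu>\<in>rigid_reps. \<mu> \<in> gl_orbit \<nu>)"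
proof
  assume "\<exists>\<nu>\<in>rigid_reps. \<mu> \<in> gl_orbit \<nu>"
  then obtain \<nu> where "\<nu> \<in> rigid_reps" "\<mu> \<in> gl_orbit \<nu>" by blast
  then show "rigid_algebra \<mu>"
    using openin_rigid_reps associative_gl_orbit rigid_reps_associative gl_orbit_eq
    unfolding rigid_algebra_def by metis
next
  assume "rigid_algebra \<mu>"
  then have \<mu>: "\<mu> \<in> associative_algebras" and op: "openin assoc_variety (gl_orbit \<mu>)"
    by (auto simp: rigid_algebra_def)
  obtain V where V: "openin zariski V" "gl_orbit \<mu> = V \<inter> associative_algebras"
    using op by (auto simp: assoc_variety_def openin_subtopology)
  have \<mu>V: "\<mu> \<in> V" using V(2) gl_orbit_refl[of \<mu>] by blast
  obtain C where C: "C \<in> component_sets" "\<mu> \<in> C" using associative_in_components[OF \<mu>] by blast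
  \<comment> \<open>An open orbit meeting the family is the orbit of some
    \<open>A14 \<alpha>\<close>. The equation for \<open>\<alpha>\<^sup>2\<close> would then hold on
    a nonempty open part of the component, hence everywhere on it, but it fails at
    \<open>A14 (2 * \<alpha>)\<close>.\<close>
  have "C \<noteq> zariski closure_of A14_family"
  proof
    assume eq: "C = zariski closure_of A14_family"
    then obtain \<rho> where \<rho>: "\<rho> \<in> V" "\<rho> \<in> A14_family" using openin_meets_dense[OF V(1) \<mu>V] C(2) by blast
    then obtain \<alpha> where \<alpha>: "\<alpha> \<noteq> 0" "\<rho> \<in> gl_orbit (A14 \<alpha>)" by (auto simp: A14_family_def)
    have "\<rho> \<in> gl_orbit \<mu>"
      using \<rho>(1) V(2) associative_gl_orbit[OF algebras_associative(2) \<alpha>(2)] by blast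
    then have "gl_orbit \<mu> = gl_orbit (A14 \<alpha>)" using gl_orbit_eq \<alpha>(2) by metis
    then have "V \<inter> C \<subseteq> {\<mu>. A14_equation \<alpha> \<mu>}"
      using V(2) component_associative[OF C(1)] A14_equation_orbit by blast
    then have "C \<subseteq> {\<mu>. A14_equation \<alpha> \<mu>}"
      using C \<mu>V component_irreducible component_closed V(1) closedin_A14_equation
      by (intro irreducible_open_subset_dense[of zariski C V]) auto
    moreover have "A14 (2 * \<alpha>) \<in> C"
      using A14_in_family[of "2 * \<alpha>"] \<alpha>(1) closure_of_subset[of A14_family zariski] unfolding eq by auto
    ultimately show False using not_A14_equation[OF \<alpha>(1)] by blast
  qed
  then obtain \<nu> where \<nu>: "\<nu> \<in> rigid_reps" "C = orbit_closure \<nu>"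
    using C(1) unfolding component_sets_eq by blast
  \<comment> \<open>The orbit of \<nu> is dense in \<open>C\<close>, so the open set
    \<open>V\<close> meets it, and two orbits with a common point coincide.\<close>
  then obtain \<rho> where \<rho>: "\<rho> \<in> V" "\<rho> \<in> gl_orbit \<nu>" using openin_meets_dense[OF V(1) \<mu>V] C(2) by blast
  then have "\<rho> \<in> gl_orbit \<mu>"
    using V(2) associative_gl_orbit[OF rigid_reps_associative[OF \<nu>(1)]] by blast
  then have "\<mu> \<in> gl_orbit \<nu>" using \<rho>(2) gl_orbit_sym gl_orbit_trans by blast
  then show "\<exists>\<nu>\<in>rigid_reps. \<mu> \<in> gl_orbit \<nu>" using \<nu>(1) by blast
qed

lemma card_rigid_classes:
  "card ({\<mu> :: 3 multiplication. rigid_algebra \<mu>} // {(\<mu>, \<nu>). alg_isomorphic \<mu> \<nu>}) = 7"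
proof -
  have cls: "{(\<mu>, \<nu>). alg_isomorphic \<mu> \<nu>} `` {\<mu>} = gl_orbit \<mu>" for \<mu> :: "3 multiplication"
    using gl_orbit_sym by (auto simp: alg_isomorphic_iff)
  have "{\<mu> :: 3 multiplication. rigid_algebra \<mu>} // {(\<mu>, \<nu>). alg_isomorphic \<mu> \<nu>} = gl_orbit ` {\<mu>. rigid_algebra \<mu>}"
    unfolding quotient_def cls by blast
  also have "\<dots> = gl_orbit ` rigid_reps"
  proof
    show "gl_orbit ` {\<mu>. rigid_algebra \<mu>} \<subseteq> gl_orbit ` rigid_reps"
      using gl_orbit_eq by (auto simp: rigid_algebra_iff)
    show "gl_orbit ` rigid_reps \<subseteq> gl_orbit ` {\<mu>. rigid_algebra \<mu>}"
      using gl_orbit_refl by (intro image_mono) (auto simp: rigid_algebra_iff)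
  qed
  finally have eq: "{\<mu> :: 3 multiplication. rigid_algebra \<mu>} // {(\<mu>, \<nu>). alg_isomorphic \<mu> \<nu>} = gl_orbit ` rigid_reps" .
  have "inj_on gl_orbit rigid_reps"
  proof (rule inj_onI)
    fix \<nu> \<rho> assume "\<nu> \<in> rigid_reps" "\<rho> \<in> rigid_reps" "gl_orbit \<nu> = gl_orbit \<rho>"
    then show "\<nu> = \<rho>"
      using rigid_reps_not_in_closure in_own_closure by metis
  qed
  then show ?thesis unfolding eq by (simp add: card_image card_rigid_reps)
qed


section \<open>The dimension\<close>

text \<open>The algebra \<open>A07\<close> with its idempotents rescaled, in the basis given by a product of a lower and
  an upper unitriangular matrix.\<close>

definition chain_matrix :: "(nat \<Rightarrow> complex) \<Rightarrow> complex^3^3" where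
  "chain_matrix x = mrows (vec3 1 (x 3) (x 4)) (vec3 (x 7) (x 7 * x 3 + 1) (x 7 * x 4 + x 5))
     (vec3 (x 8) (x 8 * x 3 + x 6) (x 8 * x 4 + x 6 * x 5 + 1))"

definition diag_table :: "(nat \<Rightarrow> complex) \<Rightarrow> 3 multiplication" where
  "diag_table x = mtable (vec3 (x 0) 0 0) 0 0 0 (vec3 0 (x 1) 0) 0 0 0 (vec3 0 0 (x 2))"

definition chain_param :: "(nat \<Rightarrow> complex) \<Rightarrow> 3 multiplication" where
  "chain_param x = adj_act (chain_matrix x) (diag_table x)"

lemma diag_table_mult: "alg_mult (diag_table d) x y = vec3 (d 0 * x$1 * y$1) (d 1 * x$2 * y$2) (d 2 * x$3 * y$3)"
  by (simp add: vec_eq_iff forall_3 alg_mult_component sum_3 diag_table_def)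

lemma det_chain_matrix: "det (chain_matrix x) = 1"
  by (simp add: det_3 chain_matrix_def algebra_simps)

lemma chain_param_associative: "chain_param x \<in> associative_algebras"
proof -
  have "diag_table x \<in> associative_algebras"
    by (simp add: associative_algebras_def diag_table_mult vec_eq_iff forall_3)
  moreover have "chain_param x \<in> gl_orbit (diag_table x)"
    unfolding gl_orbit_eq_adj_act chain_param_def using det_chain_matrix by auto
  ultimately show ?thesis by (rule associative_gl_orbit)
qed

lemma param_polys_chain_param: "(\<lambda>x. chain_param x $ i $ j $ k) \<in> param_polys 9"
proof -
  have "\<forall>i j. (\<lambda>x. chain_matrix x $ i $ j) \<in> param_polys 9"
    unfolding forall_3 chain_matrix_def vector_3
    by (intro conjI param_polys.add param_polys.mult param_polys.const param_polys.var) auto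
  moreover have "\<forall>i j k. (\<lambda>x. diag_table x $ i $ j $ k) \<in> param_polys 9"
    unfolding forall_3 diag_table_def mtable_nth vector_3 zero_index
    by (intro conjI param_polys.const param_polys.var) auto
  ultimately show ?thesis unfolding chain_param_def by (intro param_polys_adj_act) auto
qed

definition chain_set :: "nat \<Rightarrow> 3 multiplication set" where
  "chain_set i = zariski closure_of (chain_param ` {x. \<forall>j\<ge>i. x j = 0})"

text \<open>Sequences vanishing from index \<open>i\<close> on are closed under passing to lines, so
  the general image criterion applies with the constant 1 as nonvanishing condition.\<close>

lemma chain_set_irreducible: "irreducible_in zariski (chain_set i)"
proof -
  have "irreducible_in zariski (chain_param ` {x\<in>{x. \<forall>j\<ge>i. x j = 0}. (1::complex) \<noteq> 0})"
    by (rule irreducible_param_image[where m = 9 and ?x0.0 = "\<lambda>_. 0"])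
      (auto intro: param_polys_chain_param param_polys.const)
  then show ?thesis unfolding chain_set_def by (intro irreducible_in_closure_of) simp
qed

lemma chain_set_associative: "chain_set i \<subseteq> associative_algebras"
  unfolding chain_set_def using chain_param_associative
  by (intro closure_of_minimal closedin_associative) auto

lemma chain_set_strictI:
  assumes "f \<in> poly_funs" "\<And>x. \<forall>j\<ge>i. x j = 0 \<Longrightarrow> f (chain_param x) = 0"
    and "\<forall>j\<ge>Suc i. p j = 0" "f (chain_param p) \<noteq> 0"
  shows "chain_set i \<subset> chain_set (Suc i)"
proof -
  have "chain_set i \<subseteq> chain_set (Suc i)"
    unfolding chain_set_def by (intro closure_of_mono image_mono) auto
  moreover have "chain_set i \<subseteq> {\<mu>. f \<mu> = 0}"
    unfolding chain_set_def using assms(2) by (intro closure_of_minimal closedin_zero_set assms(1)) auto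
  moreover have "chain_param p \<in> chain_set (Suc i)"
    unfolding chain_set_def by (rule subsetD[OF closure_of_subset]) (use assms(3) in auto)
  ultimately show ?thesis using assms(4) by blast
qed

lemma chain_set_strict_coordI:
  assumes "\<And>x. \<forall>j\<ge>i. x j = 0 \<Longrightarrow> chain_param x $ a $ b $ c = 0"
    and "\<forall>j\<ge>Suc i. p j = 0" "chain_param p $ a $ b $ c \<noteq> 0"
  shows "chain_set i \<subset> chain_set (Suc i)"
  using assms by (intro chain_set_strictI[where f = "\<lambda>\<mu>. \<mu> $ a $ b $ c"] poly_funs.coord)

lemma chain_param_nth:
  "chain_param x $ i $ j = adj3 (chain_matrix x) *v alg_mult (diag_table x) (column i (chain_matrix x)) (column j (chain_matrix x))"
  by (simp add: chain_param_def adj_act_def)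

lemmas chain_eval = chain_param_nth adj3_def chain_matrix_def diag_table_mult matrix_vector_mult_def sum_3 column_def

text \<open>The order of the parameters (scalings, upper entries, lower entries) lets a single
  structure constant detect each of the first eight steps: it vanishes until the next parameter is
  released.\<close>

lemma chain_set_strict:
  assumes "i < 9" shows "chain_set i \<subset> chain_set (Suc i)"
proof -
  let ?d = "\<lambda>\<mu> :: 3 multiplication. det3 (axis 1 1) (alg_mult \<mu> (axis 1 1) (axis 1 1))
    (alg_mult \<mu> (axis 1 1) (alg_mult \<mu> (axis 1 1) (axis 1 1)))"
  have d: "?d (chain_param x) = det3 h (alg_mult (diag_table x) h h) (alg_mult (diag_table x) h (alg_mult (diag_table x) h h))"
    if "h = vec3 1 (x 7) (x 8)" for x h
  proof -
    let ?g = "chain_matrix x"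
    have g: "?g *v alg_mult (chain_param x) u v = alg_mult (diag_table x) (?g *v u) (?g *v v)" for u v
      by (simp add: chain_param_def alg_mult_adj_act adj3_mult_right det_chain_matrix)
    have h: "?g *v axis 1 1 = h"
      unfolding matrix_vector_mult_axis that by (simp add: vec_eq_iff forall_3 column_def chain_matrix_def)
    have "?d (chain_param x) = det ?g * ?d (chain_param x)" by (simp add: det_chain_matrix)
    also have "\<dots> = det3 h (alg_mult (diag_table x) h h) (alg_mult (diag_table x) h (alg_mult (diag_table x) h h))"
      unfolding det3_matrix[symmetric] g h ..
    finally show ?thesis .
  qed
  have c0: "chain_set 0 \<subset> chain_set (Suc 0)"
    by (rule chain_set_strict_coordI[where a = 1 and b = 1 and c = 1 and p = "(\<lambda>_. 0)(0 := 1)"])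
      (auto simp: chain_eval)
  have c1: "chain_set 1 \<subset> chain_set (Suc 1)"
    by (rule chain_set_strict_coordI[where a = 2 and b = 2 and c = 2 and p = "(\<lambda>_. 0)(1 := 1)"])
      (auto simp: chain_eval)
  have c2: "chain_set 2 \<subset> chain_set (Suc 2)"
    by (rule chain_set_strict_coordI[where a = 3 and b = 3 and c = 3 and p = "(\<lambda>_. 0)(2 := 1)"])
      (auto simp: chain_eval)
  have c3: "chain_set 3 \<subset> chain_set (Suc 3)"
    by (rule chain_set_strict_coordI[where a = 1 and b = 2 and c = 1 and p = "(\<lambda>_. 0)(0 := 1, 3 := 1)"])
      (auto simp: chain_eval)
  have c4: "chain_set 4 \<subset> chain_set (Suc 4)"
    by (rule chain_set_strict_coordI[where a = 1 and b = 3 and c = 1 and p = "(\<lambda>_. 0)(0 := 1, 4 := 1)"])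
      (auto simp: chain_eval)
  have c5: "chain_set 5 \<subset> chain_set (Suc 5)"
    by (rule chain_set_strict_coordI[where a = 2 and b = 3 and c = 2 and p = "(\<lambda>_. 0)(1 := 1, 5 := 1)"])
      (auto simp: chain_eval)
  \<comment> \<open>With the other matrix parameters zero this structure constant is
    \<open>x 2 * x 6 ^ 2 - x 1 * x 6\<close>; for equal scalings the value \<open>x 6 = 1\<close>
    would make it vanish, hence 2. The same happens with \<open>x 7\<close> in the next
    step.\<close>
  have c6: "chain_set 6 \<subset> chain_set (Suc 6)"
    by (rule chain_set_strict_coordI[where a = 2 and b = 2 and c = 3 and p = "(\<lambda>_. 0)(1 := 1, 2 := 1, 6 := 2)"])
      (auto simp: chain_eval)
  have c7: "chain_set 7 \<subset> chain_set (Suc 7)"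
    by (rule chain_set_strict_coordI[where a = 1 and b = 1 and c = 2 and p = "(\<lambda>_. 0)(0 := 1, 1 := 1, 7 := 2)"])
      (auto simp: chain_eval)
  \<comment> \<open>If \<open>x 8 = 0\<close>, the first basis vector corresponds to
    \<open>(1, x 7, 0)\<close>, which lies in a subalgebra of dimension 2, so its first three powers
    are dependent. At the witness it corresponds to \<open>(1, 2, 3)\<close> with all scalings 1,
    and the determinant is of Vandermonde type.\<close>
  have c8: "chain_set 8 \<subset> chain_set (Suc 8)"
  proof (rule chain_set_strictI[where f = ?d and p = "(\<lambda>_. 0)(0 := 1, 1 := 1, 2 := 1, 7 := 2, 8 := 3)"])
    show "?d \<in> poly_funs" by (intro poly_funs_det3 poly_funs_alg_mult poly_funs.const)
    show "?d (chain_param x) = 0" if "\<forall>j\<ge>8. x j = 0" for x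
      unfolding d[OF refl] using that by (simp add: diag_table_mult det3_eq)
    show "?d (chain_param ((\<lambda>_. 0)(0 := 1, 1 := 1, 2 := 1, 7 := 2, 8 := 3))) \<noteq> 0"
      unfolding d[OF refl] by (simp add: diag_table_mult det3_eq)
  qed simp
  have "i = 0 \<or> i = 1 \<or> i = 2 \<or> i = 3 \<or> i = 4 \<or> i = 5 \<or> i = 6 \<or> i = 7 \<or> i = 8"
    using assms by arith
  then show ?thesis using c0 c1 c2 c3 c4 c5 c6 c7 c8 by (elim disjE) (simp_all only:)
qed

text \<open>The range also contains images of singular matrices. This is harmless, since only an
  upper bound for the length of chains is drawn from it.\<close>

lemma component_param:
  assumes "C \<in> component_sets"
  obtains w where "C \<subseteq> zariski closure_of (range w)" "\<And>i j k. (\<lambda>x. w x $ i $ j $ k) \<in> param_polys 9"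
proof -
  consider "C = zariski closure_of A14_family" | \<nu> where "C = orbit_closure \<nu>"
    using assms unfolding component_sets_eq by blast
  then show ?thesis
  proof cases
    case 1
    then show ?thesis
      using that[OF _ param_polys_A14_param] closure_of_mono[OF A14_family_subset_range] by blast
  next
    case (2 \<nu>)
    show ?thesis
    proof (rule that)
      show "C \<subseteq> zariski closure_of range (\<lambda>x. adj_act (mat3 x) \<nu>)"
        unfolding 2 by (intro closure_of_mono gl_orbit_subset_range)
    qed (intro param_polys_adj_act param_polys_mat3 param_polys.const order_refl)
  qed
qed

lemma krull_dim_assoc_variety: "krull_dim (assoc_variety :: 3 multiplication topology) = 9"
proof (rule antisym)
  let ?V = "assoc_variety :: 3 multiplication topology"
  have cl: "closedin ?V Z \<longleftrightarrow> closedin zariski Z \<and> Z \<subseteq> associative_algebras" for Z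
    by (simp add: assoc_variety_def closedin_closed_subtopology closedin_associative)
  have ir: "irreducible_in ?V Z \<longleftrightarrow> Z \<subseteq> associative_algebras \<and> irreducible_in zariski Z" for Z
    by (simp add: assoc_variety_def irreducible_in_closed_subtopology closedin_associative)
  show "krull_dim ?V \<le> 9"
    unfolding krull_dim_def
  proof (rule Sup_least)
    fix m assume "m \<in> {enat n | n. \<exists>Z. (\<forall>i\<le>n. closedin ?V (Z i) \<and> irreducible_in ?V (Z i)) \<and> (\<forall>i<n. Z i \<subset> Z (Suc i))}"
    then obtain n and Z :: "nat \<Rightarrow> 3 multiplication set" where m: "m = enat n" and Z: "\<forall>i\<le>n. closedin zariski (Z i) \<and> irreducible_in zariski (Z i)"
        "\<forall>i<n. Z i \<subset> Z (Suc i)" and "Z n \<subseteq> associative_algebras"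
      unfolding cl ir by blast
    then have "Z n \<subseteq> \<Union>component_sets" using associative_in_components by blast
    moreover have "irreducible_in zariski (Z n)" using Z(1) by simp
    moreover have "finite component_sets" by (simp add: component_sets_def)
    ultimately obtain C where C: "C \<in> component_sets" "Z n \<subseteq> C"
      using irreducible_in_finite_Union component_closed by metis
    obtain w where w: "C \<subseteq> zariski closure_of (range w)" "\<And>i j k. (\<lambda>x. w x $ i $ j $ k) \<in> param_polys 9"
      using component_param[OF C(1)] by metis
    have "n \<le> 9" by (rule chain_length_le_params[OF Z _ w(2)]) (use C(2) w(1) in blast)
    then show "m \<le> 9" by (simp add: m numeral_eq_enat)
  qed
  have "enat 9 \<le> krull_dim ?V"
    unfolding krull_dim_def
  proof (rule Sup_upper, rule CollectI, intro exI conjI)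
    show "\<forall>i\<le>9. closedin ?V (chain_set i) \<and> irreducible_in ?V (chain_set i)"
      unfolding cl ir using chain_set_irreducible chain_set_associative by (simp add: chain_set_def)
    show "\<forall>i<9. chain_set i \<subset> chain_set (Suc i)" using chain_set_strict by blast
  qed simp
  then show "9 \<le> krull_dim ?V" by (simp add: numeral_eq_enat)
qed

theorem theorem34:
  shows "krull_dim (assoc_variety :: 3 multiplication topology) = 9 \<and>
    irreducible_components assoc_variety =
      {zariski closure_of gl_orbit A07,
       zariski closure_of gl_orbit A17,
       zariski closure_of gl_orbit A18,
       zariski closure_of gl_orbit A19,
       zariski closure_of gl_orbit A20,
       zariski closure_of gl_orbit A23,
       zariski closure_of gl_orbit A24,
       zariski closure_of (\<Union>\<alpha>\<in>- {0}. gl_orbit (A14 \<alpha>))} \<and>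
    card (irreducible_components (assoc_variety :: 3 multiplication topology)) = 8 \<and>
    card ({\<mu> :: 3 multiplication. rigid_algebra \<mu>} // {(\<mu>, \<nu>). alg_isomorphic \<mu> \<nu>}) = 7"
  using krull_dim_assoc_variety card_component_sets card_rigid_classes
  unfolding irreducible_components_assoc_variety component_sets_def A14_family_def by blast

end
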